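(* Let $p>1$ and $s\in(0,1)$ with $sp'>1$ and $sp<n$, and let $$r\in\bigg(\max\Big\{1,\frac{np}{(p-1)\big[n+p(sp'-1)\big]}\Big\},\ \frac{n}{(p-1)(sp'-1)}\bigg).$$ Set $$u(x)=\frac{1}{|x|^{\gamma}},\quad \gamma=\frac{n}{r(p-1)}-sp',\qquad f(x)=\frac{C}{|x|^{n/r}},\quad C=\mathrm{p.v.}\int_{\mathbb{R}^n}\frac{\big|1-|y|^{-\gamma}\big|^{p-2}\big(1-|y|^{-\gamma}\big)}{|e-y|^{n+sp}}\,dy,$$ where $e$ is a unit vector in $\mathbb{R}^n$. Then $(-\Delta_p)^su=f$ pointwise in $\mathbb{R}^n\setminus\{0\}$, $u\in W^{s,p}_{\mathrm{loc}}(\mathbb{R}^n)\cap L^{p-1}_{sp}(\mathbb{R}^n)$, and $u$ is a local weak solution of $(-\Delta_p)^su=f$ in $B_1$. Furthermore $f\in L^{\tilde r}(B_1)$ for every $\tilde r<r$, and, with $$q=\frac{rn(p-1)}{n-r(p-1)(sp'-1)},$$ one has $|\nabla u|\in L^{\tilde q}(B_1)$ for every $\tilde q<q$, while $|\nabla u|\notin L^q(B_1)$. Consequently, the assumption $f\in L^r_{\mathrm{loc}}$ is optimal to conclude that $|\nabla u|\in L^q_{\mathrm{loc}}$ for local weak solutions: it cannot be relaxed to $f\in L^{\tilde r}_{\mathrm{loc}}$ for some $\tilde r<r$ while still guaranteeing $|\nabla u|\in L^q_{\mathrm{loc}}$.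
   Context: Notation: $p'=\frac{p}{p-1}$; $B_1$ is the open unit ball centered at the origin of $\mathbb{R}^n$. Operator: $(-\Delta_p)^su(x)=\mathrm{p.v.}\int_{\mathbb{R}^n}\frac{|u(x)-u(y)|^{p-2}(u(x)-u(y))}{|x-y|^{n+sp}}\,dy$. $u\in L^{p-1}_{sp}(\mathbb{R}^n)$ means $\int_{\mathbb{R}^n}\frac{|u(x)|^{p-1}}{(1+|x|)^{n+sp}}dx<\infty$. $W^{s,p}$ is the space of $L^p$-functions with finite Gagliardo seminorm $[w]_{W^{s,p}(\Omega)}^p=\iint_{\Omega\times\Omega}\frac{|w(x)-w(y)|^p}{|x-y|^{n+sp}}\,dx\,dy$. Local weak solution in a bounded open set $\Omega$: for $f\in L^{t}_{\mathrm{loc}}(\Omega)$ with $t\ge\frac{np}{np-n+sp}$ (case $sp<n$), a function $u\in W^{s,p}_{\mathrm{loc}}(\Omega)\cap L^{p-1}_{sp}(\mathbb{R}^n)$ is a local weak solution to $(-\Delta_p)^su=f$ in $\Omega$ if $$\iint_{\mathbb{R}^n\times\mathbb{R}^n}\frac{|u(x)-u(y)|^{p-2}(u(x)-u(y))(\varphi(x)-\varphi(y))}{|x-y|^{n+sp}}\,dx\,dy=2\int_\Omega f\varphi\,dx$$ for every $\varphi\in W^{s,p}(\mathbb{R}^n)$ with $\mathrm{spt}(\varphi)\Subset\Omega$.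
   Formalization: The claim |∇u| ∉ L^q(B_1) is proved for γ ≠ 0 only: if γ = 0, i.e. r = n/(sp), which is admissible exactly when n > p, then u = 1 and ∇u = 0, so that claim fails. All other claims, including optimality, hold for the full range of r. *)

theory Defs
  imports "HOL-Analysis.Analysis"
begin

definition Lp :: "real \<Rightarrow> 'a::euclidean_space set \<Rightarrow> ('a \<Rightarrow> real) set" where
  "Lp p \<Omega> = {f. f \<in> borel_measurable (lebesgue_on \<Omega>) \<and>
                 integrable (lebesgue_on \<Omega>) (\<lambda>x. \<bar>f x\<bar> powr p)}"

definition Lp_loc :: "real \<Rightarrow> 'a::euclidean_space set \<Rightarrow> ('a \<Rightarrow> real) set" where
  "Lp_loc p \<Omega> = {f. \<forall>K. compact K \<and> K \<subseteq> \<Omega> \<longrightarrow> f \<in> Lp p K}"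

definition tail_space :: "real \<Rightarrow> real \<Rightarrow> ('a::euclidean_space \<Rightarrow> real) set" where
  "tail_space s p = {u. u \<in> borel_measurable lebesgue \<and>
     integrable lebesgue
       (\<lambda>x. \<bar>u x\<bar> powr (p - 1) / (1 + norm x) powr (real DIM('a) + s * p))}"

definition compactly_contained :: "'a::topological_space set \<Rightarrow> 'a set \<Rightarrow> bool" where
  "compactly_contained A \<Omega> \<longleftrightarrow> compact (closure A) \<and> closure A \<subseteq> \<Omega>"

text \<open>Finiteness of the Gagliardo seminorm is integrability over \<open>\<Omega> \<times> \<Omega>\<close> with respect to
  Lebesgue measure on the product space; on the diagonal, a null set, the quotient is \<open>0\<close>.\<close>

definition Wsp :: "real \<Rightarrow> real \<Rightarrow> 'a::euclidean_space set \<Rightarrow> ('a \<Rightarrow> real) set" where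
  "Wsp s p \<Omega> = {w. w \<in> Lp p \<Omega> \<and>
     integrable (lebesgue_on (\<Omega> \<times> \<Omega>))
       (\<lambda>(x, y). \<bar>w x - w y\<bar> powr p / norm (x - y) powr (real DIM('a) + s * p))}"

definition Wsp_loc :: "real \<Rightarrow> real \<Rightarrow> 'a::euclidean_space set \<Rightarrow> ('a \<Rightarrow> real) set" where
  "Wsp_loc s p \<Omega> = {w. \<forall>\<Omega>'. open \<Omega>' \<and> compactly_contained \<Omega>' \<Omega> \<longrightarrow> w \<in> Wsp s p \<Omega>'}"

definition has_pv_integral :: "('a::euclidean_space \<Rightarrow> real) \<Rightarrow> 'a \<Rightarrow> real \<Rightarrow> bool" where
  "has_pv_integral g x L \<longleftrightarrow>
     (\<forall>\<epsilon>>0. integrable (lebesgue_on (- ball x \<epsilon>)) g) \<and>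
     ((\<lambda>\<epsilon>. integral\<^sup>L (lebesgue_on (- ball x \<epsilon>)) g) \<longlongrightarrow> L) (at_right 0)"

definition pv_integral :: "('a::euclidean_space \<Rightarrow> real) \<Rightarrow> 'a \<Rightarrow> real" where
  "pv_integral g x = (THE L. has_pv_integral g x L)"

lemma pv_integral_eqI:
  assumes "has_pv_integral g x L"
  shows "pv_integral g x = L"
  unfolding pv_integral_def
proof (rule the_equality)
  show "has_pv_integral g x L" by (rule assms)
next
  fix L' assume "has_pv_integral g x L'"
  with assms show "L' = L"
    unfolding has_pv_integral_def
    using tendsto_unique[OF trivial_limit_at_right_real] by blast
qed

text \<open>The nonlinearity \<open>|t|\<^sup>p\<^sup>-\<^sup>2 t\<close>; it is \<open>0\<close> at \<open>t = 0\<close> also when \<open>p < 2\<close>.\<close>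

definition Jp :: "real \<Rightarrow> real \<Rightarrow> real" where
  "Jp p t = \<bar>t\<bar> powr (p - 2) * t"

definition has_frac_p_Laplacian ::
    "real \<Rightarrow> real \<Rightarrow> ('a::euclidean_space \<Rightarrow> real) \<Rightarrow> 'a \<Rightarrow> real \<Rightarrow> bool" where
  "has_frac_p_Laplacian s p u x L \<longleftrightarrow>
     has_pv_integral (\<lambda>y. Jp p (u x - u y) / norm (x - y) powr (real DIM('a) + s * p)) x L"

text \<open>The threshold for the exponent \<open>t\<close> is the one for \<open>s * p < DIM('a)\<close>. Absolute convergence of
  both integrals is part of the definition because the Bochner integral of a non-integrable
  function is \<open>0\<close>. Test functions are representatives that vanish outside a compact subset of
  \<open>\<Omega>\<close>; every class with compact essential support in \<open>\<Omega>\<close> has one.\<close>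

definition local_weak_solution ::
    "real \<Rightarrow> real \<Rightarrow> 'a::euclidean_space set \<Rightarrow> ('a \<Rightarrow> real) \<Rightarrow> ('a \<Rightarrow> real) \<Rightarrow> bool" where
  "local_weak_solution s p \<Omega> f u \<longleftrightarrow>
     open \<Omega> \<and> bounded \<Omega> \<and>
     (\<exists>t. t \<ge> real DIM('a) * p / (real DIM('a) * p - real DIM('a) + s * p) \<and> f \<in> Lp_loc t \<Omega>) \<and>
     u \<in> Wsp_loc s p \<Omega> \<and> u \<in> tail_space s p \<and>
     (\<forall>\<phi>. \<phi> \<in> Wsp s p UNIV \<and> compactly_contained {x. \<phi> x \<noteq> 0} \<Omega> \<longrightarrow>
        (let F = (\<lambda>(x, y). Jp p (u x - u y) * (\<phi> x - \<phi> y) / norm (x - y) powr (real DIM('a) + s * p))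
         in integrable lebesgue F \<and> integrable (lebesgue_on \<Omega>) (\<lambda>x. f x * \<phi> x) \<and>
            integral\<^sup>L lebesgue F = 2 * integral\<^sup>L (lebesgue_on \<Omega>) (\<lambda>x. f x * \<phi> x)))"

primrec Ck :: "nat \<Rightarrow> ('a::euclidean_space \<Rightarrow> real) \<Rightarrow> bool" where
  "Ck 0 f \<longleftrightarrow> continuous_on UNIV f"
| "Ck (Suc k) f \<longleftrightarrow> (\<forall>x. f differentiable (at x)) \<and>
                     (\<forall>v. Ck k (\<lambda>x. frechet_derivative f (at x) v))"

definition test_functions :: "'a::euclidean_space set \<Rightarrow> ('a \<Rightarrow> real) set" where
  "test_functions \<Omega> = {\<phi>. (\<forall>k. Ck k \<phi>) \<and> compactly_contained {x. \<phi> x \<noteq> 0} \<Omega>}"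

definition is_weak_gradient ::
    "'a::euclidean_space set \<Rightarrow> ('a \<Rightarrow> real) \<Rightarrow> ('a \<Rightarrow> 'a) \<Rightarrow> bool" where
  "is_weak_gradient \<Omega> u G \<longleftrightarrow>
     u \<in> Lp_loc 1 \<Omega> \<and> (\<forall>b\<in>Basis. (\<lambda>x. G x \<bullet> b) \<in> Lp_loc 1 \<Omega>) \<and>
     (\<forall>\<phi>\<in>test_functions \<Omega>. \<forall>b\<in>Basis.
        integral\<^sup>L (lebesgue_on \<Omega>) (\<lambda>x. u x * frechet_derivative \<phi> (at x) b) =
        - integral\<^sup>L (lebesgue_on \<Omega>) (\<lambda>x. (G x \<bullet> b) * \<phi> x))"

end

theory Submission
  imports Defs
begin

text \<open>Put \<open>\<alpha> = \<gamma> (p - 1) + s p = n / r\<close>. The kernel of the operator applied to \<open>u\<close> depends only on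
  \<open>|x|\<close>, \<open>|y|\<close>, \<open>|x - y|\<close> and is homogeneous, so rotations and dilations reduce everything to the
  unit vector \<open>e\<close>. The inversion \<open>y \<mapsto> y / |y|\<^sup>2\<close> carries the part of the singular integral outside
  the unit ball to the inside, where it multiplies the integrand \<open>g\<close> by \<open>- |z|^(\<alpha> - n)\<close>. The sum of
  the two parts converges absolutely near \<open>e\<close>, because \<open>g\<close> is multiplied by \<open>1 - |z|^(\<alpha> - n)\<close>,
  which vanishes on the sphere.

  For the weak formulation cut out the symmetric homogeneous set \<open>|x - y| < \<epsilon> max |x| |y|\<close>. Off this set
  antisymmetry of the kernel and Fubini's theorem apply, since a weak Hardy inequality makes \<open>f \<phi>\<close>
  integrable; then let \<open>\<epsilon> \<rightarrow> 0\<close>. The gradient of \<open>u\<close> misses \<open>L\<^sup>q\<close> by scaling, and the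
  optimality of \<open>r\<close> follows by taking the same solution for a slightly smaller exponent.\<close>

section \<open>Changes of variables\<close>

text \<open>Since s p > p - 1, the kernel at \<open>e\<close> has order n + s p - (p - 1) > n there,
  although its numerator vanishes on the sphere. Estimates of absolute values therefore cannot work,
  and the cancellation must take place before the cut is removed. Inversion respects only the cut
  relative to max |x| |y|, whereas the principal value removes balls about x. Both cuts are carried
  along; the integrals differ by order eps^(p - s p), which tends to 0 because s < 1. The symmetric
  cut returns in the double integral, so that the pointwise and the weak equation share the constant
  \<open>c\<^sub>0\<close>. A test function lies only in W^(s,p), so the integrability of f \<phi>
  has to be proved; the Hardy argument draws it from the Gagliardo energy, in place of a Sobolev
  embedding. The value \<gamma> = 0 is admissible for some parameters. There u is constant off the
  origin and f = 0, so the gradient is claimed to miss the critical space only for \<gamma> \<noteq>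
  0, and the optimality argument steers clear of this value.\<close>

text \<open>The change of variables theorem of the library needs a well-ordered index type.\<close>

typedef 'n ordered_copy = "UNIV :: 'n set" ..

instance ordered_copy :: (finite) finite
proof
  have "(UNIV :: 'a ordered_copy set) = range Abs_ordered_copy"
    by (metis Rep_ordered_copy_inverse surj_def)
  then show "finite (UNIV :: 'a ordered_copy set)"
    by (metis finite finite_imageI)
qed

instantiation ordered_copy :: (finite) wellorder
begin

definition less_eq_ordered_copy :: "'a ordered_copy \<Rightarrow> 'a ordered_copy \<Rightarrow> bool"
  where "less_eq_ordered_copy a b \<longleftrightarrow> to_nat (Rep_ordered_copy a) \<le> to_nat (Rep_ordered_copy b)"

definition less_ordered_copy :: "'a ordered_copy \<Rightarrow> 'a ordered_copy \<Rightarrow> bool"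
  where "less_ordered_copy a b \<longleftrightarrow> to_nat (Rep_ordered_copy a) < to_nat (Rep_ordered_copy b)"

instance
proof
  fix P :: "'a ordered_copy \<Rightarrow> bool" and a
  assume *: "\<And>x. (\<And>y. y < x \<Longrightarrow> P y) \<Longrightarrow> P x"
  show "P a"
    by (induction "to_nat (Rep_ordered_copy a)" arbitrary: a rule: less_induct)
       (rule *, auto simp: less_ordered_copy_def)
qed (auto simp: less_eq_ordered_copy_def less_ordered_copy_def Rep_ordered_copy_inject)

end

definition reindex :: "real ^ 'n ordered_copy \<Rightarrow> real ^ 'n::finite"
  where "reindex x = (\<chi> i. x $ Abs_ordered_copy i)"

definition unreindex :: "real ^ 'n::finite \<Rightarrow> real ^ 'n ordered_copy"
  where "unreindex x = (\<chi> i. x $ Rep_ordered_copy i)"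

lemma reindex_unreindex [simp]: "reindex (unreindex x) = x"
  and unreindex_reindex [simp]: "unreindex (reindex y) = y"
  by (simp_all add: reindex_def unreindex_def vec_eq_iff Abs_ordered_copy_inverse Rep_ordered_copy_inverse)

lemma bij_Rep_ordered_copy: "bij Rep_ordered_copy"
  by (metis Abs_ordered_copy_inverse Rep_ordered_copy_inverse UNIV_I bijI')

lemma linear_reindex: "linear reindex" and linear_unreindex: "linear unreindex"
  by (auto intro!: linearI simp: reindex_def unreindex_def vec_eq_iff)

lemma inner_unreindex: "unreindex x \<bullet> unreindex y = x \<bullet> y"
  unfolding inner_vec_def unreindex_def
  by (simp add: sum.reindex_bij_betw[OF bij_Rep_ordered_copy, of "\<lambda>i. x $ i * y $ i"])

lemma norm_unreindex [simp]: "norm (unreindex x) = norm x"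
  by (simp add: norm_eq_sqrt_inner inner_unreindex)

lemma norm_reindex [simp]: "norm (reindex x) = norm x"
  by (metis norm_unreindex unreindex_reindex)

lemma reindex_measurable [measurable]: "reindex \<in> borel_measurable borel"
  and unreindex_measurable [measurable]: "unreindex \<in> borel_measurable borel"
  by (auto intro!: borel_measurable_continuous_onI linear_continuous_on linear_linear[THEN iffD2]
      simp: linear_reindex linear_unreindex linear_conv_bounded_linear[symmetric])

lemma prod_Basis_cart: "(\<Prod>b\<in>Basis. (x :: real ^ 'n) \<bullet> b) = (\<Prod>i\<in>UNIV. x $ i)"
proof -
  have B: "Basis = (\<lambda>i::'n. axis i (1::real)) ` UNIV" by (auto simp: Basis_vec_def)
  have i: "inj (\<lambda>i::'n. axis i (1::real))" by (auto simp: inj_on_def axis_eq_axis)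
  show ?thesis unfolding B prod.reindex[OF i] by (simp add: inner_axis)
qed

lemma lborel_distr_reindex: "distr lborel borel reindex = (lborel :: (real ^ 'n) measure)"
proof (rule lborel_eqI[symmetric])
  fix l u :: "real ^ 'n::_" assume le: "\<And>b. b \<in> Basis \<Longrightarrow> l \<bullet> b \<le> u \<bullet> b"
  have "l \<bullet> axis i 1 \<le> u \<bullet> axis i 1" for i using le by (auto simp: axis_in_Basis_iff)
  then have le': "l $ i \<le> u $ i" for i by (simp add: inner_axis)
  have "reindex -` box l u = box (unreindex l) (unreindex u)"
    by (auto simp: mem_box_cart reindex_def unreindex_def)
       (metis Rep_ordered_copy_inverse Abs_ordered_copy_inverse UNIV_I)+
  moreover have "unreindex l \<bullet> b \<le> unreindex u \<bullet> b" if "b \<in> Basis" for b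
    using that le' by (auto simp: Basis_vec_def inner_axis unreindex_def)
  moreover have "(\<Prod>b\<in>Basis. (unreindex u - unreindex l) \<bullet> b) = (\<Prod>b\<in>Basis. (u - l) \<bullet> b)"
    unfolding prod_Basis_cart unreindex_def
    by (simp add: prod.reindex_bij_betw[OF bij_Rep_ordered_copy, of "\<lambda>i. u $ i - l $ i"])
  ultimately show "emeasure (distr lborel borel reindex) (box l u) = (\<Prod>b\<in>Basis. (u - l) \<bullet> b)"
    by (simp add: emeasure_distr)
qed simp

text \<open>By injectivity, the integral of the Jacobian over the preimage of a box is the volume of
  the box, and boxes determine the measure. The origin is excluded because the inversion is not
  differentiable there; it is a null set.\<close>

lemma lborel_eq_distr_density:
  fixes g :: "real ^ 'n::{finite,wellorder} \<Rightarrow> real ^ 'n::_"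
  assumes [measurable]: "g \<in> borel_measurable borel" "D \<in> borel_measurable borel"
    and D0: "\<And>x. 0 \<le> D x"
    and der: "\<And>x. x \<noteq> 0 \<Longrightarrow> (g has_derivative g' x) (at x)"
    and D: "\<And>x. x \<noteq> 0 \<Longrightarrow> \<bar>det (matrix (g' x))\<bar> = D x"
    and inj: "inj_on g (- {0})" and surj: "g ` (- {0}) = - {0}"
  shows "lborel = distr (density lborel (\<lambda>x. ennreal (D x))) borel g"
proof (rule lborel_eqI)
  fix l u :: "real ^ 'n::_" assume le: "\<And>b. b \<in> Basis \<Longrightarrow> l \<bullet> b \<le> u \<bullet> b"
  define S where "S = g -` box l u \<inter> (- {0})"
  have Sb [measurable]: "S \<in> sets borel"
    unfolding S_def using measurable_sets[OF assms(1), of "box l u"] by auto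
  have gS: "g ` S = box l u - {0}"
  proof
    show "g ` S \<subseteq> box l u - {0}" using surj unfolding S_def by blast
    show "box l u - {0} \<subseteq> g ` S"
    proof
      fix y assume y: "y \<in> box l u - {0}"
      then have "y \<in> g ` (- {0})" using surj by simp
      then show "y \<in> g ` S" using y unfolding S_def by auto
    qed
  qed
  have meas: "box l u - {0} \<in> lmeasurable" by (intro fmeasurable.Diff) (auto simp: lmeasurable_cbox[of 0 0, simplified])
  have "emeasure lebesgue (box l u - {0}) = emeasure lebesgue (box l u)"
    by (rule emeasure_Diff_null_set) auto
  then have content: "measure lebesgue (box l u - {0}) = (\<Prod>b\<in>Basis. (u - l) \<bullet> b)"
    using le by (simp add: measure_def prod_nonneg inner_diff_left)
  have "((\<lambda>x. \<bar>det (matrix (g' x))\<bar>) has_integral (\<Prod>b\<in>Basis. (u - l) \<bullet> b)) S"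
  proof (rule has_measure_differentiable_image[THEN iffD1])
    show "S \<in> sets lebesgue" using Sb by simp
    show "(g has_derivative g' x) (at x within S)" if "x \<in> S" for x
      using that der[of x] by (simp add: S_def has_derivative_at_withinI)
    show "inj_on g S" using inj by (rule inj_on_subset) (auto simp: S_def)
    show "g ` S \<in> lmeasurable \<and> measure lebesgue (g ` S) = (\<Prod>b\<in>Basis. (u - l) \<bullet> b)"
      using meas content gS by simp
  qed
  then have "(D has_integral (\<Prod>b\<in>Basis. (u - l) \<bullet> b)) S"
    by (rule has_integral_eq[rotated]) (auto simp: D S_def)
  then have "((\<lambda>x. if x \<in> S then D x else 0) has_integral (\<Prod>b\<in>Basis. (u - l) \<bullet> b)) UNIV"
    by (simp only: has_integral_restrict_UNIV)
  moreover have "(\<lambda>x. if x \<in> S then D x else 0) = (\<lambda>x. indicator S x * D x)" by (simp add: fun_eq_iff)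
  ultimately have *: "(\<integral>\<^sup>+x. ennreal (indicator S x * D x) \<partial>lborel) = ennreal (\<Prod>b\<in>Basis. (u - l) \<bullet> b)"
    by (intro nn_integral_has_integral_lborel) (simp_all add: D0)
  have "emeasure (distr (density lborel D) borel g) (box l u) = (\<integral>\<^sup>+x. ennreal (D x) * indicator (g -` box l u) x \<partial>lborel)"
    using measurable_sets[OF assms(1), of "box l u"] by (simp add: emeasure_distr emeasure_density)
  also have "\<dots> = (\<integral>\<^sup>+x. ennreal (indicator S x * D x) \<partial>lborel)"
    using AE_lborel_singleton[of 0]
    by (intro nn_integral_cong_AE) (auto elim!: eventually_mono simp: S_def split: split_indicator)
  finally show "emeasure (distr (density lborel D) borel g) (box l u) = (\<Prod>b\<in>Basis. (u - l) \<bullet> b)"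
    using * by simp
qed simp

lemma lborel_distr_orthogonal_wellorder:
  fixes g :: "real ^ 'n::{finite,wellorder} \<Rightarrow> real ^ 'n::_"
  assumes "orthogonal_transformation g"
  shows "distr lborel borel g = lborel"
proof -
  have l: "linear g" using assms by (simp add: orthogonal_transformation_def)
  have i: "inj g" and s: "surj g"
    using assms by (auto simp: orthogonal_transformation_inj orthogonal_transformation_surj)
  have "g 0 = 0" using l by (rule linear_0)
  have "lborel = distr (density lborel (\<lambda>x. ennreal 1)) borel g"
  proof (rule lborel_eq_distr_density[where g' = "\<lambda>_. g"])
    show "g \<in> borel_measurable borel"
      using l by (simp add: borel_measurable_continuous_onI linear_continuous_on linear_conv_bounded_linear)
    show "(g has_derivative g) (at x)" for x
      using l by (simp add: linear_imp_has_derivative)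
    show "inj_on g (- {0})" using i by (rule inj_on_subset) simp
    show "g ` (- {0}) = - {0}"
      using i s \<open>g 0 = 0\<close> by (metis bij_def bij_image_Compl_eq image_empty image_insert)
    show "\<bar>det (matrix g)\<bar> = 1" using assms by simp
  qed auto
  then show ?thesis by (simp add: density_1)
qed

lemma linear_conj_unreindex:
  assumes "linear g" shows "linear (\<lambda>x. unreindex (g (reindex x)))"
  using linear_compose[OF linear_compose[OF linear_reindex assms] linear_unreindex] by (simp add: o_def)

lemma lborel_distr_orthogonal:
  fixes g :: "real ^ 'n \<Rightarrow> real ^ 'n"
  assumes g: "orthogonal_transformation g"
  shows "distr lborel borel g = lborel"
proof -
  let ?g = "\<lambda>x. unreindex (g (reindex x))"
  have l: "linear g" using g by (simp add: orthogonal_transformation_def)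
  have [measurable]: "g \<in> borel_measurable borel"
    using l by (simp add: borel_measurable_continuous_onI linear_continuous_on linear_conv_bounded_linear)
  have o: "orthogonal_transformation ?g"
    using g linear_conj_unreindex[OF l] by (simp add: orthogonal_transformation)
  have "distr lborel borel g = distr (distr lborel borel reindex) borel g"
    by (simp add: lborel_distr_reindex)
  also have "\<dots> = distr lborel borel (\<lambda>x. reindex (?g x))"
    by (simp add: distr_distr o_def)
  also have "\<dots> = distr (distr lborel borel ?g) borel reindex"
    by (simp add: distr_distr o_def)
  finally show ?thesis
    by (simp add: lborel_distr_orthogonal_wellorder[OF o] lborel_distr_reindex)
qed

section \<open>Inversion in the unit sphere\<close>

definition inversion :: "'a::real_inner \<Rightarrow> 'a"
  where "inversion x = x /\<^sub>R (norm x)\<^sup>2"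

lemma inversion_measurable [measurable]:
  "(inversion :: 'a::euclidean_space \<Rightarrow> 'a) \<in> borel_measurable borel"
  unfolding inversion_def[abs_def] by measurable

lemma norm_inversion: "norm (inversion x) = 1 / norm x"
  by (cases "x = 0") (auto simp: inversion_def field_simps power2_eq_square)

text \<open>This includes the origin, which is a fixed point because division by zero gives
  zero.\<close>

lemma inversion_inversion [simp]: "inversion (inversion x) = x"
  by (cases "x = 0") (auto simp: inversion_def field_simps power2_eq_square)

lemma inversion_eq_0_iff [simp]: "inversion x = 0 \<longleftrightarrow> x = 0"
  by (auto simp: inversion_def)

text \<open>Expand both squares and use |e| = 1. Through this identity the kernel and the cut at
  \<open>e\<close> pass through the inversion.\<close>

lemma norm_diff_inversion:
  fixes e z :: "'a::real_inner"
  assumes "norm e = 1" "z \<noteq> 0"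
  shows "norm (e - inversion z) = norm (e - z) / norm z"
proof (rule power2_eq_imp_eq)
  have "e \<bullet> e = 1" using assms by (simp add: dot_square_norm)
  then show "(norm (e - inversion z))\<^sup>2 = (norm (e - z) / norm z)\<^sup>2"
    using assms unfolding power_divide power2_norm_eq_inner inversion_def
    by (simp add: inner_simps field_simps power2_eq_square inner_commute)
qed auto

text \<open>The derivative at x is the reflection \<open>Q\<close> in the hyperplane orthogonal to
  x, scaled by \<open>c\<close> = |x|^(-2). Hence the Jacobian is \<open>c\<close> to the power
  n.\<close>

lemma lborel_inversion_wellorder:
  "(lborel :: (real ^ 'n::{finite,wellorder}) measure)
    = distr (density lborel (\<lambda>x. ennreal (norm x powr (- 2 * real CARD('n))))) borel inversion"
proof (rule lborel_eq_distr_density)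
  fix x :: "real ^ 'n::_" assume x: "x \<noteq> 0"
  define c where "c = inverse ((norm x)\<^sup>2)"
  define Q where "Q h = h - (2 * (x \<bullet> h) / (x \<bullet> x)) *\<^sub>R x" for h
  have xx: "x \<bullet> x \<noteq> 0" using x by simp
  have lQ: "linear Q"
    unfolding Q_def
    by (rule linearI) (simp_all add: inner_add_right distrib_left add_divide_distrib scaleR_add_left scaleR_diff_right)
  have "Q h \<bullet> Q h = h \<bullet> h" for h
  proof -
    define t where "t = 2 * (x \<bullet> h) / (x \<bullet> x)"
    have t: "t * (x \<bullet> x) = 2 * (x \<bullet> h)" using xx by (simp add: t_def)
    have "Q h = h - t *\<^sub>R x" by (simp add: Q_def t_def)
    then have "Q h \<bullet> Q h = h \<bullet> h - 2 * t * (x \<bullet> h) + t * (t * (x \<bullet> x))"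
      by (simp only: inner_diff_left inner_diff_right inner_commute[of h x] inner_scaleR_left inner_scaleR_right)
         (simp add: algebra_simps)
    then show ?thesis by (simp add: t)
  qed
  then have oQ: "orthogonal_transformation Q"
    using lQ by (simp add: orthogonal_transformation norm_eq_sqrt_inner)
  show "(inversion has_derivative (\<lambda>h. c *\<^sub>R Q h)) (at x)"
  proof -
    have "((\<lambda>x. x \<bullet> x) has_derivative (\<lambda>h. x \<bullet> h + h \<bullet> x)) (at x)"
      by (rule has_derivative_inner[OF has_derivative_ident has_derivative_ident])
    from has_derivative_scaleR[OF Deriv.has_derivative_inverse[OF xx this] has_derivative_ident]
    have "((\<lambda>x. inverse (x \<bullet> x) *\<^sub>R x) has_derivative
      (\<lambda>h. inverse (x \<bullet> x) *\<^sub>R h + (- (inverse (x \<bullet> x) * (x \<bullet> h + h \<bullet> x) * inverse (x \<bullet> x))) *\<^sub>R x)) (at x)" .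
    moreover have "inverse (x \<bullet> x) *\<^sub>R h + (- (inverse (x \<bullet> x) * (x \<bullet> h + h \<bullet> x) * inverse (x \<bullet> x))) *\<^sub>R x = c *\<^sub>R Q h" for h
      unfolding c_def Q_def power2_norm_eq_inner scaleR_diff_right scaleR_scaleR
      by (simp add: inner_commute[of h x] divide_inverse mult.commute mult.left_commute)
    ultimately show ?thesis
      unfolding inversion_def[abs_def] power2_norm_eq_inner by simp
  qed
  have "matrix (\<lambda>h. c *\<^sub>R Q h) = matrix ((*\<^sub>R) c) ** matrix Q"
    using lQ matrix_compose[of Q "(*\<^sub>R) c"] by (simp add: o_def linear_scale_self)
  then have "\<bar>det (matrix (\<lambda>h. c *\<^sub>R Q h))\<bar> = c ^ CARD('n)"
    using oQ by (simp add: det_mul det_matrix_scaleR abs_mult c_def)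
  also have "\<dots> = norm x powr (- 2 * real CARD('n))"
  proof -
    have "c ^ CARD('n) = inverse ((norm x ^ 2) ^ CARD('n))" by (simp add: c_def power_inverse)
    also have "\<dots> = inverse (norm x ^ (2 * CARD('n)))" by (simp only: power_mult)
    also have "\<dots> = inverse (norm x powr (real (2 * CARD('n))))"
      by (subst powr_realpow) (use x in simp_all)
    also have "\<dots> = norm x powr (- 2 * real CARD('n))" by (simp add: powr_minus)
    finally show ?thesis .
  qed
  finally show "\<bar>det (matrix (\<lambda>h. c *\<^sub>R Q h))\<bar> = norm x powr (- 2 * real CARD('n))" .
next
  show "inj_on inversion (- {0} :: (real ^ 'n::_) set)"
    by (metis inj_onI inversion_inversion)
  show "inversion ` (- {0}) = (- {0} :: (real ^ 'n::_) set)"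
    by (auto simp: image_iff) (metis ComplI inversion_eq_0_iff inversion_inversion singletonD)
qed auto

lemma inversion_reindex: "inversion (reindex x) = reindex (inversion x)"
  unfolding inversion_def norm_reindex by (simp add: linear_scale[OF linear_reindex])

lemma lborel_inversion:
  "(lborel :: (real ^ 'n) measure)
    = distr (density lborel (\<lambda>x. ennreal (norm x powr (- 2 * real CARD('n))))) borel inversion"
proof (rule measure_eqI)
  fix A :: "(real ^ 'n) set" assume "A \<in> sets lborel"
  then have A [measurable]: "A \<in> sets borel" by simp
  have card: "CARD('n ordered_copy) = CARD('n)"
    using bij_Rep_ordered_copy by (rule bij_betw_same_card)
  define a where "a = - 2 * real CARD('n)"
  have L: "(lborel :: (real ^ 'n ordered_copy) measure) = distr (density lborel (\<lambda>x. ennreal (norm x powr a))) borel inversion"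
    unfolding a_def card[symmetric] by (rule lborel_inversion_wellorder)
  have nn_reindex: "(\<integral>\<^sup>+x. h x \<partial>lborel) = (\<integral>\<^sup>+x. h (reindex x) \<partial>lborel)"
    if [measurable]: "h \<in> borel_measurable borel" for h :: "real ^ 'n \<Rightarrow> ennreal"
    using nn_integral_distr[of reindex lborel borel h] by (simp add: lborel_distr_reindex)
  have "emeasure lborel A = (\<integral>\<^sup>+x. indicator A x \<partial>lborel)" by simp
  also have "\<dots> = (\<integral>\<^sup>+x. indicator A (reindex x) \<partial>lborel)"
    by (rule nn_reindex) simp
  also have "\<dots> = (\<integral>\<^sup>+x. ennreal (norm x powr a) * indicator A (inversion (reindex x)) \<partial>lborel)"
    using nn_integral_distr[of inversion "density lborel (\<lambda>x::real ^ 'n ordered_copy. ennreal (norm x powr a))"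
      borel "\<lambda>x. indicator A (reindex x)"]
    unfolding L[symmetric] by (simp add: nn_integral_density inversion_reindex)
  also have "\<dots> = (\<integral>\<^sup>+x. ennreal (norm x powr a) * indicator A (inversion x) \<partial>lborel)"
    by (subst nn_reindex) simp_all
  also have "\<dots> = (\<integral>\<^sup>+x. indicator A x \<partial>distr (density lborel (\<lambda>x. ennreal (norm x powr a))) borel inversion)"
    by (simp add: nn_integral_distr nn_integral_density del: nn_integral_indicator)
  finally show "emeasure lborel A = emeasure (distr (density lborel (\<lambda>x. ennreal (norm x powr (- 2 * real CARD('n))))) borel inversion) A"
    by (simp add: a_def)
qed simp

lemma nn_integral_inversion:
  fixes h :: "real ^ 'n \<Rightarrow> ennreal"
  assumes [measurable]: "h \<in> borel_measurable borel"
  shows "(\<integral>\<^sup>+x. h x \<partial>lborel) = (\<integral>\<^sup>+x. norm x powr (- 2 * real CARD('n)) * h (inversion x) \<partial>lborel)"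
  using nn_integral_distr[of inversion "density lborel (\<lambda>x::real ^ 'n. ennreal (norm x powr (- 2 * real CARD('n))))" borel h]
  unfolding lborel_inversion[symmetric] by (simp add: nn_integral_density)

lemma integrable_inversion_iff:
  fixes h :: "real ^ 'n \<Rightarrow> real"
  assumes [measurable]: "h \<in> borel_measurable borel"
  shows "integrable lborel h \<longleftrightarrow> integrable lborel (\<lambda>x. norm x powr (- 2 * real CARD('n)) * h (inversion x))"
  using integrable_distr_eq[of inversion "density lborel (\<lambda>x::real ^ 'n. ennreal (norm x powr (- 2 * real CARD('n))))" borel h]
  unfolding lborel_inversion[symmetric] by (simp add: integrable_density)

lemma integral_inversion:
  fixes h :: "real ^ 'n \<Rightarrow> real"
  assumes [measurable]: "h \<in> borel_measurable borel"
  shows "integral\<^sup>L lborel h = (\<integral>x. norm x powr (- 2 * real CARD('n)) * h (inversion x) \<partial>lborel)"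
  using integral_distr[of inversion "density lborel (\<lambda>x::real ^ 'n. ennreal (norm x powr (- 2 * real CARD('n))))" borel h]
  unfolding lborel_inversion[symmetric] by (simp add: integral_density)

text \<open>\<open>S\<close> is a rotation that turns \<open>e\<close> into the direction of x,
  followed by the dilation by |x|.\<close>

lemma similarity_exists:
  fixes e x :: "real ^ 'n"
  assumes e: "norm e = 1" and x: "x \<noteq> 0"
  obtains S :: "real ^ 'n \<Rightarrow> real ^ 'n"
  where "linear S" "S e = x" "\<And>z. norm (S z) = norm x * norm z" "S \<in> borel_measurable borel"
    "lborel = density (distr lborel borel S) (\<lambda>_. ennreal (norm x powr real CARD('n)))"
proof -
  obtain Q where Q: "orthogonal_transformation Q" "Q e = x /\<^sub>R norm x"
    using orthogonal_transformation_exists[of e "x /\<^sub>R norm x"] e x by auto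
  have lQ: "linear Q" using Q by (simp add: orthogonal_transformation_def)
  have [measurable]: "Q \<in> borel_measurable borel"
    using lQ by (simp add: borel_measurable_continuous_onI linear_continuous_on linear_conv_bounded_linear)
  define S where "S z = norm x *\<^sub>R Q z" for z
  have S [measurable]: "S \<in> borel_measurable borel" unfolding S_def by measurable
  have "(lborel :: (real ^ 'n) measure)
      = density (distr lborel borel (\<lambda>z. 0 + norm x *\<^sub>R z)) (\<lambda>_. ennreal (\<bar>norm x\<bar> ^ DIM(real ^ 'n)))"
    using x by (intro lborel_affine) simp
  also have "distr lborel borel (\<lambda>z. 0 + norm x *\<^sub>R z) = distr lborel borel S"
    using distr_distr[of "\<lambda>z. 0 + norm x *\<^sub>R z" borel borel Q lborel]
    by (simp add: lborel_distr_orthogonal[OF Q(1)] o_def S_def[abs_def])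
  also have "\<bar>norm x\<bar> ^ DIM(real ^ 'n) = norm x powr real CARD('n)"
    using x by (simp add: powr_realpow)
  finally have L: "lborel = density (distr lborel borel S) (\<lambda>_. ennreal (norm x powr real CARD('n)))" .
  show thesis
  proof (rule that[OF _ _ _ S L])
    show "linear S" using linear_compose_scale_right[OF lQ, of "norm x"] by (simp add: S_def[abs_def])
    show "S e = x" using Q x by (simp add: S_def)
    show "norm (S z) = norm x * norm z" for z
      using Q(1) by (simp add: S_def orthogonal_transformation)
  qed
qed

section \<open>Integrals of powers\<close>

lemma borel_ball [measurable]: "ball (x :: 'a::metric_space) r \<in> sets borel"
  by simp

lemma nn_integral_lborel_translate:
  fixes h :: "'a::euclidean_space \<Rightarrow> ennreal"
  assumes [measurable]: "h \<in> borel_measurable borel"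
  shows "(\<integral>\<^sup>+y. h (a + y) \<partial>lborel) = (\<integral>\<^sup>+y. h y \<partial>lborel)"
  using nn_integral_distr[of "(+) a" lborel borel h] by (simp add: lborel_distr_plus)

text \<open>For a > 0 the ball is cut into dyadic shells. Between the radii R / 2^(k+1) and R / 2^k
  the integrand is at most \<open>c k\<close>; bounding the shell by the full ball leaves a
  geometric series of ratio \<open>q\<close> = 2^(a - n), where n is the dimension.\<close>

lemma nn_integral_power_ball_0:
  fixes R a :: real
  assumes R: "R > 0" and a: "a < DIM('a)"
  shows "(\<integral>\<^sup>+y. ennreal (indicator (ball (0::'a::euclidean_space) R) y * norm y powr (- a)) \<partial>lborel) < \<infinity>"
proof -
  define m where "m = measure lebesgue (ball (0::'a) 1)"
  have m0: "m \<ge> 0" by (simp add: m_def)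
  have ball: "emeasure lborel (ball (0::'a) r) = ennreal (r ^ DIM('a) * m)" if "r \<ge> 0" for r
    using content_ball_conv_unit_ball[OF that, of "0::'a"] emeasure_lborel_ball_finite[of "0::'a" r]
    by (subst emeasure_eq_ennreal_measure) (auto simp: m_def)
  show ?thesis
  proof (cases "a \<le> 0")
    case True
    have "(\<integral>\<^sup>+y. ennreal (indicator (ball (0::'a) R) y * norm y powr (- a)) \<partial>lborel)
        \<le> (\<integral>\<^sup>+y. ennreal (R powr (- a)) * indicator (ball (0::'a) R) y \<partial>lborel)"
      using True by (intro nn_integral_mono) (auto simp: indicator_def powr_mono2)
    also have "\<dots> < \<infinity>"
      using R by (subst nn_integral_cmult_indicator) (simp_all add: ball ennreal_mult'[symmetric])
    finally show ?thesis .
  next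
    case False
    define c where "c k = (R / 2 ^ Suc k) powr (- a)" for k :: nat
    define q where "q = 2 powr (a - DIM('a))"
    have q: "0 < q" "q < 1"
      using a powr_less_mono[of "a - DIM('a)" 0 2] by (auto simp: q_def)
    have bound: "ennreal (indicator (ball (0::'a) R) y * norm y powr (- a))
        \<le> (\<Sum>k. ennreal (c k) * indicator (ball 0 (R / 2 ^ k)) y)" for y :: 'a
    proof (cases "y \<in> ball 0 R \<and> y \<noteq> 0")
      case True
      then have y: "0 < norm y" "norm y < R" by auto
      have "\<exists>k. R / 2 ^ Suc k \<le> norm y"
      proof -
        obtain k where "R / norm y < 2 ^ k"
          using real_arch_pow[of 2 "R / norm y"] by auto
        then have "R < norm y * 2 ^ k" using y by (simp add: field_simps)
        also have "\<dots> \<le> norm y * 2 ^ Suc k" by simp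
        finally have "R / 2 ^ Suc k \<le> norm y" by (simp add: divide_le_eq)
        then show ?thesis ..
      qed
      define k where "k = (LEAST k. R / 2 ^ Suc k \<le> norm y)"
      have k1: "R / 2 ^ Suc k \<le> norm y"
        unfolding k_def using \<open>\<exists>k. R / 2 ^ Suc k \<le> norm y\<close> by (rule LeastI_ex)
      have k2: "norm y < R / 2 ^ k"
      proof (cases k)
        case 0 then show ?thesis using y by simp
      next
        case (Suc j)
        then have "\<not> R / 2 ^ Suc j \<le> norm y"
          using not_less_Least[of j "\<lambda>k. R / 2 ^ Suc k \<le> norm y"] by (simp add: k_def)
        then show ?thesis using Suc by simp
      qed
      have "norm y powr (- a) \<le> c k"
        unfolding c_def using k1 R False by (intro powr_mono2') auto
      then have "ennreal (indicator (ball (0::'a) R) y * norm y powr (- a))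
          \<le> ennreal (c k) * indicator (ball 0 (R / 2 ^ k)) y"
        using k2 True by (simp add: ennreal_leI)
      also have "\<dots> \<le> (\<Sum>k. ennreal (c k) * indicator (ball 0 (R / 2 ^ k)) y)"
      proof -
        define F where "F k = ennreal (c k) * indicator (ball 0 (R / 2 ^ k)) y" for k
        have "F k \<le> suminf F" using sum_le_suminf[of F "{k}"] by simp
        then show ?thesis unfolding F_def .
      qed
      finally show ?thesis .
    qed (use False in \<open>auto simp: indicator_def\<close>)
    have summand: "c k * ((R / 2 ^ k) ^ DIM('a) * m) = (R powr (DIM('a) - a) * 2 powr a * m) * q ^ k" for k
    proof -
      have "c k = R powr (- a) * (2 powr a * (2 powr a) ^ k)"
        using R unfolding c_def
        by (simp add: powr_divide powr_minus powr_mult powr_powr powr_realpow[symmetric] field_simps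
              powr_add[symmetric])
      moreover have "(R / 2 ^ k) ^ DIM('a) = R powr DIM('a) * (2 powr (- DIM('a))) ^ k"
      proof -
        have "((2::real) ^ k) ^ DIM('a) = (2 ^ DIM('a)) ^ k"
          by (simp add: power_mult[symmetric] mult.commute)
        then have "(R / 2 ^ k) ^ DIM('a) = R ^ DIM('a) * (inverse (2 ^ DIM('a))) ^ k"
          by (simp add: divide_inverse power_mult_distrib power_inverse)
        then show ?thesis using R by (simp add: powr_realpow powr_minus)
      qed
      moreover have "q ^ k = (2 powr a) ^ k * (2 powr (- DIM('a))) ^ k"
        by (simp add: q_def powr_add[symmetric] power_mult_distrib[symmetric])
      moreover have "R powr (DIM('a) - a) = R powr (- a) * R powr DIM('a)"
        by (simp add: powr_add[symmetric])
      ultimately show ?thesis by simp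
    qed
    have "(\<integral>\<^sup>+y. ennreal (indicator (ball (0::'a) R) y * norm y powr (- a)) \<partial>lborel)
        \<le> (\<integral>\<^sup>+y. (\<Sum>k. ennreal (c k) * indicator (ball 0 (R / 2 ^ k)) (y::'a)) \<partial>lborel)"
      by (intro nn_integral_mono bound)
    also have "\<dots> = (\<Sum>k. ennreal (c k) * emeasure lborel (ball (0::'a) (R / 2 ^ k)))"
      by (subst nn_integral_suminf) (simp_all add: nn_integral_cmult)
    also have "\<dots> = (\<Sum>k. ennreal ((R powr (DIM('a) - a) * 2 powr a * m) * q ^ k))"
      using R m0 by (simp add: ball ennreal_mult'[symmetric] c_def[symmetric] summand[symmetric])
         (simp add: ennreal_mult'[symmetric] c_def)
    also have "\<dots> < \<infinity>"
      using q m0 by (subst suminf_ennreal2) (auto intro!: summable_mult summable_geometric)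
    finally show ?thesis .
  qed
qed

lemma nn_integral_power_ball:
  fixes R a :: real and x :: "'a::euclidean_space"
  assumes a: "a < DIM('a)"
  shows "(\<integral>\<^sup>+y. ennreal (indicator (ball x R) y * norm (x - y) powr (- a)) \<partial>lborel) < \<infinity>"
proof (cases "R > 0")
  case True
  have "(\<integral>\<^sup>+y. ennreal (indicator (ball x R) y * norm (x - y) powr (- a)) \<partial>lborel)
      = (\<integral>\<^sup>+y. ennreal (indicator (ball x R) (x + y) * norm (x - (x + y)) powr (- a)) \<partial>lborel)"
    using nn_integral_lborel_translate[of "\<lambda>y. ennreal (indicator (ball x R) y * norm (x - y) powr (- a))" x] by simp
  also have "\<dots> = (\<integral>\<^sup>+y. ennreal (indicator (ball (0::'a) R) y * norm y powr (- a)) \<partial>lborel)"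
    by (intro nn_integral_cong) (auto simp: indicator_def dist_norm)
  finally show ?thesis using nn_integral_power_ball_0[OF True a] by simp
next
  case False
  then have "ball x R = {}" by simp
  then show ?thesis by (simp only:) simp
qed

text \<open>Inversion turns the exterior into the punctured closed unit ball and the exponent a into
  2 n - a, which is below n exactly when a > n.\<close>

lemma nn_integral_power_outside:
  fixes a :: real
  assumes a: "a > CARD('n)"
  shows "(\<integral>\<^sup>+y. ennreal (indicator (- ball (0 :: real ^ 'n) 1) y * norm y powr (- a)) \<partial>lborel) < \<infinity>"
proof -
  have "(\<integral>\<^sup>+y. ennreal (indicator (- ball (0 :: real ^ 'n) 1) y * norm y powr (- a)) \<partial>lborel)
     = (\<integral>\<^sup>+y. norm y powr (- 2 * real CARD('n)) * ennreal (indicator (- ball (0 :: real ^ 'n) 1) (inversion y) * norm (inversion y) powr (- a)) \<partial>lborel)"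
    using nn_integral_inversion[of "\<lambda>y. ennreal (indicator (- ball (0 :: real ^ 'n) 1) y * norm y powr (- a))"] by simp
  also have "\<dots> \<le> (\<integral>\<^sup>+y. ennreal (indicator (ball (0 :: real ^ 'n) 2) y * norm y powr (- (2 * real CARD('n) - a))) \<partial>lborel)"
  proof (intro nn_integral_mono)
    fix y :: "real ^ 'n"
    show "ennreal (norm y powr (- 2 * real CARD('n))) * ennreal (indicator (- ball (0 :: real ^ 'n) 1) (inversion y) * norm (inversion y) powr (- a))
       \<le> ennreal (indicator (ball (0 :: real ^ 'n) 2) y * norm y powr (- (2 * real CARD('n) - a)))"
    proof (cases "y = 0 \<or> norm y > 1")
      case True
      then have "inversion y \<in> ball 0 1" by (auto simp: norm_inversion divide_less_eq)
      then show ?thesis by simp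
    next
      case False
      then have "norm (inversion y) powr (- a) = norm y powr a"
        by (simp add: norm_inversion powr_divide powr_minus)
      then have "norm y powr (- 2 * real CARD('n)) * norm (inversion y) powr (- a) = norm y powr (- (2 * real CARD('n) - a))"
        by (simp add: powr_add[symmetric])
      then show ?thesis using False
        by (simp add: ennreal_mult'[symmetric] indicator_def)
    qed
  qed
  also have "\<dots> < \<infinity>" using a by (intro nn_integral_power_ball_0) auto
  finally show ?thesis .
qed

lemma powr_le_two_powr_abs:
  fixes t c :: real
  assumes "1 / 2 \<le> t" "t \<le> 2"
  shows "t powr c \<le> 2 powr \<bar>c\<bar>"
proof (cases "c \<ge> 0")
  case True
  then show ?thesis using assms by (simp add: powr_mono2)
next
  case False
  then have "t powr c \<le> (1 / 2) powr c" using assms by (intro powr_mono2') auto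
  also have "\<dots> = 2 powr \<bar>c\<bar>" using False by (simp add: powr_divide powr_minus_divide)
  finally show ?thesis .
qed

text \<open>The singularities 0 and \<open>e\<close> are at distance 1. For |y| <= 1/2 the factor
  with e - y is bounded, for 1/2 < |y| < 2 the factor with y is, and the other factor is integrable
  on its own.\<close>

lemma nn_integral_two_powers:
  fixes a b :: real and e :: "'a::euclidean_space"
  assumes e: "norm e = 1" and a: "a < DIM('a)" and b: "b < DIM('a)"
  shows "(\<integral>\<^sup>+y. ennreal (indicator (ball 0 2) y * (norm y powr (- a) * norm (e - y) powr (- b))) \<partial>lborel) < \<infinity>"
proof -
  have "(\<integral>\<^sup>+y. ennreal (indicator (ball 0 2) y * (norm y powr (- a) * norm (e - y) powr (- b))) \<partial>lborel)
     \<le> (\<integral>\<^sup>+y. ennreal (2 powr \<bar>b\<bar>) * ennreal (indicator (ball 0 2) y * norm (0 - y) powr (- a))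
          + ennreal (2 powr \<bar>a\<bar>) * ennreal (indicator (ball e 4) y * norm (e - y) powr (- b)) \<partial>lborel)"
  proof (intro nn_integral_mono)
    fix y :: 'a
    have t1: "norm e \<le> norm (e - y) + norm y" using norm_triangle_ineq[of "e - y" y] by simp
    have t2: "norm (e - y) \<le> norm e + norm y" by (rule norm_triangle_ineq4)
    have "indicator (ball 0 2) y * (norm y powr (- a) * norm (e - y) powr (- b))
      \<le> 2 powr \<bar>b\<bar> * (indicator (ball 0 2) y * norm y powr (- a)) + 2 powr \<bar>a\<bar> * (indicator (ball e 4) y * norm (e - y) powr (- b))"
    proof (cases "norm y < 2")
      case y: True
      show ?thesis
      proof (cases "norm y \<le> 1 / 2")
        case True
        then have "norm (e - y) powr (- b) \<le> 2 powr \<bar>- b\<bar>"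
          using t1 t2 e by (intro powr_le_two_powr_abs) auto
        from mult_left_mono[OF this, of "norm y powr (- a)"]
        have "norm y powr (- a) * norm (e - y) powr (- b) \<le> 2 powr \<bar>b\<bar> * norm y powr (- a)"
          by (simp add: mult.commute)
        then show ?thesis using y by (intro add_increasing2) auto
      next
        case False
        then have "norm y powr (- a) \<le> 2 powr \<bar>- a\<bar>"
          using y by (intro powr_le_two_powr_abs) auto
        from mult_right_mono[OF this, of "norm (e - y) powr (- b)"]
        have "norm y powr (- a) * norm (e - y) powr (- b) \<le> 2 powr \<bar>a\<bar> * norm (e - y) powr (- b)" by simp
        moreover have "y \<in> ball e 4" using t2 y e by (simp add: dist_norm)
        ultimately show ?thesis using y by (intro add_increasing) auto
      qed
    qed simp
    then show "ennreal (indicator (ball 0 2) y * (norm y powr (- a) * norm (e - y) powr (- b)))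
      \<le> ennreal (2 powr \<bar>b\<bar>) * ennreal (indicator (ball 0 2) y * norm (0 - y) powr (- a))
          + ennreal (2 powr \<bar>a\<bar>) * ennreal (indicator (ball e 4) y * norm (e - y) powr (- b))"
      by (simp add: ennreal_mult'[symmetric] ennreal_plus[symmetric] ennreal_leI del: ennreal_plus)
  qed
  also have "\<dots> < \<infinity>"
    using nn_integral_power_ball[OF a, of 0 2] nn_integral_power_ball[OF b, of e 4]
    by (subst nn_integral_add) (simp_all add: nn_integral_cmult ennreal_mult_less_top)
  finally show ?thesis .
qed

section \<open>Homogeneous radial kernels\<close>

text \<open>The arguments of \<open>k\<close> are meant to be |x|, |y| and |x - y|. Homogeneity is
  required only for nonnegative arguments, where \<open>powr\<close> is multiplicative.\<close>

locale radial_kernel =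
  fixes k :: "real \<Rightarrow> real \<Rightarrow> real \<Rightarrow> real" and d :: real
  assumes homogeneous: "\<And>t a b c. t > 0 \<Longrightarrow> a \<ge> 0 \<Longrightarrow> b \<ge> 0 \<Longrightarrow> c \<ge> 0 \<Longrightarrow> k (t * a) (t * b) (t * c) = t powr d * k a b c"
    and kernel_measurable: "\<And>a. (\<lambda>(b, c). k a b c) \<in> borel_measurable (borel \<Otimes>\<^sub>M borel)"
begin

lemma kernel_measurable' [measurable (raw)]:
  assumes [measurable]: "f \<in> borel_measurable M" "g \<in> borel_measurable M"
  shows "(\<lambda>z. k a (f z) (g z)) \<in> borel_measurable M"
  using measurable_compose[OF _ kernel_measurable[of a], of "\<lambda>z. (f z, g z)"] by simp

text \<open>Substitute y = S z with the similarity that sends \<open>e\<close> to x. All three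
  arguments scale by |x|, which yields the exponent \<open>d\<close> from the kernel and n from the
  volume.\<close>

lemma radial_kernel_scaling:
  fixes e x :: "real ^ 'n"
  assumes e: "norm e = 1" and x: "x \<noteq> 0"
  shows nn_integral_radial_kernel: "(\<integral>\<^sup>+y. ennreal (k (norm x) (norm y) (norm (x - y))) \<partial>lborel)
      = ennreal (norm x powr (real CARD('n) + d)) * (\<integral>\<^sup>+z. ennreal (k 1 (norm z) (norm (e - z))) \<partial>lborel)"
    and integrable_radial_kernel: "integrable lborel (\<lambda>y. k (norm x) (norm y) (norm (x - y)))
      \<longleftrightarrow> integrable lborel (\<lambda>z. k 1 (norm z) (norm (e - z)))"
    and integral_radial_kernel: "(\<integral>y. k (norm x) (norm y) (norm (x - y)) \<partial>lborel)
      = norm x powr (real CARD('n) + d) * (\<integral>z. k 1 (norm z) (norm (e - z)) \<partial>lborel)"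
proof -
  obtain S :: "real ^ 'n \<Rightarrow> real ^ 'n"
    where S: "linear S" "S e = x" "\<And>z. norm (S z) = norm x * norm z" "S \<in> borel_measurable borel"
      and L: "lborel = density (distr lborel borel S) (\<lambda>_. ennreal (norm x powr real CARD('n)))"
    using similarity_exists[OF e x] by metis
  note [measurable] = S(4)
  let ?h = "\<lambda>y. k (norm x) (norm y) (norm (x - y))"
  have h [measurable]: "?h \<in> borel_measurable borel" by measurable
  have diff: "norm (x - S z) = norm x * norm (e - z)" for z
    using S(3)[of "e - z"] by (simp add: linear_diff[OF S(1)] S(2))
  have hS: "?h (S z) = norm x powr d * k 1 (norm z) (norm (e - z))" for z
    unfolding diff S(3) using homogeneous[of "norm x" 1 "norm z" "norm (e - z)"] x by simp
  have pos: "norm x powr real CARD('n) > 0" "norm x powr d > 0" using x by auto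
  have "(\<integral>\<^sup>+y. ennreal (?h y) \<partial>lborel) = (\<integral>\<^sup>+y. ennreal (?h y) \<partial>density (distr lborel borel S) (\<lambda>_. ennreal (norm x powr real CARD('n))))"
    using L by simp
  also have "\<dots> = (\<integral>\<^sup>+z. ennreal (norm x powr real CARD('n)) * ennreal (?h (S z)) \<partial>lborel)"
    by (simp add: nn_integral_density nn_integral_distr)
  also have "\<dots> = (\<integral>\<^sup>+z. ennreal (norm x powr (real CARD('n) + d)) * ennreal (k 1 (norm z) (norm (e - z))) \<partial>lborel)"
    unfolding hS by (simp add: ennreal_mult' powr_add mult.assoc)
  also have "\<dots> = ennreal (norm x powr (real CARD('n) + d)) * (\<integral>\<^sup>+z. ennreal (k 1 (norm z) (norm (e - z))) \<partial>lborel)"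
    by (rule nn_integral_cmult) measurable
  finally show "(\<integral>\<^sup>+y. ennreal (?h y) \<partial>lborel)
      = ennreal (norm x powr (real CARD('n) + d)) * (\<integral>\<^sup>+z. ennreal (k 1 (norm z) (norm (e - z))) \<partial>lborel)" .
  have "integrable lborel ?h \<longleftrightarrow> integrable (density (distr lborel borel S) (\<lambda>_. ennreal (norm x powr real CARD('n)))) ?h"
    using L by simp
  also have "\<dots> \<longleftrightarrow> integrable lborel (\<lambda>z. norm x powr real CARD('n) *\<^sub>R ?h (S z))"
    by (subst integrable_density) (auto simp: integrable_distr_eq)
  also have "\<dots> \<longleftrightarrow> integrable lborel (\<lambda>z. k 1 (norm z) (norm (e - z)))"
    unfolding hS using pos by (simp only: integrable_mult_right_iff real_scaleR_def) simp
  finally show "integrable lborel ?h \<longleftrightarrow> integrable lborel (\<lambda>z. k 1 (norm z) (norm (e - z)))" .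
  have "integral\<^sup>L lborel ?h = integral\<^sup>L (density (distr lborel borel S) (\<lambda>_. ennreal (norm x powr real CARD('n)))) ?h"
    using L by simp
  also have "\<dots> = (\<integral>z. norm x powr real CARD('n) *\<^sub>R ?h (S z) \<partial>lborel)"
    by (subst integral_density) (auto simp: integral_distr)
  also have "\<dots> = norm x powr (real CARD('n) + d) * (\<integral>z. k 1 (norm z) (norm (e - z)) \<partial>lborel)"
    unfolding hS by (simp add: powr_add mult.assoc)
  finally show "integral\<^sup>L lborel ?h = norm x powr (real CARD('n) + d) * (\<integral>z. k 1 (norm z) (norm (e - z)) \<partial>lborel)" .
qed

end

section \<open>The operator applied to a power\<close>

lemma abs_Jp: "\<bar>Jp p t\<bar> = \<bar>t\<bar> powr (p - 1)"
proof (cases "t = 0")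
  case False
  then have "\<bar>t\<bar> powr (p - 2) * \<bar>t\<bar> powr 1 = \<bar>t\<bar> powr (p - 1)"
    by (simp only: powr_add[symmetric]) simp
  then show ?thesis using False by (simp add: Jp_def abs_mult)
qed (simp add: Jp_def)

lemma Jp_0 [simp]: "Jp p 0 = 0"
  by (simp add: Jp_def)

lemma Jp_minus: "Jp p (- t) = - Jp p t"
  by (simp add: Jp_def)

lemma Jp_mult: "t > 0 \<Longrightarrow> Jp p (t * x) = t powr (p - 1) * Jp p x"
proof -
  assume t: "t > 0"
  have "t powr (p - 2) * t = t powr (p - 1)"
    using t powr_add[of t "p - 2" 1] by simp
  then show ?thesis using t by (simp add: Jp_def abs_mult powr_mult mult_ac)
qed

lemma Jp_measurable [measurable]: "Jp p \<in> borel_measurable borel"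
  unfolding Jp_def[abs_def] by measurable

text \<open>Below 1/2 the factor |1 - b| is at least 1/2, so only a possible blow-up of b^(-c)
  counts; above 1/2 the mean value theorem supplies |1 - b|. This factor later becomes the zero of
  the kernels on the unit sphere.\<close>

lemma abs_one_minus_powr_le:
  fixes c :: real
  obtains L where "L \<ge> 0"
    "\<And>b. 0 < b \<Longrightarrow> b \<le> 2 \<Longrightarrow> \<bar>1 - b powr (- c)\<bar> \<le> L * \<bar>1 - b\<bar> * b powr (- max c 0)"
proof -
  \<comment> \<open>A bound for the derivative of b^(-c) on the interval from 1/2 to 2.\<close>
  define M where "M = \<bar>c\<bar> * 2 powr \<bar>c + 1\<bar>"
  have M0: "M \<ge> 0" by (simp add: M_def)
  show thesis
  proof (rule that[of "M * 2 powr \<bar>c\<bar> + 2"])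
    show "0 \<le> M * 2 powr \<bar>c\<bar> + 2" using M0 by simp
    fix b :: real assume b: "0 < b" "b \<le> 2"
    show "\<bar>1 - b powr (- c)\<bar> \<le> (M * 2 powr \<bar>c\<bar> + 2) * \<bar>1 - b\<bar> * b powr (- max c 0)"
    proof (cases "b < 1 / 2")
      case True
      have "\<bar>1 - b powr (- c)\<bar> \<le> max 1 (b powr (- c))" using powr_ge_zero[of b "- c"] by (simp add: abs_if max_def)
      also have "\<dots> \<le> b powr (- max c 0)"
      proof (cases "c \<ge> 0")
        case True
        have "1 \<le> b powr (- c)" using powr_mono'[of "- c" 0 b] True \<open>b < 1 / 2\<close> b by simp
        then show ?thesis using True by simp
      next
        case False
        have "b powr (- c) \<le> 1" using powr_mono'[of 0 "- c" b] False True b by simp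
        then show ?thesis using False b by simp
      qed
      also have "\<dots> \<le> (2 * \<bar>1 - b\<bar>) * b powr (- max c 0)"
        using True mult_right_mono[of 1 "2 * \<bar>1 - b\<bar>" "b powr (- max c 0)"] by simp
      also have "\<dots> \<le> (M * 2 powr \<bar>c\<bar> + 2) * \<bar>1 - b\<bar> * b powr (- max c 0)"
        using M0 by (intro mult_right_mono) auto
      finally show ?thesis .
    next
      case False
      have "\<bar>b powr (- c) - 1 powr (- c)\<bar> \<le> M * \<bar>b - 1\<bar>"
      proof (rule field_differentiable_bound[where S = "{1 / 2..2}" and f = "\<lambda>b. b powr (- c)" and f' = "\<lambda>b. (- c) * b powr (- c - 1)", unfolded real_norm_def])
        fix z :: real assume z: "z \<in> {1 / 2..2}"
        then show "((\<lambda>b. b powr (- c)) has_field_derivative (- c) * z powr (- c - 1)) (at z within {1 / 2..2})"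
          by (intro has_field_derivative_at_within[OF has_real_derivative_powr]) auto
        have "z powr (- c - 1) \<le> 2 powr \<bar>- c - 1\<bar>" using z by (intro powr_le_two_powr_abs) auto
        moreover have "\<bar>- c - 1\<bar> = \<bar>c + 1\<bar>" by simp
        ultimately show "\<bar>(- c) * z powr (- c - 1)\<bar> \<le> M"
          unfolding M_def abs_mult by (intro mult_mono) auto
      qed (use False b in auto)
      then have "\<bar>1 - b powr (- c)\<bar> \<le> M * \<bar>1 - b\<bar>" by (simp add: abs_minus_commute)
      also have "1 \<le> 2 powr \<bar>c\<bar> * b powr (- max c 0)"
      proof -
        have "b powr (max c 0) \<le> 2 powr \<bar>max c 0\<bar>" using b False by (intro powr_le_two_powr_abs) auto
        also have "\<dots> \<le> 2 powr \<bar>c\<bar>" by (intro powr_mono) auto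
        finally show ?thesis using b by (simp add: powr_minus field_simps)
      qed
      then have "(M * \<bar>1 - b\<bar>) * 1 \<le> (M * \<bar>1 - b\<bar>) * (2 powr \<bar>c\<bar> * b powr (- max c 0))"
        using M0 by (intro mult_left_mono) auto
      then have "M * \<bar>1 - b\<bar> \<le> (M * 2 powr \<bar>c\<bar>) * \<bar>1 - b\<bar> * b powr (- max c 0)"
        by (simp add: mult_ac)
      also have "\<dots> \<le> (M * 2 powr \<bar>c\<bar> + 2) * \<bar>1 - b\<bar> * b powr (- max c 0)"
        by (intro mult_right_mono) auto
      finally show ?thesis by simp
    qed
  qed
qed

lemma integrable_iff_nn_integral_finite:
  fixes f :: "'a \<Rightarrow> real"
  assumes "f \<in> borel_measurable M"
  shows "integrable M f \<longleftrightarrow> (\<integral>\<^sup>+x. ennreal \<bar>f x\<bar> \<partial>M) < \<infinity>"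
  using assms by (simp add: integrable_iff_bounded)

lemma integrable_dominated_nn:
  fixes f g :: "'a \<Rightarrow> real"
  assumes "f \<in> borel_measurable M" "AE x in M. \<bar>f x\<bar> \<le> A * g x" "A \<ge> 0" "g \<in> borel_measurable M"
    "(\<integral>\<^sup>+x. ennreal (g x) \<partial>M) < \<infinity>"
  shows "integrable M f"
proof -
  have "(\<integral>\<^sup>+x. ennreal \<bar>f x\<bar> \<partial>M) \<le> (\<integral>\<^sup>+x. ennreal A * ennreal (g x) \<partial>M)"
    using assms(2,3) by (intro nn_integral_mono_AE) (auto simp: ennreal_mult'[symmetric] intro: ennreal_leI elim!: eventually_mono)
  also have "\<dots> = ennreal A * (\<integral>\<^sup>+x. ennreal (g x) \<partial>M)"
    using assms by (intro nn_integral_cmult) simp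
  also have "\<dots> < \<infinity>" using assms by (simp add: ennreal_mult_less_top)
  finally show ?thesis using assms by (simp add: integrable_iff_nn_integral_finite)
qed

text \<open>The hypotheses on \<open>r\<close>, rewritten for \<gamma>: \<open>sp_gt\<close> is s p'
  > 1, \<open>gamma_gt\<close> is the upper bound on \<open>r\<close>, and \<open>gamma_lt\<close>
  and \<open>gamma_lt'\<close> are its two lower bounds. The last one says \<alpha> < n, while
  \<open>gamma_gt\<close> and \<open>sp_gt\<close> together give \<alpha> > 0.\<close>

locale power_solution =
  fixes n s p \<gamma> :: real and e :: "real ^ 'n"
  assumes n_eq: "n = real CARD('n)"
    and p_gt: "p > 1" and s_pos: "0 < s" and s_lt: "s < 1"
    and sp_gt: "p - 1 < s * p"
    and gamma_gt: "- 1 < \<gamma>" and gamma_lt: "\<gamma> < n / p - 1" and gamma_lt': "\<gamma> * (p - 1) < n - s * p"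
    and norm_e: "norm e = 1"
begin

definition \<alpha> where "\<alpha> = \<gamma> * (p - 1) + s * p"

text \<open>The integrand of the operator applied to u, as a function of |x|, |y| and |x -
  y|.\<close>

definition G where "G a b c = Jp p (a powr (- \<gamma>) - b powr (- \<gamma>)) / c powr (n + s * p)"

lemma n_pos: "n > 0" using n_eq by simp

lemma sp_less_p: "s * p < p" using s_lt p_gt by simp

lemma gamma_times: "- (p - 1) < \<gamma> * (p - 1)"
  using mult_strict_right_mono[OF gamma_gt, of "p - 1"] p_gt by simp

lemma alpha_pos: "\<alpha> > 0" and alpha_less: "\<alpha> < n"
  using gamma_times sp_gt gamma_lt' by (auto simp: \<alpha>_def)

lemma gamma_plus_less_alpha: "max \<gamma> 0 * (p - 1) < \<alpha>"
  using alpha_pos p_gt s_pos by (auto simp: \<alpha>_def max_def)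

lemma G_measurable [measurable]:
  assumes [measurable]: "f \<in> borel_measurable M" "g \<in> borel_measurable M" "h \<in> borel_measurable M"
  shows "(\<lambda>z. G (f z) (g z) (h z)) \<in> borel_measurable M"
  unfolding G_def by measurable

lemma G_homogeneous:
  assumes "t > 0" "a \<ge> 0" "b \<ge> 0" "c \<ge> 0"
  shows "G (t * a) (t * b) (t * c) = t powr (- (\<alpha> + n)) * G a b c"
proof -
  have "Jp p ((t * a) powr (- \<gamma>) - (t * b) powr (- \<gamma>)) = Jp p (t powr (- \<gamma>) * (a powr (- \<gamma>) - b powr (- \<gamma>)))"
    using assms by (simp add: powr_mult right_diff_distrib)
  also have "\<dots> = (t powr (- \<gamma>)) powr (p - 1) * Jp p (a powr (- \<gamma>) - b powr (- \<gamma>))"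
    using assms by (intro Jp_mult) auto
  finally have "G (t * a) (t * b) (t * c) = ((t powr (- \<gamma>)) powr (p - 1) / t powr (n + s * p)) * G a b c"
    using assms by (simp add: G_def powr_mult)
  moreover have "(t powr (- \<gamma>)) powr (p - 1) / t powr (n + s * p) = t powr (- (\<alpha> + n))"
    by (simp add: powr_powr powr_diff[symmetric] \<alpha>_def algebra_simps)
  ultimately show ?thesis by simp
qed

lemma G_swap: "G b a c = - G a b c"
  using Jp_minus[of p "a powr (- \<gamma>) - b powr (- \<gamma>)"] by (simp add: G_def)

definition g where "g y = G 1 (norm y) (norm (e - y))"

lemma g_measurable [measurable]: "g \<in> borel_measurable borel"
  unfolding g_def[abs_def] by measurable

lemma g_sphere: "norm y = 1 \<Longrightarrow> g y = 0"
  by (simp add: g_def G_def)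

lemma g_e: "g e = 0"
  by (simp add: g_sphere norm_e)

lemma abs_one_minus_norm_le: "\<bar>1 - norm y\<bar> \<le> norm (e - y)"
  using norm_triangle_ineq3[of e y] by (simp add: norm_e)

text \<open>The numerator vanishes on the unit sphere, and the distance of y to the sphere is at
  most |e - y|; this gains p - 1 powers at \<open>e\<close>. The remaining order n + s p - (p - 1)
  still exceeds n, so this bound does not make \<open>g\<close> integrable.\<close>

lemma g_bound:
  obtains L where "L \<ge> 0" "\<And>y. y \<noteq> 0 \<Longrightarrow> norm y \<le> 2 \<Longrightarrow>
    \<bar>g y\<bar> \<le> L * norm y powr (- (max \<gamma> 0 * (p - 1))) * norm (e - y) powr (- (n + s * p - (p - 1)))"
proof -
  obtain L where L: "L \<ge> 0"
    "\<And>b. 0 < b \<Longrightarrow> b \<le> 2 \<Longrightarrow> \<bar>1 - b powr (- \<gamma>)\<bar> \<le> L * \<bar>1 - b\<bar> * b powr (- max \<gamma> 0)"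
    by (rule abs_one_minus_powr_le[of \<gamma>]) blast
  show thesis
  proof (rule that[of "L powr (p - 1)"])
    fix y :: "real ^ 'n" assume y: "y \<noteq> 0" "norm y \<le> 2"
    have "\<bar>1 - norm y powr (- \<gamma>)\<bar> \<le> L * \<bar>1 - norm y\<bar> * norm y powr (- max \<gamma> 0)"
      using y L(2)[of "norm y"] by simp
    also have "\<dots> \<le> L * norm (e - y) * norm y powr (- max \<gamma> 0)"
      using L(1) abs_one_minus_norm_le[of y] by (intro mult_right_mono mult_left_mono) auto
    finally have "\<bar>1 - norm y powr (- \<gamma>)\<bar> powr (p - 1) \<le> (L * norm (e - y) * norm y powr (- max \<gamma> 0)) powr (p - 1)"
      using p_gt by (intro powr_mono2) auto
    also have "\<dots> = L powr (p - 1) * norm y powr (- (max \<gamma> 0 * (p - 1))) * norm (e - y) powr (p - 1)"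
      using L(1) by (simp add: powr_mult powr_powr)
    finally have "\<bar>1 - norm y powr (- \<gamma>)\<bar> powr (p - 1) / norm (e - y) powr (n + s * p)
       \<le> (L powr (p - 1) * norm y powr (- (max \<gamma> 0 * (p - 1))) * norm (e - y) powr (p - 1)) / norm (e - y) powr (n + s * p)"
      by (intro divide_right_mono) auto
    also have "\<dots> = L powr (p - 1) * norm y powr (- (max \<gamma> 0 * (p - 1))) * norm (e - y) powr (- (n + s * p - (p - 1)))"
      using powr_diff[of "norm (e - y)" "p - 1" "n + s * p"] by (simp add: algebra_simps)
    finally show "\<bar>g y\<bar> \<le> L powr (p - 1) * norm y powr (- (max \<gamma> 0 * (p - 1))) * norm (e - y) powr (- (n + s * p - (p - 1)))"
      by (simp add: g_def G_def abs_Jp)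
  qed simp
qed

text \<open>What is left of \<open>g\<close> in the unit ball once the exterior part has been
  reflected inside and added.\<close>

definition w where "w z = g z * (1 - norm z powr (\<alpha> - n))"

lemma w_measurable [measurable]: "w \<in> borel_measurable borel"
  unfolding w_def[abs_def] by measurable

text \<open>The factor 1 - |z|^(\<alpha> - n) contributes one more power of |e - z|, which lowers
  the order at \<open>e\<close> to n + s p - p < n. At the origin the order is max \<gamma> 0 times
  p - 1, plus n - \<alpha>, and this is below n by \<open>gamma_plus_less_alpha\<close>.\<close>

lemma integrable_w: "integrable lborel (\<lambda>z. indicator (ball 0 1) z * w z)"
proof -
  obtain L where L: "L \<ge> 0" "\<And>y. y \<noteq> 0 \<Longrightarrow> norm y \<le> 2 \<Longrightarrow>
    \<bar>g y\<bar> \<le> L * norm y powr (- (max \<gamma> 0 * (p - 1))) * norm (e - y) powr (- (n + s * p - (p - 1)))"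
    by (rule g_bound) blast
  obtain M where M: "M \<ge> 0"
    "\<And>b. 0 < b \<Longrightarrow> b \<le> 2 \<Longrightarrow> \<bar>1 - b powr (- (n - \<alpha>))\<bar> \<le> M * \<bar>1 - b\<bar> * b powr (- max (n - \<alpha>) 0)"
    by (rule abs_one_minus_powr_le[of "n - \<alpha>"]) blast
  show ?thesis
  proof (rule integrable_dominated_nn)
    show "(\<integral>\<^sup>+y. ennreal (indicator (ball 0 2) y * (norm y powr (- (max \<gamma> 0 * (p - 1) + (n - \<alpha>))) * norm (e - y) powr (- (n + s * p - p)))) \<partial>lborel) < \<infinity>"
      using gamma_plus_less_alpha sp_less_p by (intro nn_integral_two_powers norm_e) (auto simp: n_eq)
    have "\<bar>indicator (ball 0 1) z * w z\<bar> \<le> (L * M) * (indicator (ball 0 2) z * (norm z powr (- (max \<gamma> 0 * (p - 1) + (n - \<alpha>))) * norm (e - z) powr (- (n + s * p - p))))"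
      if "z \<noteq> 0" for z
    proof (cases "norm z < 1")
      case True
      have "\<bar>1 - norm z powr (- (n - \<alpha>))\<bar> \<le> M * \<bar>1 - norm z\<bar> * norm z powr (- max (n - \<alpha>) 0)"
        using True that by (intro M) auto
      also have "\<dots> \<le> M * norm (e - z) * norm z powr (- (n - \<alpha>))"
        using M(1) alpha_less abs_one_minus_norm_le[of z] by (simp add: max_def mult_mono)
      finally have 1: "\<bar>1 - norm z powr (\<alpha> - n)\<bar> \<le> M * norm (e - z) * norm z powr (- (n - \<alpha>))" by simp
      have "\<bar>w z\<bar> \<le> (L * norm z powr (- (max \<gamma> 0 * (p - 1))) * norm (e - z) powr (- (n + s * p - (p - 1)))) * (M * norm (e - z) * norm z powr (- (n - \<alpha>)))"
        unfolding w_def abs_mult using L True 1 that by (intro mult_mono) auto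
      also have "\<dots> = (L * M) * (norm z powr (- (max \<gamma> 0 * (p - 1))) * norm z powr (- (n - \<alpha>))) * (norm (e - z) powr (- (n + s * p - (p - 1))) * norm (e - z) powr 1)"
        by simp
      also have "\<dots> = (L * M) * (norm z powr (- (max \<gamma> 0 * (p - 1) + (n - \<alpha>))) * norm (e - z) powr (- (n + s * p - p)))"
        unfolding powr_add[symmetric] by (simp add: algebra_simps)
      finally show ?thesis using True by simp
    next
      case False
      then show ?thesis using L M by simp
    qed
    then show "AE z in lborel. \<bar>indicator (ball 0 1) z * w z\<bar> \<le> (L * M) * (indicator (ball 0 2) z * (norm z powr (- (max \<gamma> 0 * (p - 1) + (n - \<alpha>))) * norm (e - z) powr (- (n + s * p - p))))"
      using AE_lborel_singleton[of "0 :: real ^ 'n"] by (auto elim: eventually_mono)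
  qed (use L M in auto)
qed

text \<open>With c = 0 this treats the part inside the unit ball, with c = n - \<alpha> the
  reflected exterior part. Each must be integrable by itself before the two can be added.\<close>

lemma integrable_g_cut:
  assumes \<epsilon>: "\<epsilon> > 0" and c: "max \<gamma> 0 * (p - 1) + c < n"
  shows "integrable lborel (\<lambda>z. indicator (ball 0 1) z * (if \<epsilon> \<le> norm (e - z) then g z else 0) * norm z powr (- c))"
proof -
  obtain L where L: "L \<ge> 0" "\<And>y. y \<noteq> 0 \<Longrightarrow> norm y \<le> 2 \<Longrightarrow>
    \<bar>g y\<bar> \<le> L * norm y powr (- (max \<gamma> 0 * (p - 1))) * norm (e - y) powr (- (n + s * p - (p - 1)))"
    by (rule g_bound) blast
  let ?b = "n + s * p - (p - 1)"
  show ?thesis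
  proof (rule integrable_dominated_nn)
    show "(\<integral>\<^sup>+y. ennreal (indicator (ball (0 :: real ^ 'n) 1) y * norm y powr (- (max \<gamma> 0 * (p - 1) + c))) \<partial>lborel) < \<infinity>"
      using c by (intro nn_integral_power_ball_0) (auto simp: n_eq)
    show "AE z in lborel. \<bar>indicator (ball 0 1) z * (if \<epsilon> \<le> norm (e - z) then g z else 0) * norm z powr (- c)\<bar>
      \<le> (L * \<epsilon> powr (- ?b)) * (indicator (ball 0 1) z * norm z powr (- (max \<gamma> 0 * (p - 1) + c)))"
    proof (intro AE_I2)
      fix z :: "real ^ 'n"
      show "\<bar>indicator (ball 0 1) z * (if \<epsilon> \<le> norm (e - z) then g z else 0) * norm z powr (- c)\<bar>
      \<le> (L * \<epsilon> powr (- ?b)) * (indicator (ball 0 1) z * norm z powr (- (max \<gamma> 0 * (p - 1) + c)))"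
    proof (cases "z \<noteq> 0 \<and> norm z < 1 \<and> \<epsilon> \<le> norm (e - z)")
      case True
      have "norm (e - z) powr (- ?b) \<le> \<epsilon> powr (- ?b)"
        using True \<epsilon> sp_gt n_pos by (intro powr_mono2') auto
      then have "\<bar>g z\<bar> * norm z powr (- c) \<le> (L * norm z powr (- (max \<gamma> 0 * (p - 1))) * \<epsilon> powr (- ?b)) * norm z powr (- c)"
        using L(1) True by (intro mult_right_mono order_trans[OF L(2)] mult_left_mono) auto
      also have "\<dots> = (L * \<epsilon> powr (- ?b)) * norm z powr (- (max \<gamma> 0 * (p - 1) + c))"
        using powr_add[of "norm z" "- (max \<gamma> 0 * (p - 1))" "- c"] by simp
      finally show ?thesis using True by (simp add: abs_mult)
    next
      case False
      then show ?thesis using L by (auto simp: indicator_def)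
    qed
    qed
  qed (use L in auto)
qed

text \<open>The sign comes from 1 - |z|^\<gamma> = - |z|^\<gamma> (1 - |z|^(-\<gamma>)). The
  exponents -2 n of the volume, \<gamma> (p - 1) of \<open>Jp\<close> and n + s p of the denominator
  add up to \<alpha> - n.\<close>

lemma g_inversion:
  assumes z: "z \<noteq> 0"
  shows "norm z powr (- 2 * n) * g (inversion z) = - (g z * norm z powr (\<alpha> - n))"
proof -
  have 1: "norm (inversion z) powr (- \<gamma>) = norm z powr \<gamma>"
    using z by (simp add: norm_inversion powr_divide powr_minus_divide)
  have 2: "norm z powr \<gamma> * (1 - norm z powr (- \<gamma>)) = norm z powr \<gamma> - 1"
    using z by (simp add: right_diff_distrib powr_add[symmetric])
  have "Jp p (1 - norm (inversion z) powr (- \<gamma>)) = - Jp p (norm z powr \<gamma> * (1 - norm z powr (- \<gamma>)))"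
    unfolding 1 2 Jp_minus[symmetric] by simp
  also have "\<dots> = - (norm z powr (\<gamma> * (p - 1)) * Jp p (1 - norm z powr (- \<gamma>)))"
    using z by (subst Jp_mult) (auto simp: powr_powr)
  finally have "g (inversion z) = - (norm z powr (\<gamma> * (p - 1)) * norm z powr (n + s * p) * g z)"
    using z by (simp add: g_def G_def norm_diff_inversion[OF norm_e z] powr_divide)
  then have "norm z powr (- 2 * n) * g (inversion z)
      = - (norm z powr (- 2 * n) * norm z powr (\<gamma> * (p - 1)) * norm z powr (n + s * p) * g z)" by simp
  also have "norm z powr (- 2 * n) * norm z powr (\<gamma> * (p - 1)) * norm z powr (n + s * p) = norm z powr (\<alpha> - n)"
    unfolding powr_add[symmetric] \<alpha>_def by (simp add: algebra_simps)
  finally show ?thesis by simp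
qed

text \<open>Measuring the cut against the larger of |x| and |y| makes it symmetric and homogeneous.
  It also suits the inversion: the condition \<epsilon> |y| <= |e - y| outside the ball turns into
  \<epsilon> <= |e - z| inside.\<close>

definition dcut where "dcut \<epsilon> a b c = (if \<epsilon> * max a b \<le> c then G a b c else 0)" for \<epsilon> a b c

lemma dcut_integral:
  assumes \<epsilon>: "\<epsilon> > 0"
  shows "integrable lborel (\<lambda>y. dcut \<epsilon> 1 (norm y) (norm (e - y)))"
    and "(\<integral>y. dcut \<epsilon> 1 (norm y) (norm (e - y)) \<partial>lborel)
      = (\<integral>z. indicator (ball 0 1) z * (if \<epsilon> \<le> norm (e - z) then w z else 0) \<partial>lborel)"
proof -
  define A where "A y = indicator (ball 0 1) y * (if \<epsilon> \<le> norm (e - y) then g y else 0)" for y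
  define B where "B y = (if 1 < norm y \<and> \<epsilon> * norm y \<le> norm (e - y) then g y else 0)" for y
  define B' where "B' z = - (indicator (ball 0 1) z * (if \<epsilon> \<le> norm (e - z) then g z else 0) * norm z powr (- (n - \<alpha>)))" for z
  have [measurable]: "B \<in> borel_measurable borel" unfolding B_def[abs_def] by measurable
  have cut: "(\<lambda>y. dcut \<epsilon> 1 (norm y) (norm (e - y))) = (\<lambda>y. A y + B y)"
  proof
    fix y :: "real ^ 'n"
    consider "norm y < 1" | "norm y = 1" | "norm y > 1" by linarith
    then show "dcut \<epsilon> 1 (norm y) (norm (e - y)) = A y + B y"
    proof cases
      case 2 then show ?thesis using g_sphere[of y] by (auto simp: dcut_def A_def B_def g_def)
    qed (auto simp: dcut_def A_def B_def g_def max_def)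
  qed
  have inv: "norm z powr (- 2 * real CARD('n)) * B (inversion z) = B' z" for z
  proof (cases "z = 0")
    case False
    have eq: "1 < norm (inversion z) \<longleftrightarrow> norm z < 1"
      using False by (simp add: norm_inversion less_divide_eq)
    have eq': "\<epsilon> * norm (inversion z) \<le> norm (e - inversion z) \<longleftrightarrow> \<epsilon> \<le> norm (e - z)"
      using False by (simp add: norm_diff_inversion[OF norm_e False] norm_inversion divide_le_cancel)
    show ?thesis using g_inversion[OF False] unfolding B_def B'_def eq eq' n_eq[symmetric]
      by auto
  qed (simp add: B'_def)
  \<comment> \<open>The weight with exponent 0 equals 1 except at the origin, where
    \<open>powr\<close> gives 0; therefore it agrees with \<open>A\<close> only almost
    everywhere.\<close>
  have "integrable lborel (\<lambda>z. indicator (ball 0 1) z * (if \<epsilon> \<le> norm (e - z) then g z else 0) * norm z powr (- 0))"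
    using gamma_plus_less_alpha alpha_less by (intro integrable_g_cut \<epsilon>) auto
  then have A: "integrable lborel A"
  proof (rule integrable_cong_AE_imp)
    show "A \<in> borel_measurable lborel" unfolding A_def[abs_def] by measurable
    show "AE z in lborel. indicator (ball 0 1) z * (if \<epsilon> \<le> norm (e - z) then g z else 0) * norm z powr (- 0) = A z"
      by (rule eventually_mono[OF AE_lborel_singleton[of "0 :: real ^ 'n"]]) (simp add: A_def)
  qed
  have B': "integrable lborel B'" unfolding B'_def
    using gamma_plus_less_alpha by (intro Bochner_Integration.integrable_minus integrable_g_cut \<epsilon>) auto
  then have B: "integrable lborel B"
    by (subst integrable_inversion_iff) (auto simp: inv[simplified])
  show "integrable lborel (\<lambda>y. dcut \<epsilon> 1 (norm y) (norm (e - y)))"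
    unfolding cut using A B by simp
  have "(\<integral>y. dcut \<epsilon> 1 (norm y) (norm (e - y)) \<partial>lborel) = integral\<^sup>L lborel A + integral\<^sup>L lborel B"
    unfolding cut using A B by simp
  also have "integral\<^sup>L lborel B = integral\<^sup>L lborel B'"
    by (subst integral_inversion) (auto simp: inv[simplified])
  also have "integral\<^sup>L lborel A + integral\<^sup>L lborel B' = (\<integral>z. A z + B' z \<partial>lborel)"
    using A B' by simp
  also have "\<dots> = (\<integral>z. indicator (ball 0 1) z * (if \<epsilon> \<le> norm (e - z) then w z else 0) \<partial>lborel)"
    by (intro Bochner_Integration.integral_cong) (auto simp: A_def B'_def w_def algebra_simps)
  finally show "(\<integral>y. dcut \<epsilon> 1 (norm y) (norm (e - y)) \<partial>lborel)
      = (\<integral>z. indicator (ball 0 1) z * (if \<epsilon> \<le> norm (e - z) then w z else 0) \<partial>lborel)" .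
qed

definition c\<^sub>0 where "c\<^sub>0 = (\<integral>z. indicator (ball 0 1) z * w z \<partial>lborel)"

lemma dcut_tendsto: "((\<lambda>\<epsilon>. \<integral>y. dcut \<epsilon> 1 (norm y) (norm (e - y)) \<partial>lborel) \<longlongrightarrow> c\<^sub>0) (at_right 0)"
  unfolding tendsto_at_iff_sequentially
proof (intro allI impI)
  fix X :: "nat \<Rightarrow> real" assume X: "\<forall>i. X i \<in> {0<..} - {0}" "X \<longlonglongrightarrow> 0"
  have "(\<lambda>i. \<integral>z. indicator (ball 0 1) z * (if X i \<le> norm (e - z) then w z else 0) \<partial>lborel) \<longlonglongrightarrow> c\<^sub>0"
    unfolding c\<^sub>0_def
  proof (rule integral_dominated_convergence[where w = "\<lambda>z. \<bar>indicator (ball 0 1) z * w z\<bar>"])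
    show "integrable lborel (\<lambda>z. \<bar>indicator (ball 0 1) z * w z\<bar>)" by (rule integrable_abs[OF integrable_w])
    show "AE z in lborel. (\<lambda>i. indicator (ball 0 1) z * (if X i \<le> norm (e - z) then w z else 0)) \<longlonglongrightarrow> indicator (ball 0 1) z * w z"
    proof (intro AE_I2)
      fix z
      show "(\<lambda>i. indicator (ball 0 1) z * (if X i \<le> norm (e - z) then w z else 0)) \<longlonglongrightarrow> indicator (ball 0 1) z * w z"
      \<comment> \<open>Every cut removes the point \<open>e\<close>, which does no harm because
        \<open>w\<close> vanishes there.\<close>
      proof (cases "z = e")
        case True
        then have "w z = 0" by (simp add: w_def g_e)
        then show ?thesis by (simp cong: if_cong)
      next
        case False
        then have "eventually (\<lambda>i. X i < norm (e - z)) sequentially"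
          using order_tendstoD(2)[OF X(2), of "norm (e - z)"] by simp
        then show ?thesis
          by (intro tendsto_eventually) (erule eventually_mono, simp)
      qed
    qed
    show "AE z in lborel. norm (indicator (ball 0 1) z * (if X i \<le> norm (e - z) then w z else 0)) \<le> \<bar>indicator (ball 0 1) z * w z\<bar>" for i
      by (intro AE_I2) (auto simp: abs_mult)
  qed auto
  moreover have "(\<integral>y. dcut (X i) 1 (norm y) (norm (e - y)) \<partial>lborel)
     = (\<integral>z. indicator (ball 0 1) z * (if X i \<le> norm (e - z) then w z else 0) \<partial>lborel)" for i
    using X(1) by (intro dcut_integral(2)) auto
  ultimately show "((\<lambda>\<epsilon>. \<integral>y. dcut \<epsilon> 1 (norm y) (norm (e - y)) \<partial>lborel) \<circ> X) \<longlonglongrightarrow> c\<^sub>0"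
    by (simp add: o_def)
qed

end

section \<open>Reduction of Lebesgue integrals to Borel integrals\<close>

lemma borel_measurable_lebesgue_onI:
  fixes f :: "'a::euclidean_space \<Rightarrow> 'b::euclidean_space"
  assumes "f \<in> borel_measurable borel"
  shows "f \<in> borel_measurable (lebesgue_on A)"
  using assms by (intro measurable_restrict_space1 measurable_completion) simp

lemma
  fixes f :: "'a::euclidean_space \<Rightarrow> real"
  assumes f: "f \<in> borel_measurable borel" and A: "A \<in> sets borel"
  shows integrable_lebesgue_on_iff:
      "integrable (lebesgue_on A) f \<longleftrightarrow> integrable lborel (\<lambda>x. indicator A x * f x)"
    and integral_lebesgue_on_eq:
      "integral\<^sup>L (lebesgue_on A) f = (\<integral>x. indicator A x * f x \<partial>lborel)"
proof -
  have L: "A \<inter> space lebesgue \<in> sets lebesgue" using A by simp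
  have [measurable]: "(\<lambda>x. indicator A x * f x) \<in> borel_measurable lborel"
    using A f by simp
  show "integrable (lebesgue_on A) f \<longleftrightarrow> integrable lborel (\<lambda>x. indicator A x * f x)"
    using integrable_restrict_space[OF L, of f] by (simp add: integrable_completion)
  show "integral\<^sup>L (lebesgue_on A) f = (\<integral>x. indicator A x * f x \<partial>lborel)"
    using integral_restrict_space[OF L, of f] by (simp add: integral_completion)
qed

lemma Lp_borel_iff:
  fixes f :: "'a::euclidean_space \<Rightarrow> real"
  assumes [measurable]: "f \<in> borel_measurable borel" and A: "A \<in> sets borel"
  shows "f \<in> Lp p A \<longleftrightarrow> integrable lborel (\<lambda>x. indicator A x * \<bar>f x\<bar> powr p)"
  unfolding Lp_def using A by (simp add: borel_measurable_lebesgue_onI integrable_lebesgue_on_iff)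

context power_solution
begin

text \<open>With \<open>a\<close> = |x| this removes the ball of radius \<epsilon> |x| about x, as
  the principal value does. It is homogeneous like \<open>dcut\<close>, but not symmetric in x and
  y.\<close>

definition ucut where "ucut \<epsilon> a b c = (if \<epsilon> * a \<le> c then G a b c else 0)" for \<epsilon> a b c

lemma ucut_measurable [measurable]:
  assumes [measurable]: "f1 \<in> borel_measurable M" "f2 \<in> borel_measurable M" "f3 \<in> borel_measurable M"
  shows "(\<lambda>z. ucut \<epsilon> (f1 z) (f2 z) (f3 z)) \<in> borel_measurable M"
  unfolding ucut_def by measurable

lemma dcut_measurable [measurable]:
  assumes [measurable]: "f1 \<in> borel_measurable M" "f2 \<in> borel_measurable M" "f3 \<in> borel_measurable M"
  shows "(\<lambda>z. dcut \<epsilon> (f1 z) (f2 z) (f3 z)) \<in> borel_measurable M"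
  unfolding dcut_def by measurable

text \<open>The two cutoffs differ on a shell of width \<open>\<epsilon>\<^sup>2\<close> around the sphere of radius \<open>\<epsilon>\<close>.\<close>

lemma cut_difference:
  "\<exists>K. \<forall>\<epsilon>. 0 < \<epsilon> \<and> \<epsilon> \<le> 1 / 2 \<longrightarrow>
      integrable lborel (\<lambda>y. ucut \<epsilon> 1 (norm y) (norm (e - y)) - dcut \<epsilon> 1 (norm y) (norm (e - y))) \<and>
      \<bar>\<integral>y. ucut \<epsilon> 1 (norm y) (norm (e - y)) - dcut \<epsilon> 1 (norm y) (norm (e - y)) \<partial>lborel\<bar> \<le> K * \<epsilon> powr (p - s * p)"
proof -
  obtain L where L: "L \<ge> 0" "\<And>y. y \<noteq> 0 \<Longrightarrow> norm y \<le> 2 \<Longrightarrow>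
    \<bar>g y\<bar> \<le> L * norm y powr (- (max \<gamma> 0 * (p - 1))) * norm (e - y) powr (- (n + s * p - (p - 1)))"
    by (rule g_bound) blast
  define m where "m = measure lebesgue (ball (0 :: real ^ 'n) 1)"
  define b where "b = n + s * p - (p - 1)"
  define N where "N = CARD('n)"
  have m0: "m \<ge> 0" by (simp add: m_def)
  have *: "integrable lborel (\<lambda>y. ucut \<epsilon> 1 (norm y) (norm (e - y)) - dcut \<epsilon> 1 (norm y) (norm (e - y))) \<and>
      \<bar>\<integral>y. ucut \<epsilon> 1 (norm y) (norm (e - y)) - dcut \<epsilon> 1 (norm y) (norm (e - y)) \<partial>lborel\<bar> \<le> (L * m * 2 ^ N * N) * \<epsilon> powr (p - s * p)"
    if \<epsilon>: "0 < \<epsilon>" "\<epsilon> \<le> 1 / 2" for \<epsilon>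
  proof -
    let ?h = "\<lambda>y. ucut \<epsilon> 1 (norm y) (norm (e - y)) - dcut \<epsilon> 1 (norm y) (norm (e - y))"
    \<comment> \<open>Where the cuts differ, |y| > 1 and |e - y| < \<epsilon> |y|. Then |y| <= 1 +
      |e - y| forces |y| <= 1 / (1 - \<epsilon>), hence |e - y| < R.\<close>
    define R where "R = \<epsilon> / (1 - \<epsilon>)"
    have R: "\<epsilon> \<le> R" "0 < R" using \<epsilon> by (auto simp: R_def field_simps)
    have bound: "\<bar>?h y\<bar> \<le> (L * \<epsilon> powr (- b)) * indicator (ball e R - ball e \<epsilon>) y" for y
    proof (cases "\<epsilon> \<le> norm (e - y) \<and> norm (e - y) < \<epsilon> * max 1 (norm y)")
      case True
      then have "\<epsilon> * 1 < \<epsilon> * max 1 (norm y)" by simp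
      then have y1: "norm y > 1" using \<epsilon> by (auto simp: max_def split: if_splits)
      then have lt: "norm (e - y) < \<epsilon> * norm y" using True by simp
      have "norm y \<le> 1 + norm (e - y)" using norm_triangle_ineq2[of y e] norm_minus_commute[of y e] norm_e by simp
      then have "norm y * (1 - \<epsilon>) \<le> 1" using lt by (simp add: algebra_simps)
      then have y2: "norm y \<le> 1 / (1 - \<epsilon>)" using \<epsilon> by (simp add: field_simps)
      moreover have "1 / (1 - \<epsilon>) \<le> 2" using \<epsilon> by (simp add: field_simps)
      ultimately have "norm y \<le> 2" by linarith
      have "norm (e - y) < \<epsilon> * (1 / (1 - \<epsilon>))"
        using lt mult_left_mono[OF y2, of \<epsilon>] \<epsilon> by linarith
      then have yR: "norm (e - y) < R" by (simp add: R_def)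
      have "\<bar>g y\<bar> \<le> L * norm y powr (- (max \<gamma> 0 * (p - 1))) * norm (e - y) powr (- b)"
        unfolding b_def using y1 \<open>norm y \<le> 2\<close> by (intro L) auto
      also have "\<dots> \<le> L * 1 * \<epsilon> powr (- b)"
      proof (intro mult_mono)
        show "norm y powr (- (max \<gamma> 0 * (p - 1))) \<le> 1"
        proof -
          have "y \<noteq> 0" using y1 by auto
          then show ?thesis
            using y1 p_gt powr_mono[of "- (max \<gamma> 0 * (p - 1))" 0 "norm y"] by simp
        qed
        show "norm (e - y) powr (- b) \<le> \<epsilon> powr (- b)"
          using True \<epsilon> sp_gt n_pos unfolding b_def by (intro powr_mono2') auto
      qed (use L in auto)
      finally have "\<bar>g y\<bar> \<le> L * \<epsilon> powr (- b)" by simp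
      moreover have "?h y = g y" using True by (simp add: ucut_def dcut_def g_def)
      moreover have "y \<in> ball e R - ball e \<epsilon>" using yR True by (simp add: dist_norm)
      ultimately show ?thesis by simp
    next
      case False
      have "\<epsilon> \<le> \<epsilon> * max 1 (norm y)" using \<epsilon> by simp
      then have "?h y = 0" using False by (auto simp: ucut_def dcut_def)
      moreover have "0 \<le> (L * \<epsilon> powr (- b)) * indicator (ball e R - ball e \<epsilon>) y"
        using L(1) by (intro mult_nonneg_nonneg) auto
      ultimately show ?thesis by linarith
    qed
    have fin: "ball e R - ball e \<epsilon> \<in> fmeasurable lborel"
      by (intro fmeasurable.Diff) (auto simp: fmeasurable_def emeasure_lborel_ball_finite[unfolded infinity_ennreal_def])
    have i: "integrable lborel (\<lambda>y. (L * \<epsilon> powr (- b)) * indicator (ball e R - ball e \<epsilon>) y)"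
      using fin by (auto simp: fmeasurable_def intro!: integrable_real_indicator integrable_mult_right)
    have h: "integrable lborel ?h"
      by (rule Bochner_Integration.integrable_bound[OF i]) (use bound L in \<open>auto intro!: AE_I2 simp: abs_mult\<close>)
    have "\<bar>integral\<^sup>L lborel ?h\<bar> \<le> (\<integral>y. \<bar>?h y\<bar> \<partial>lborel)" by (rule integral_abs_bound)
    also have "\<dots> \<le> (\<integral>y. (L * \<epsilon> powr (- b)) * indicator (ball e R - ball e \<epsilon>) y \<partial>lborel)"
      using h i bound by (intro integral_mono) auto
    also have "\<dots> = (L * \<epsilon> powr (- b)) * measure lborel (ball e R - ball e \<epsilon>)" by simp
    also have "measure lborel (ball e R - ball e \<epsilon>) = measure lborel (ball e R) - measure lborel (ball e \<epsilon>)"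
      using R emeasure_lborel_ball_finite[of e R] by (intro measure_Diff) auto
    also have "\<dots> = (R ^ N - \<epsilon> ^ N) * m"
      using content_ball_conv_unit_ball[of R e] content_ball_conv_unit_ball[of \<epsilon> e] R \<epsilon>
      by (simp add: m_def N_def left_diff_distrib)
    \<comment> \<open>By Bernoulli's inequality the shell has volume of order \<epsilon>^(n + 1). On
      it \<open>g\<close> is at most of order \<epsilon>^(-b), and -b + n + 1 = p - s p > 0.\<close>
    also have "R ^ N - \<epsilon> ^ N \<le> \<epsilon> ^ N * (2 ^ N * (real N * \<epsilon>))"
    proof -
      have "1 + real N * (- \<epsilon>) \<le> (1 + (- \<epsilon>)) ^ N" using \<epsilon> by (intro Bernoulli_inequality) auto
      then have 1: "1 - (1 - \<epsilon>) ^ N \<le> real N * \<epsilon>" by simp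
      have 2: "inverse (1 - \<epsilon>) ^ N \<le> 2 ^ N"
        using \<epsilon> le_imp_inverse_le[of "1 / 2" "1 - \<epsilon>"] by (intro power_mono) auto
      have "inverse (1 - \<epsilon>) ^ N * (1 - (1 - \<epsilon>) ^ N) = inverse (1 - \<epsilon>) ^ N - 1"
      proof -
        have "inverse (1 - \<epsilon>) * (1 - \<epsilon>) = 1" using \<epsilon> by simp
        then have "inverse (1 - \<epsilon>) ^ N * (1 - \<epsilon>) ^ N = 1"
          by (simp only: power_mult_distrib[symmetric] power_one)
        then show ?thesis by (simp add: right_diff_distrib)
      qed
      then have "R ^ N - \<epsilon> ^ N = \<epsilon> ^ N * (inverse (1 - \<epsilon>) ^ N * (1 - (1 - \<epsilon>) ^ N))"
        by (simp add: R_def divide_inverse power_mult_distrib right_diff_distrib)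
      also have "\<dots> \<le> \<epsilon> ^ N * (2 ^ N * (real N * \<epsilon>))"
        using 1 2 \<epsilon> by (intro mult_left_mono mult_mono) (auto simp: power_le_one)
      finally show ?thesis .
    qed
    then have "L * \<epsilon> powr (- b) * ((R ^ N - \<epsilon> ^ N) * m) \<le> L * \<epsilon> powr (- b) * (\<epsilon> ^ N * (2 ^ N * (real N * \<epsilon>)) * m)"
      using L m0 by (intro mult_left_mono mult_right_mono) auto
    also have "\<dots> = (L * m * 2 ^ N * N) * (\<epsilon> powr (- b) * \<epsilon> powr n * \<epsilon> powr 1)"
      using \<epsilon> by (simp add: n_eq N_def powr_realpow)
    also have "\<epsilon> powr (- b) * \<epsilon> powr n * \<epsilon> powr 1 = \<epsilon> powr (p - s * p)"
      unfolding powr_add[symmetric] b_def by simp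
    finally show ?thesis using h by simp
  qed
  show ?thesis using * by blast
qed

text \<open>For small \<epsilon> compare with \<open>dcut\<close>. A larger \<epsilon> removes more
  of the same function, so a small cut dominates it.\<close>

lemma integrable_ucut:
  assumes \<epsilon>: "\<epsilon> > 0"
  shows "integrable lborel (\<lambda>y. ucut \<epsilon> 1 (norm y) (norm (e - y)))"
proof -
  have small: "integrable lborel (\<lambda>y. ucut \<epsilon> 1 (norm y) (norm (e - y)))" if "0 < \<epsilon>" "\<epsilon> \<le> 1 / 2" for \<epsilon>
  proof -
    have "integrable lborel (\<lambda>y. ucut \<epsilon> 1 (norm y) (norm (e - y)) - dcut \<epsilon> 1 (norm y) (norm (e - y)))"
      using cut_difference that by blast
    from Bochner_Integration.integrable_add[OF this dcut_integral(1)[OF that(1)]] show ?thesis by simp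
  qed
  define \<delta> where "\<delta> = min \<epsilon> (1 / 2)"
  have "integrable lborel (\<lambda>y. ucut \<delta> 1 (norm y) (norm (e - y)))"
    using \<epsilon> by (intro small) (auto simp: \<delta>_def)
  then show ?thesis
    by (rule Bochner_Integration.integrable_bound) (auto intro!: AE_I2 simp: ucut_def \<delta>_def)
qed

lemma ucut_tendsto: "((\<lambda>\<epsilon>. \<integral>y. ucut \<epsilon> 1 (norm y) (norm (e - y)) \<partial>lborel) \<longlongrightarrow> c\<^sub>0) (at_right 0)"
proof -
  obtain K where K: "\<And>\<epsilon>. 0 < \<epsilon> \<Longrightarrow> \<epsilon> \<le> 1 / 2 \<Longrightarrow>
      \<bar>\<integral>y. ucut \<epsilon> 1 (norm y) (norm (e - y)) - dcut \<epsilon> 1 (norm y) (norm (e - y)) \<partial>lborel\<bar> \<le> K * \<epsilon> powr (p - s * p)"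
    using cut_difference by blast
  have pos: "eventually (\<lambda>\<epsilon>::real. 0 < \<epsilon>) (at_right 0)"
    by (rule eventually_at_right_less)
  have half: "eventually (\<lambda>\<epsilon>::real. \<epsilon> < 1 / 2) (at_right 0)"
    using eventually_at_right[of 0 "1::real"] by (auto intro!: exI[of _ "1 / 2"])
  have "((\<lambda>\<epsilon>::real. \<epsilon> powr (p - s * p)) \<longlongrightarrow> 0 powr (p - s * p)) (at_right 0)"
    using sp_less_p pos by (intro tendsto_powr2 tendsto_const tendsto_ident_at) (auto elim: eventually_mono)
  then have 0: "((\<lambda>\<epsilon>::real. K * \<epsilon> powr (p - s * p)) \<longlongrightarrow> 0) (at_right 0)"
    using tendsto_mult_right_zero by force
  have "((\<lambda>\<epsilon>. (\<integral>y. ucut \<epsilon> 1 (norm y) (norm (e - y)) \<partial>lborel) - (\<integral>y. dcut \<epsilon> 1 (norm y) (norm (e - y)) \<partial>lborel)) \<longlongrightarrow> 0) (at_right 0)"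
  proof (rule Lim_null_comparison[OF _ 0])
    show "\<forall>\<^sub>F \<epsilon> in at_right 0. norm ((\<integral>y. ucut \<epsilon> 1 (norm y) (norm (e - y)) \<partial>lborel) - (\<integral>y. dcut \<epsilon> 1 (norm y) (norm (e - y)) \<partial>lborel)) \<le> K * \<epsilon> powr (p - s * p)"
      using pos half
    proof eventually_elim
      case (elim \<epsilon>)
      then show ?case
        using K[of \<epsilon>] Bochner_Integration.integral_diff[OF integrable_ucut[of \<epsilon>] dcut_integral(1)[of \<epsilon>]] by simp
    qed
  qed
  from tendsto_add[OF this dcut_tendsto] show ?thesis by simp
qed

lemma radial_kernel_ucut:
  assumes "\<epsilon> > 0"
  shows "radial_kernel (ucut \<epsilon>) (- (\<alpha> + n))"
proof
  show "ucut \<epsilon> (t * a) (t * b) (t * c) = t powr (- (\<alpha> + n)) * ucut \<epsilon> a b c"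
    if "t > 0" "a \<ge> 0" "b \<ge> 0" "c \<ge> 0" for t a b c
  proof -
    have "\<epsilon> * (t * a) \<le> t * c \<longleftrightarrow> \<epsilon> * a \<le> c"
      using that by (simp add: mult.left_commute)
    then show ?thesis using G_homogeneous[OF that] by (simp add: ucut_def)
  qed
  show "(\<lambda>(b, c). ucut \<epsilon> a b c) \<in> borel_measurable (borel \<Otimes>\<^sub>M borel)" for a
    by measurable
qed

definition u :: "real ^ 'n \<Rightarrow> real" where "u x = 1 / norm x powr \<gamma>"

lemma u_eq: "u x = norm x powr (- \<gamma>)"
  by (simp add: u_def powr_minus_divide)

lemma u_measurable [measurable]: "u \<in> borel_measurable borel"
  unfolding u_eq[abs_def] by measurable

lemma u_kernel: "Jp p (u x - u y) / norm (x - y) powr (n + s * p) = G (norm x) (norm y) (norm (x - y))"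
  by (simp add: G_def u_eq)

text \<open>The ball of radius \<epsilon> about x is the cut \<open>ucut\<close> with parameter
  \<epsilon> / |x|. Scaling to \<open>e\<close> produces the power n - (\<alpha> + n) = -\<alpha> of
  |x|.\<close>

theorem has_frac_p_Laplacian_u:
  assumes x: "x \<noteq> 0"
  shows "has_frac_p_Laplacian s p u x (c\<^sub>0 / norm x powr \<alpha>)"
  unfolding has_frac_p_Laplacian_def has_pv_integral_def
proof (intro conjI allI impI)
  let ?k = "\<lambda>y. Jp p (u x - u y) / norm (x - y) powr (real DIM(real ^ 'n) + s * p)"
  have k: "?k y = G (norm x) (norm y) (norm (x - y))" for y
    using u_kernel[of x y] by (simp add: n_eq)
  have cut: "indicator (- ball x \<epsilon>) y * ?k y = ucut (\<epsilon> / norm x) (norm x) (norm y) (norm (x - y))" for \<epsilon> y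
    unfolding k using x by (simp add: ucut_def indicator_def dist_norm)
  have b: "- ball x \<epsilon> \<in> sets borel" for \<epsilon> by simp
  have km: "?k \<in> borel_measurable borel" by measurable
  show "integrable (lebesgue_on (- ball x \<epsilon>)) ?k" if \<epsilon>: "\<epsilon> > 0" for \<epsilon>
  proof -
    interpret radial_kernel "ucut (\<epsilon> / norm x)" "- (\<alpha> + n)"
      using \<epsilon> x by (intro radial_kernel_ucut) simp
    show ?thesis
      unfolding integrable_lebesgue_on_iff[OF km b] cut
      using integrable_radial_kernel[OF norm_e x] integrable_ucut[of "\<epsilon> / norm x"] \<epsilon> x by simp
  qed
  have pos: "eventually (\<lambda>\<epsilon>::real. 0 < \<epsilon>) (at_right 0)"
    by (rule eventually_at_right_less)
  have "filterlim (\<lambda>\<epsilon>::real. \<epsilon> / norm x) (at_right 0) (at_right 0)"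
    unfolding filterlim_at using x
    by (auto intro!: tendsto_divide_zero tendsto_ident_at eventually_mono[OF pos])
  from tendsto_mult_left[OF filterlim_compose[OF ucut_tendsto this], of "norm x powr (- \<alpha>)"]
  have lim: "((\<lambda>\<epsilon>. norm x powr (- \<alpha>) * (\<integral>y. ucut (\<epsilon> / norm x) 1 (norm y) (norm (e - y)) \<partial>lborel)) \<longlongrightarrow> c\<^sub>0 / norm x powr \<alpha>) (at_right 0)"
    by (simp add: powr_minus divide_inverse mult.commute)
  have "integral\<^sup>L (lebesgue_on (- ball x \<epsilon>)) ?k
      = norm x powr (- \<alpha>) * (\<integral>y. ucut (\<epsilon> / norm x) 1 (norm y) (norm (e - y)) \<partial>lborel)" if \<epsilon>: "\<epsilon> > 0" for \<epsilon>
  proof -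
    interpret radial_kernel "ucut (\<epsilon> / norm x)" "- (\<alpha> + n)"
      using \<epsilon> x by (intro radial_kernel_ucut) simp
    show ?thesis
      unfolding integral_lebesgue_on_eq[OF km b] cut
      using integral_radial_kernel[OF norm_e x] by (simp add: n_eq)
  qed
  then have "eventually (\<lambda>\<epsilon>. norm x powr (- \<alpha>) * (\<integral>y. ucut (\<epsilon> / norm x) 1 (norm y) (norm (e - y)) \<partial>lborel)
      = integral\<^sup>L (lebesgue_on (- ball x \<epsilon>)) ?k) (at_right 0)"
    by (intro eventually_mono[OF pos]) simp
  from tendsto_cong[OF this] lim
  show "((\<lambda>\<epsilon>. integral\<^sup>L (lebesgue_on (- ball x \<epsilon>)) ?k) \<longlongrightarrow> c\<^sub>0 / norm x powr \<alpha>) (at_right 0)"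
    by simp
qed

text \<open>The pointwise formula at x = e, where u is 1; this identifies the integral over the ball
  with the constant \<open>C\<close> of the theorem.\<close>

lemma c\<^sub>0_eq_pv: "c\<^sub>0 = pv_integral (\<lambda>y. \<bar>1 - norm y powr (- \<gamma>)\<bar> powr (p - 2) * (1 - norm y powr (- \<gamma>))
                                   / norm (e - y) powr (n + s * p)) e"
proof -
  have "e \<noteq> 0" using norm_e by auto
  from has_frac_p_Laplacian_u[OF this]
  have "has_pv_integral (\<lambda>y. \<bar>1 - norm y powr (- \<gamma>)\<bar> powr (p - 2) * (1 - norm y powr (- \<gamma>))
                                   / norm (e - y) powr (n + s * p)) e c\<^sub>0"
    by (simp add: has_frac_p_Laplacian_def Jp_def u_eq norm_e n_eq)
  then show ?thesis by (simp add: pv_integral_eqI)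
qed

end

section \<open>Membership in the function spaces\<close>

lemma
  fixes f :: "'a::euclidean_space \<times> 'b::euclidean_space \<Rightarrow> ennreal"
  assumes [measurable]: "f \<in> borel_measurable borel"
  shows nn_integral_lborel_pair: "(\<integral>\<^sup>+z. f z \<partial>lborel) = (\<integral>\<^sup>+x. \<integral>\<^sup>+y. f (x, y) \<partial>lborel \<partial>lborel)"
    and nn_integral_lborel_pair_swap: "(\<integral>\<^sup>+z. f z \<partial>lborel) = (\<integral>\<^sup>+y. \<integral>\<^sup>+x. f (x, y) \<partial>lborel \<partial>lborel)"
proof -
  have m: "f \<in> borel_measurable (lborel \<Otimes>\<^sub>M lborel)"
    using assms by (simp add: lborel_prod)
  show "(\<integral>\<^sup>+z. f z \<partial>lborel) = (\<integral>\<^sup>+x. \<integral>\<^sup>+y. f (x, y) \<partial>lborel \<partial>lborel)"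
    using lborel.nn_integral_fst[OF m] by (simp add: lborel_prod)
  show "(\<integral>\<^sup>+z. f z \<partial>lborel) = (\<integral>\<^sup>+y. \<integral>\<^sup>+x. f (x, y) \<partial>lborel \<partial>lborel)"
    using lborel_pair.nn_integral_snd[OF m] by (simp add: lborel_prod)
qed

lemma integrable_power_ball:
  fixes a :: real
  assumes "a < DIM('a::euclidean_space)"
  shows "integrable lborel (\<lambda>x. indicator (ball (0::'a) R) x * norm x powr (- a))"
  using nn_integral_power_ball[OF assms, of 0 R]
  by (subst integrable_iff_nn_integral_finite) (simp_all add: abs_mult)

lemma Lp_power:
  fixes f :: "'a::euclidean_space \<Rightarrow> real"
  assumes f: "f \<in> borel_measurable borel" and A: "A \<in> sets borel" "A \<subseteq> ball 0 R"
    and bound: "AE x in lborel. x \<in> A \<longrightarrow> \<bar>f x\<bar> \<le> c * norm x powr (- a)"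
    and c: "c \<ge> 0" and t: "t \<ge> 0" "a * t < DIM('a)"
  shows "f \<in> Lp t A"
proof -
  have "integrable lborel (\<lambda>x. c powr t * (indicator (ball (0::'a) R) x * norm x powr (- (a * t))))"
    using t by (intro integrable_mult_right integrable_power_ball) auto
  then have "integrable lborel (\<lambda>x. indicator A x * \<bar>f x\<bar> powr t)"
  proof (rule Bochner_Integration.integrable_bound)
    show "(\<lambda>x. indicator A x * \<bar>f x\<bar> powr t) \<in> borel_measurable lborel" using f A by measurable
    show "AE x in lborel. norm (indicator A x * \<bar>f x\<bar> powr t) \<le> norm (c powr t * (indicator (ball (0::'a) R) x * norm x powr (- (a * t))))"
      using bound
    proof eventually_elim
      case (elim x)
      show ?case
      proof (cases "x \<in> A")
        case True
        have "\<bar>f x\<bar> powr t \<le> (c * norm x powr (- a)) powr t"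
          using elim True t by (intro powr_mono2) auto
        also have "\<dots> = c powr t * norm x powr (- (a * t))"
          using c by (simp add: powr_mult powr_powr)
        finally show ?thesis using True A by auto
      qed simp
    qed
  qed
  then show ?thesis using f A by (simp add: Lp_borel_iff)
qed

lemma compactly_contained_UNIV_bounded:
  fixes A :: "'a::euclidean_space set"
  assumes "compactly_contained A B"
  obtains R where "R > 0" "A \<subseteq> ball 0 R"
proof -
  have "bounded A"
    using assms by (auto simp: compactly_contained_def intro: bounded_subset[OF compact_imp_bounded closure_subset])
  then obtain R where "R > 0" "\<forall>x\<in>A. norm x \<le> R" using bounded_pos by metis
  then have "A \<subseteq> ball 0 (R + 1)" by force
  with \<open>R > 0\<close> show thesis by (intro that[of "R + 1"]) auto
qed

section \<open>Gagliardo energy and tail of the power\<close>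

context power_solution
begin

lemma gamma_p: "\<gamma> * p + p < n"
  using gamma_lt p_gt by (simp add: field_simps)

text \<open>Equivalent to \<alpha> t < n for the smallest exponent t = n p / (n p - n + s p) that
  the definition of a weak solution admits. The same inequality makes the power weight in the Hardy
  argument integrable.\<close>

lemma alpha_p: "\<alpha> * p < n * (p - 1) + s * p"
proof -
  have "\<gamma> * p < n - p" using gamma_p by simp
  then have "\<gamma> * p * (p - 1) < (n - p) * (p - 1)" using p_gt by (intro mult_strict_right_mono) auto
  moreover have "s * (p * (p - 1)) < 1 * (p * (p - 1))" using s_lt p_gt by (intro mult_strict_right_mono) auto
  ultimately show ?thesis unfolding \<alpha>_def by (simp add: algebra_simps)
qed

text \<open>One half of the Gagliardo integrand of u; the other half follows by exchanging x and y.
  At x = e the condition confines y to the unit ball, so that nothing has to be estimated at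
  infinity.\<close>

definition gagliardo where
  "gagliardo a b c = (if b < a then \<bar>a powr (- \<gamma>) - b powr (- \<gamma>)\<bar> powr p / c powr (n + s * p) else 0)"

lemma gagliardo_nonneg: "0 \<le> gagliardo a b c"
  by (simp add: gagliardo_def)

lemma gagliardo_measurable [measurable]:
  assumes [measurable]: "f1 \<in> borel_measurable M" "f2 \<in> borel_measurable M" "f3 \<in> borel_measurable M"
  shows "(\<lambda>z. gagliardo (f1 z) (f2 z) (f3 z)) \<in> borel_measurable M"
  unfolding gagliardo_def by measurable

sublocale gagliardo: radial_kernel gagliardo "- (\<gamma> * p + n + s * p)"
proof
  show "gagliardo (t * a) (t * b) (t * c) = t powr (- (\<gamma> * p + n + s * p)) * gagliardo a b c"
    if t: "t > 0" "a \<ge> 0" "b \<ge> 0" "c \<ge> 0" for t a b c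
  proof -
    have "\<bar>(t * a) powr (- \<gamma>) - (t * b) powr (- \<gamma>)\<bar> = t powr (- \<gamma>) * \<bar>a powr (- \<gamma>) - b powr (- \<gamma>)\<bar>"
      using t by (simp add: powr_mult right_diff_distrib[symmetric] abs_mult)
    then have "\<bar>(t * a) powr (- \<gamma>) - (t * b) powr (- \<gamma>)\<bar> powr p / (t * c) powr (n + s * p)
      = (t powr (- (\<gamma> * p)) / t powr (n + s * p)) * (\<bar>a powr (- \<gamma>) - b powr (- \<gamma>)\<bar> powr p / c powr (n + s * p))"
      using t by (simp add: powr_mult powr_powr)
    moreover have "t powr (- (\<gamma> * p)) / t powr (n + s * p) = t powr (- (\<gamma> * p + n + s * p))"
    proof -
      have "- (\<gamma> * p) - (n + s * p) = - (\<gamma> * p + n + s * p)" by simp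
      then show ?thesis by (simp only: powr_diff[symmetric])
    qed
    ultimately show ?thesis using t by (simp add: gagliardo_def)
  qed
  show "(\<lambda>(b, c). gagliardo a b c) \<in> borel_measurable (borel \<Otimes>\<^sub>M borel)" for a
    by measurable
qed

text \<open>The zero on the sphere now enters with power p, which gives the order n + s p - p < n at
  \<open>e\<close>; at the origin the order is max \<gamma> 0 times p, which is below n by
  \<open>gamma_p\<close>.\<close>

lemma nn_integral_gagliardo_unit:
  "(\<integral>\<^sup>+z. ennreal (gagliardo 1 (norm z) (norm (e - z))) \<partial>lborel) < \<infinity>"
proof -
  obtain L where L: "L \<ge> 0"
    "\<And>b. 0 < b \<Longrightarrow> b \<le> 2 \<Longrightarrow> \<bar>1 - b powr (- \<gamma>)\<bar> \<le> L * \<bar>1 - b\<bar> * b powr (- max \<gamma> 0)"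
    by (rule abs_one_minus_powr_le[of \<gamma>]) blast
  have "integrable lborel (\<lambda>z. gagliardo 1 (norm z) (norm (e - z)))"
  proof (rule integrable_dominated_nn)
    have "max \<gamma> 0 * p < n" using gamma_p p_gt n_pos by (auto simp: max_def)
    then show "(\<integral>\<^sup>+y. ennreal (indicator (ball 0 2) y * (norm y powr (- (max \<gamma> 0 * p)) * norm (e - y) powr (- (n + s * p - p)))) \<partial>lborel) < \<infinity>"
      using sp_less_p by (intro nn_integral_two_powers norm_e) (auto simp: n_eq)
    have "\<bar>gagliardo 1 (norm z) (norm (e - z))\<bar> \<le> L powr p * (indicator (ball 0 2) z * (norm z powr (- (max \<gamma> 0 * p)) * norm (e - z) powr (- (n + s * p - p))))"
      if "z \<noteq> 0" for z
    proof (cases "norm z < 1")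
      case True
      have "\<bar>1 - norm z powr (- \<gamma>)\<bar> \<le> L * \<bar>1 - norm z\<bar> * norm z powr (- max \<gamma> 0)"
        using True that by (intro L) auto
      also have "\<dots> \<le> L * norm (e - z) * norm z powr (- max \<gamma> 0)"
        using L(1) abs_one_minus_norm_le[of z] by (intro mult_right_mono mult_left_mono) auto
      finally have "\<bar>1 - norm z powr (- \<gamma>)\<bar> powr p \<le> (L * norm (e - z) * norm z powr (- max \<gamma> 0)) powr p"
        using p_gt by (intro powr_mono2) auto
      also have "\<dots> = L powr p * norm z powr (- (max \<gamma> 0 * p)) * norm (e - z) powr p"
        using L(1) by (simp add: powr_mult powr_powr)
      finally have "\<bar>1 - norm z powr (- \<gamma>)\<bar> powr p / norm (e - z) powr (n + s * p)
         \<le> (L powr p * norm z powr (- (max \<gamma> 0 * p)) * norm (e - z) powr p) / norm (e - z) powr (n + s * p)"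
        by (intro divide_right_mono) auto
      also have "\<dots> = L powr p * (norm z powr (- (max \<gamma> 0 * p)) * norm (e - z) powr (- (n + s * p - p)))"
        using powr_diff[of "norm (e - z)" p "n + s * p"] by (simp add: algebra_simps)
      finally show ?thesis using True by (simp add: gagliardo_def)
    next
      case False
      then show ?thesis by (simp add: gagliardo_def)
    qed
    then show "AE z in lborel. \<bar>gagliardo 1 (norm z) (norm (e - z))\<bar> \<le> L powr p * (indicator (ball 0 2) z * (norm z powr (- (max \<gamma> 0 * p)) * norm (e - z) powr (- (n + s * p - p))))"
      by (intro eventually_mono[OF AE_lborel_singleton[of "0 :: real ^ 'n"]]) auto
  qed auto
  then show ?thesis
    by (subst (asm) integrable_iff_nn_integral_finite) (auto simp: gagliardo_nonneg)
qed

text \<open>Integration in y leaves, by homogeneity, a constant times |x|^(- (\<gamma> p + s p)).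
  This is locally integrable because s p < p and \<gamma> p + p < n.\<close>

lemma gagliardo_ball_finite:
  "(\<integral>\<^sup>+z. ennreal (indicator (ball 0 R \<times> ball 0 R) z * (\<bar>u (fst z) - u (snd z)\<bar> powr p / norm (fst z - snd z) powr (n + s * p))) \<partial>lborel) < \<infinity>"
proof -
  define \<Psi> :: "real ^ 'n \<Rightarrow> real ^ 'n \<Rightarrow> ennreal"
    where "\<Psi> x y = ennreal (indicator (ball 0 R) x) * ennreal (gagliardo (norm x) (norm y) (norm (x - y)))" for x y
  have \<Psi>_meas [measurable]: "(\<lambda>z. \<Psi> (fst z) (snd z)) \<in> borel_measurable borel" "(\<lambda>z. \<Psi> (snd z) (fst z)) \<in> borel_measurable borel"
    unfolding \<Psi>_def borel_prod[symmetric] by measurable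
  define K where "K = (\<integral>\<^sup>+z. ennreal (gagliardo 1 (norm z) (norm (e - z))) \<partial>lborel)"
  have K: "K < \<infinity>" unfolding K_def by (rule nn_integral_gagliardo_unit)
  have inner: "(\<integral>\<^sup>+y. \<Psi> x y \<partial>lborel) = ennreal (indicator (ball 0 R) x * norm x powr (- (\<gamma> * p + s * p))) * K" for x
  proof (cases "x = 0")
    case True
    then show ?thesis by (simp add: \<Psi>_def gagliardo_def)
  next
    case False
    have "(\<integral>\<^sup>+y. \<Psi> x y \<partial>lborel) = ennreal (indicator (ball 0 R) x) * (\<integral>\<^sup>+y. ennreal (gagliardo (norm x) (norm y) (norm (x - y))) \<partial>lborel)"
      unfolding \<Psi>_def by (rule nn_integral_cmult) measurable
    also have "\<dots> = ennreal (indicator (ball 0 R) x) * (ennreal (norm x powr (- (\<gamma> * p + s * p))) * K)"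
      unfolding gagliardo.nn_integral_radial_kernel[OF norm_e False] K_def by (simp add: n_eq)
    finally show ?thesis by (simp add: ennreal_mult' mult.assoc)
  qed
  have fin: "(\<integral>\<^sup>+x. \<integral>\<^sup>+y. \<Psi> x y \<partial>lborel \<partial>lborel) < \<infinity>"
  proof -
    have "\<gamma> * p + s * p < DIM(real ^ 'n)" using gamma_p sp_less_p n_eq by simp
    from nn_integral_power_ball[OF this, of 0 R] have "(\<integral>\<^sup>+x. ennreal (indicator (ball (0 :: real ^ 'n) R) x * norm x powr (- (\<gamma> * p + s * p))) \<partial>lborel) < \<infinity>"
      by simp
    then show ?thesis unfolding inner using K
      by (subst nn_integral_multc) (auto simp: ennreal_mult_less_top)
  qed
  have "(\<integral>\<^sup>+z. ennreal (indicator (ball 0 R \<times> ball 0 R) z * (\<bar>u (fst z) - u (snd z)\<bar> powr p / norm (fst z - snd z) powr (n + s * p))) \<partial>lborel)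
      \<le> (\<integral>\<^sup>+z. \<Psi> (fst z) (snd z) + \<Psi> (snd z) (fst z) \<partial>lborel)"
  proof (intro nn_integral_mono)
    fix z :: "(real ^ 'n) \<times> (real ^ 'n)"
    obtain x y where z: "z = (x, y)" by (cases z)
    consider "x \<notin> ball 0 R \<or> y \<notin> ball 0 R" | "x \<in> ball 0 R" "y \<in> ball 0 R" "norm y < norm x"
      | "x \<in> ball 0 R" "y \<in> ball 0 R" "norm x < norm y" | "norm x = norm y" by linarith
    then show "ennreal (indicator (ball 0 R \<times> ball 0 R) z * (\<bar>u (fst z) - u (snd z)\<bar> powr p / norm (fst z - snd z) powr (n + s * p)))
      \<le> \<Psi> (fst z) (snd z) + \<Psi> (snd z) (fst z)"
    proof cases
      case 1 then show ?thesis by (auto simp: z)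
    next
      case 2 then show ?thesis by (simp add: z \<Psi>_def gagliardo_def u_eq)
    next
      case 3 then show ?thesis by (simp add: z \<Psi>_def gagliardo_def u_eq norm_minus_commute abs_minus_commute)
    next
      case 4 then show ?thesis by (simp add: z u_eq)
    qed
  qed
  also have "\<dots> = (\<integral>\<^sup>+z. \<Psi> (fst z) (snd z) \<partial>lborel) + (\<integral>\<^sup>+z. \<Psi> (snd z) (fst z) \<partial>lborel)"
    by (rule nn_integral_add) simp_all
  also have "(\<integral>\<^sup>+z. \<Psi> (fst z) (snd z) \<partial>lborel) = (\<integral>\<^sup>+x. \<integral>\<^sup>+y. \<Psi> x y \<partial>lborel \<partial>lborel)"
    using nn_integral_lborel_pair[OF \<Psi>_meas(1)] by simp
  also have "(\<integral>\<^sup>+z. \<Psi> (snd z) (fst z) \<partial>lborel) = (\<integral>\<^sup>+x. \<integral>\<^sup>+y. \<Psi> x y \<partial>lborel \<partial>lborel)"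
    using nn_integral_lborel_pair_swap[OF \<Psi>_meas(2)] by simp
  finally show ?thesis using fin by (auto intro: le_less_trans)
qed

lemma u_Wsp_loc: "u \<in> Wsp_loc s p UNIV"
  unfolding Wsp_loc_def
proof (intro CollectI allI impI)
  fix A :: "(real ^ 'n) set" assume A: "open A \<and> compactly_contained A UNIV"
  then obtain R where R: "R > 0" "A \<subseteq> ball 0 R" using compactly_contained_UNIV_bounded by blast
  have "u \<in> Lp p A"
    using A R gamma_p p_gt
    by (intro Lp_power[where R = R and c = 1 and a = \<gamma>]) (auto simp: u_eq n_eq intro!: AE_I2)
  moreover have "integrable (lebesgue_on (A \<times> A)) (\<lambda>(x, y). \<bar>u x - u y\<bar> powr p / norm (x - y) powr (real DIM(real ^ 'n) + s * p))"
  proof (subst integrable_lebesgue_on_iff)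
    show "A \<times> A \<in> sets borel" using A by (simp add: open_Times)
    show m: "(\<lambda>(x, y). \<bar>u x - u y\<bar> powr p / norm (x - y) powr (real DIM(real ^ 'n) + s * p)) \<in> borel_measurable borel"
      unfolding borel_prod[symmetric] by measurable
    show "integrable lborel (\<lambda>z. indicator (A \<times> A) z * (case z of (x, y) \<Rightarrow> \<bar>u x - u y\<bar> powr p / norm (x - y) powr (real DIM(real ^ 'n) + s * p)))"
    proof (rule integrable_dominated_nn[OF _ _ _ _ gagliardo_ball_finite[of R]])
      have "indicator (A \<times> A) z \<le> (indicator (ball 0 R \<times> ball 0 R) z :: real)" for z
        using R by (auto simp: indicator_def)
      then have "indicator (A \<times> A) z * (\<bar>u (fst z) - u (snd z)\<bar> powr p / norm (fst z - snd z) powr (n + s * p))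
        \<le> indicator (ball 0 R \<times> ball 0 R) z * (\<bar>u (fst z) - u (snd z)\<bar> powr p / norm (fst z - snd z) powr (n + s * p))" for z
        by (intro mult_right_mono) auto
      then show "AE z in lborel. \<bar>indicator (A \<times> A) z * (case z of (x, y) \<Rightarrow> \<bar>u x - u y\<bar> powr p / norm (x - y) powr (real DIM(real ^ 'n) + s * p))\<bar>
        \<le> 1 * (indicator (ball 0 R \<times> ball 0 R) z * (\<bar>u (fst z) - u (snd z)\<bar> powr p / norm (fst z - snd z) powr (n + s * p)))"
        by (intro AE_I2) (auto simp: split_beta n_eq abs_mult)
      have "A \<times> A \<in> sets borel" using A by (simp add: open_Times)
      then show "(\<lambda>z. indicator (A \<times> A) z * (case z of (x, y) \<Rightarrow> \<bar>u x - u y\<bar> powr p / norm (x - y) powr (real DIM(real ^ 'n) + s * p))) \<in> borel_measurable lborel"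
        using m by measurable
      have "ball (0 :: real ^ 'n) R \<times> ball (0 :: real ^ 'n) R \<in> sets borel" by (simp add: open_Times)
      moreover have "(\<lambda>z. \<bar>u (fst z) - u (snd z)\<bar> powr p / norm (fst z - snd z) powr (n + s * p)) \<in> borel_measurable borel"
        unfolding borel_prod[symmetric] by measurable
      ultimately show "(\<lambda>z. indicator (ball 0 R \<times> ball 0 R) z * (\<bar>u (fst z) - u (snd z)\<bar> powr p / norm (fst z - snd z) powr (n + s * p))) \<in> borel_measurable lborel"
        by measurable
    qed simp
  qed
  ultimately show "u \<in> Wsp s p A" by (simp add: Wsp_def)
qed

text \<open>At the origin the order is \<gamma> (p - 1) < n. Outside the unit ball the integrand is
  at most |x|^(- (\<alpha> + n)), which is integrable because \<alpha> > 0.\<close>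

lemma u_tail_space: "u \<in> tail_space s p"
  unfolding tail_space_def
proof (intro CollectI conjI)
  show "u \<in> borel_measurable lebesgue" by (intro measurable_completion) simp
  let ?f = "\<lambda>x. \<bar>u x\<bar> powr (p - 1) / (1 + norm x) powr (real DIM(real ^ 'n) + s * p)"
  have f: "?f \<in> borel_measurable borel" by measurable
  have "integrable lborel (\<lambda>x. indicator (ball (0 :: real ^ 'n) 1) x * norm x powr (- (\<gamma> * (p - 1)))
      + indicator (- ball 0 1) x * norm x powr (- (\<alpha> + n)))"
  proof (rule Bochner_Integration.integrable_add)
    show "integrable lborel (\<lambda>x. indicator (ball (0 :: real ^ 'n) 1) x * norm x powr (- (\<gamma> * (p - 1))))"
    proof (rule integrable_power_ball)
      have "0 < s * p" using s_pos p_gt by simp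
      then show "\<gamma> * (p - 1) < DIM(real ^ 'n)" using gamma_lt' by (simp add: n_eq)
    qed
    have "(\<integral>\<^sup>+y. ennreal (indicator (- ball (0 :: real ^ 'n) 1) y * norm y powr (- (\<alpha> + n))) \<partial>lborel) < \<infinity>"
      using alpha_pos by (intro nn_integral_power_outside) (simp add: n_eq)
    then show "integrable lborel (\<lambda>x. indicator (- ball (0 :: real ^ 'n) 1) x * norm x powr (- (\<alpha> + n)))"
      by (subst integrable_iff_nn_integral_finite) (auto simp: abs_mult)
  qed
  then have "integrable lborel ?f"
  proof (rule Bochner_Integration.integrable_bound)
    show "?f \<in> borel_measurable lborel" using f by simp
    have "?f x \<le> indicator (ball (0 :: real ^ 'n) 1) x * norm x powr (- (\<gamma> * (p - 1)))
      + indicator (- ball 0 1) x * norm x powr (- (\<alpha> + n))" for x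
    proof (cases "norm x < 1")
      case True
      have "1 \<le> (1 + norm x) powr (n + s * p)"
        using n_pos s_pos p_gt by (intro ge_one_powr_ge_zero) auto
      then have "norm x powr (- (\<gamma> * (p - 1))) / (1 + norm x) powr (n + s * p) \<le> norm x powr (- (\<gamma> * (p - 1))) / 1"
        by (intro divide_left_mono) auto
      then show ?thesis using True by (simp add: u_eq powr_powr n_eq)
    next
      case False
      have "norm x powr (n + s * p) \<le> (1 + norm x) powr (n + s * p)"
        using n_pos s_pos p_gt by (intro powr_mono2) auto
      then have "norm x powr (- (\<gamma> * (p - 1))) / (1 + norm x) powr (n + s * p) \<le> norm x powr (- (\<gamma> * (p - 1))) / norm x powr (n + s * p)"
      proof (intro divide_left_mono mult_pos_pos)
        have "x \<noteq> 0" using False by auto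
        then show "0 < norm x powr (n + s * p)" by simp
        show "0 < (1 + norm x) powr (n + s * p)"
          using norm_ge_zero[of x] by (simp add: add_nonneg_eq_0_iff powr_gt_zero)
      qed auto
      also have "\<dots> = norm x powr (- (\<alpha> + n))"
        by (simp add: powr_diff[symmetric] \<alpha>_def algebra_simps)
      finally show ?thesis using False by (simp add: u_eq powr_powr n_eq)
    qed
    then show "AE x in lborel. norm (?f x) \<le> norm (indicator (ball (0 :: real ^ 'n) 1) x * norm x powr (- (\<gamma> * (p - 1)))
      + indicator (- ball 0 1) x * norm x powr (- (\<alpha> + n)))"
      by (intro AE_I2) (auto intro: order_trans)
  qed
  then show "integrable lebesgue ?f" using f by (simp add: integrable_completion)
qed

lemma f_Lp:
  assumes "A \<in> sets borel" "A \<subseteq> ball 0 1" "0 \<le> t" "\<alpha> * t < n"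
  shows "(\<lambda>x :: real ^ 'n. c / norm x powr \<alpha>) \<in> Lp t A"
  using assms
  by (intro Lp_power[where R = 1 and c = "\<bar>c\<bar>" and a = \<alpha>])
     (auto simp: n_eq abs_mult powr_minus divide_inverse intro!: AE_I2)

end

section \<open>The weak gradient\<close>

lemma lborel_integral_translate:
  fixes f :: "'a::euclidean_space \<Rightarrow> real"
  assumes "f \<in> borel_measurable borel"
  shows "(\<integral>x. f (a + x) \<partial>lborel) = integral\<^sup>L lborel f"
    and "integrable lborel (\<lambda>x. f (a + x)) \<longleftrightarrow> integrable lborel f"
  using integral_distr[of "(+) a" lborel borel f] integrable_distr_eq[of "(+) a" lborel borel f] assms
  by (simp_all add: lborel_distr_plus)

text \<open>The difference quotients have integral \<open>0\<close> by translation invariance.\<close>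

lemma integral_directional_derivative_eq_0:
  fixes F :: "'a::euclidean_space \<Rightarrow> real"
  assumes der: "\<And>x. (F has_derivative F' x) (at x)"
    and cont: "continuous_on UNIV (\<lambda>x. F' x b)"
    and supp: "\<And>x. F x \<noteq> 0 \<Longrightarrow> norm x \<le> R"
  shows "(\<integral>x. F' x b \<partial>lborel) = 0"
proof -
  have contF: "continuous_on UNIV F"
    using der by (meson continuous_at_imp_continuous_on has_derivative_continuous)
  have Fm [measurable]: "F \<in> borel_measurable borel" by (rule borel_measurable_continuous_onI[OF contF])
  have F'm: "(\<lambda>x. F' x b) \<in> borel_measurable borel" by (rule borel_measurable_continuous_onI[OF cont])
  \<comment> \<open>A difference quotient \<open>D k x\<close> can be nonzero only for |x| <= R +
    |b|, and then the whole segment from x to its shift lies in \<open>S\<close>.\<close>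
  define S where "S = cball (0::'a) (R + 2 * norm b)"
  have "bounded ((\<lambda>x. F' x b) ` S)"
    unfolding S_def by (intro compact_imp_bounded compact_continuous_image continuous_on_subset[OF cont]) auto
  then obtain M where M: "M > 0" "\<And>x. x \<in> S \<Longrightarrow> \<bar>F' x b\<bar> \<le> M"
    unfolding bounded_pos by (metis image_eqI real_norm_def)
  have "bounded (F ` S)"
    unfolding S_def by (intro compact_imp_bounded compact_continuous_image continuous_on_subset[OF contF]) auto
  then obtain M' where M': "M' > 0" "\<And>x. x \<in> S \<Longrightarrow> \<bar>F x\<bar> \<le> M'"
    unfolding bounded_pos by (metis image_eqI real_norm_def)
  have Sfin: "integrable lborel (\<lambda>x. c * indicator S x :: real)" for c
    unfolding S_def using emeasure_lborel_cball_finite[of "0::'a" "R + 2 * norm b"]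
    by (intro integrable_mult_right integrable_real_indicator) auto
  have iF: "integrable lborel F"
  proof (rule Bochner_Integration.integrable_bound[OF Sfin[of M']])
    show "AE x in lborel. norm (F x) \<le> norm (M' * indicator S x)"
    proof (intro AE_I2)
      fix x show "norm (F x) \<le> norm (M' * indicator S x)"
      proof (cases "x \<in> S")
        case True then show ?thesis using M' by auto
      next
        case False
        have "0 \<le> norm b" by simp
        then have "\<not> norm x \<le> R" using False unfolding S_def mem_cball dist_0_norm by linarith
        then have "F x = 0" using supp by blast
        then show ?thesis by simp
      qed
    qed
  qed simp
  define h where "h k = inverse (real (Suc k))" for k
  have h: "0 < h k" "h k \<le> 1" for k by (auto simp: h_def inverse_le_1_iff)
  define D where "D k x = (F (h k *\<^sub>R b + x) - F x) / h k" for k x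
  have line: "((\<lambda>t. F (t *\<^sub>R b + x)) has_real_derivative F' (t *\<^sub>R b + x) b) (at t)" for t x
  proof -
    have "((\<lambda>t. t *\<^sub>R b + x) has_derivative (\<lambda>t. t *\<^sub>R b)) (at t)"
      by (auto intro!: derivative_eq_intros)
    from diff_chain_at[OF this der] have "((\<lambda>t. F (t *\<^sub>R b + x)) has_derivative (\<lambda>r. F' (t *\<^sub>R b + x) (r *\<^sub>R b))) (at t)"
      by (simp add: o_def)
    moreover have "(\<lambda>r. F' (t *\<^sub>R b + x) (r *\<^sub>R b)) = (*) (F' (t *\<^sub>R b + x) b)"
      using linear_scale[OF has_derivative_linear[OF der]] by (simp add: fun_eq_iff mult.commute)
    ultimately show ?thesis by (simp add: has_field_derivative_def)
  qed
  have lim: "(\<lambda>k. D k x) \<longlonglongrightarrow> F' x b" for x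
  proof -
    have "((\<lambda>d. (F (d *\<^sub>R b + x) - F x) / d) \<longlongrightarrow> F' x b) (at 0)"
      using line[of x 0] by (simp add: DERIV_def)
    moreover have "filterlim h (at 0) sequentially"
      unfolding filterlim_at h_def[abs_def] using LIMSEQ_inverse_real_of_nat by auto
    ultimately show ?thesis
      unfolding D_def by (rule filterlim_compose)
  qed
  have bound: "\<bar>D k x\<bar> \<le> M * indicator S x" for k x
  proof (cases "norm x \<le> R + norm b")
    case True
    obtain t where t: "0 < t" "t < h k" "F (h k *\<^sub>R b + x) - F (0 *\<^sub>R b + x) = (h k - 0) * F' (t *\<^sub>R b + x) b"
      using MVT2[of 0 "h k" "\<lambda>t. F (t *\<^sub>R b + x)" "\<lambda>t. F' (t *\<^sub>R b + x) b"] line h[of k] by auto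
    have "norm (t *\<^sub>R b + x) \<le> t * norm b + norm x"
      using norm_triangle_ineq[of "t *\<^sub>R b" x] t by simp
    also have "t * norm b \<le> 1 * norm b" using t h[of k] by (intro mult_right_mono) auto
    finally have "t *\<^sub>R b + x \<in> S" using True by (simp add: S_def)
    moreover have "D k x = F' (t *\<^sub>R b + x) b" using t(3) h[of k] by (simp add: D_def)
    moreover have "x \<in> S" unfolding S_def mem_cball dist_0_norm using True norm_ge_zero[of b] by linarith
    ultimately show ?thesis using M by simp
  next
    case False
    have "norm x - norm (h k *\<^sub>R b) \<le> norm (h k *\<^sub>R b + x)"
      using norm_diff_ineq[of x "h k *\<^sub>R b"] by (simp add: add.commute)
    moreover have "norm (h k *\<^sub>R b) \<le> 1 * norm b" using h[of k] mult_right_mono[of "h k" 1 "norm b"] by simp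
    ultimately have "\<not> norm (h k *\<^sub>R b + x) \<le> R" using False by linarith
    moreover have "\<not> norm x \<le> R" using False norm_ge_zero[of b] by linarith
    ultimately have "F (h k *\<^sub>R b + x) = 0" "F x = 0" using supp by blast+
    then show ?thesis using M by (simp add: D_def)
  qed
  have "(\<lambda>k. integral\<^sup>L lborel (D k)) \<longlonglongrightarrow> (\<integral>x. F' x b \<partial>lborel)"
  proof (rule integral_dominated_convergence[OF _ _ Sfin[of M]])
    show "AE x in lborel. (\<lambda>k. D k x) \<longlonglongrightarrow> F' x b" using lim by simp
    show "AE x in lborel. norm (D k x) \<le> M * indicator S x" for k using bound by simp
    show "D k \<in> borel_measurable lborel" for k unfolding D_def[abs_def] by measurable
    show "(\<lambda>x. F' x b) \<in> borel_measurable lborel" using F'm by simp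
  qed
  moreover have "integral\<^sup>L lborel (D k) = 0" for k
    unfolding D_def using lborel_integral_translate[OF Fm, of "h k *\<^sub>R b"] iF by simp
  ultimately show ?thesis by (simp add: LIMSEQ_const_iff)
qed

text \<open>At x = 0 both sides are 0, since \<open>powr\<close> with base 0 is 0 for every
  exponent.\<close>

lemma inner_self_powr: "(x \<bullet> x) powr c = norm x powr (2 * c)"
proof (cases "x = 0")
  case False
  then have "x \<bullet> x = norm x powr 2" by (simp add: power2_norm_eq_inner[symmetric])
  then show ?thesis by (simp only: powr_powr)
qed simp

lemma has_derivative_inner_self_powr:
  fixes x :: "'a::euclidean_space"
  assumes "x \<bullet> x + \<delta> > 0"
  shows "((\<lambda>x. (x \<bullet> x + \<delta>) powr c) has_derivative (\<lambda>h. (2 * c * (x \<bullet> x + \<delta>) powr (c - 1)) * (x \<bullet> h))) (at x)"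
proof -
  have "((\<lambda>x. x \<bullet> x + \<delta>) has_derivative (\<lambda>h. x \<bullet> h + h \<bullet> x)) (at x)"
    using has_derivative_add[OF has_derivative_inner[OF has_derivative_ident has_derivative_ident] has_derivative_const[of \<delta>]]
    by simp
  from DERIV_compose_FDERIV[OF has_real_derivative_powr[OF assms, of c] this]
  show ?thesis by (simp add: inner_commute mult_ac)
qed

lemma test_functionD:
  fixes \<phi> :: "'a::euclidean_space \<Rightarrow> real"
  assumes "\<phi> \<in> test_functions A"
  shows "(\<phi> has_derivative frechet_derivative \<phi> (at x)) (at x)"
    and "continuous_on UNIV (\<lambda>x. frechet_derivative \<phi> (at x) v)"
    and "x \<notin> A \<Longrightarrow> \<phi> x = 0"
    and "x \<notin> A \<Longrightarrow> frechet_derivative \<phi> (at x) v = 0"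
proof -
  have "Ck (Suc 0) \<phi>" using assms by (auto simp: test_functions_def simp del: Ck.simps)
  then show der: "(\<phi> has_derivative frechet_derivative \<phi> (at x)) (at x)"
    and "continuous_on UNIV (\<lambda>x. frechet_derivative \<phi> (at x) v)"
    by (auto simp: frechet_derivative_works[symmetric])
  let ?S = "{x. \<phi> x \<noteq> 0}"
  have S: "closure ?S \<subseteq> A" using assms by (simp add: test_functions_def compactly_contained_def)
  show "\<phi> x = 0" if "x \<notin> A" using S closure_subset[of ?S] that by auto
  show "frechet_derivative \<phi> (at x) v = 0" if "x \<notin> A"
  proof -
    have "((\<lambda>_. 0) has_derivative (\<lambda>_. 0)) (at x)" by simp
    then have "(\<phi> has_derivative (\<lambda>_. 0)) (at x)"
    proof (rule has_derivative_transform_within_open)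
      show "open (- closure ?S)" by auto
      show "x \<in> - closure ?S" using S that by auto
      show "0 = \<phi> y" if "y \<in> - closure ?S" for y using closure_subset[of ?S] that by auto
    qed
    then show ?thesis using frechet_derivative_at[of \<phi> "\<lambda>_. 0" x] by metis
  qed
qed

context power_solution
begin

definition grad :: "real ^ 'n \<Rightarrow> real ^ 'n"
  where "grad x = (- \<gamma> * norm x powr (- \<gamma> - 2)) *\<^sub>R x"

lemma grad_measurable [measurable]: "grad \<in> borel_measurable borel"
  unfolding grad_def[abs_def] by measurable

lemma norm_grad: "norm (grad x) = \<bar>\<gamma>\<bar> * norm x powr (- (\<gamma> + 1))"
proof (cases "x = 0")
  case False
  have "- \<gamma> - 2 + 1 = - (\<gamma> + 1)" by simp
  then have "norm x powr (- \<gamma> - 2) * norm x powr 1 = norm x powr (- (\<gamma> + 1))"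
    by (simp only: powr_add[symmetric])
  then show ?thesis using False by (simp add: grad_def abs_mult)
qed (simp add: grad_def)

lemma abs_grad_inner_le: "b \<in> Basis \<Longrightarrow> \<bar>grad x \<bullet> b\<bar> \<le> \<bar>\<gamma>\<bar> * norm x powr (- (\<gamma> + 1))"
  using Cauchy_Schwarz_ineq2[of "grad x" b] by (simp add: norm_grad)

lemma GDERIV_u: "x \<noteq> 0 \<Longrightarrow> GDERIV u x :> grad x"
proof -
  assume "x \<noteq> 0"
  then have "((\<lambda>x. (x \<bullet> x + 0) powr (- \<gamma> / 2)) has_derivative
    (\<lambda>h. (2 * (- \<gamma> / 2) * (x \<bullet> x + 0) powr (- \<gamma> / 2 - 1)) * (x \<bullet> h))) (at x)"
    by (intro has_derivative_inner_self_powr) simp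
  moreover have "(\<lambda>x. (x \<bullet> x + 0) powr (- \<gamma> / 2)) = u"
    by (simp add: fun_eq_iff u_eq inner_self_powr)
  moreover have "(2 * (- \<gamma> / 2) * (x \<bullet> x + 0) powr (- \<gamma> / 2 - 1)) * (x \<bullet> h) = h \<bullet> grad x" for h
    by (simp add: inner_self_powr grad_def inner_commute algebra_simps)
  ultimately show ?thesis by (simp add: gderiv_def)
qed

lemma gamma_plus_1_less: "\<gamma> + 1 < n"
  using gamma_lt p_gt n_pos divide_left_mono[of 1 p n] by simp

lemma grad_Lp:
  assumes "0 \<le> t" "(\<gamma> + 1) * t < n"
  shows "(\<lambda>x. norm (grad x)) \<in> Lp t (ball 0 1)"
  using assms by (intro Lp_power[where R = 1 and c = "\<bar>\<gamma>\<bar>" and a = "\<gamma> + 1"]) (auto simp: norm_grad n_eq)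

text \<open>Integration by parts is available for the smooth functions (|x|^2 + \<delta>)^(-\<gamma>
  / 2), and \<delta> -> 0 by dominated convergence. The majorant needs |x|^(- (\<gamma> + 1)) to be
  integrable on the ball, that is \<gamma> + 1 < n.\<close>

lemma is_weak_gradient_grad: "is_weak_gradient (ball 0 1) u grad"
  unfolding is_weak_gradient_def
proof (intro conjI ballI)
  have sub: "K \<in> sets borel" "K \<subseteq> ball 0 1" if "compact K \<and> K \<subseteq> ball 0 1" for K :: "(real ^ 'n) set"
    using that by (auto intro: borel_compact)
  show "u \<in> Lp_loc 1 (ball 0 1)"
    unfolding Lp_loc_def using gamma_plus_1_less sub
    by (intro CollectI allI impI Lp_power[where R = 1 and c = 1 and a = \<gamma>]) (auto simp: u_eq n_eq intro!: AE_I2)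
  show "(\<lambda>x. grad x \<bullet> b) \<in> Lp_loc 1 (ball 0 1)" if "b \<in> Basis" for b
    unfolding Lp_loc_def using gamma_plus_1_less sub abs_grad_inner_le[OF that]
    by (intro CollectI allI impI Lp_power[where R = 1 and c = "\<bar>\<gamma>\<bar>" and a = "\<gamma> + 1"]) (auto simp: n_eq intro!: AE_I2)
  fix \<phi> :: "real ^ 'n \<Rightarrow> real" and b :: "real ^ 'n"
  assume \<phi>: "\<phi> \<in> test_functions (ball 0 1)" and b: "b \<in> Basis"
  note td = test_functionD[OF \<phi>]
  define \<psi> where "\<psi> x = frechet_derivative \<phi> (at x) b" for x
  have cont\<psi>: "continuous_on UNIV \<psi>" unfolding \<psi>_def[abs_def] by (rule td(2))
  have cont\<phi>: "continuous_on UNIV \<phi>"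
    using td(1) by (meson continuous_at_imp_continuous_on has_derivative_continuous)
  have [measurable]: "\<phi> \<in> borel_measurable borel" "\<psi> \<in> borel_measurable borel"
    using cont\<phi> cont\<psi> by (auto intro: borel_measurable_continuous_onI)
  have out: "\<phi> x = 0" "\<psi> x = 0" if "x \<notin> ball 0 1" for x
    using td(3,4)[OF that] by (auto simp: \<psi>_def)
  obtain M where M: "M > 0" "\<And>x. \<bar>\<phi> x\<bar> \<le> M" "\<And>x. \<bar>\<psi> x\<bar> \<le> M"
  proof -
    have "bounded (\<phi> ` cball 0 1)" "bounded (\<psi> ` cball 0 1)"
      by (intro compact_imp_bounded compact_continuous_image continuous_on_subset[OF cont\<phi>] continuous_on_subset[OF cont\<psi>]; simp)+
    then obtain M1 M2 where "M1 > 0" "\<forall>x\<in>cball 0 1. \<bar>\<phi> x\<bar> \<le> M1" "M2 > 0" "\<forall>x\<in>cball 0 1. \<bar>\<psi> x\<bar> \<le> M2"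
      unfolding bounded_pos by auto
    moreover have "\<phi> x = 0 \<and> \<psi> x = 0" if "x \<notin> cball 0 1" for x using out[of x] that by auto
    ultimately have "\<bar>\<phi> x\<bar> \<le> max M1 M2 \<and> \<bar>\<psi> x\<bar> \<le> max M1 M2" for x
      by (cases "x \<in> cball 0 1") (auto simp: le_max_iff_disj)
    then show thesis using \<open>M1 > 0\<close> by (intro that[of "max M1 M2"]) auto
  qed
  define \<delta> where "\<delta> k = inverse (real (Suc k))" for k
  have \<delta>: "0 < \<delta> k" "\<delta> k \<le> 1" for k by (auto simp: \<delta>_def inverse_le_1_iff)
  have \<delta>_lim: "\<delta> \<longlonglongrightarrow> 0" unfolding \<delta>_def by (rule LIMSEQ_inverse_real_of_nat)
  define U where "U k x = (x \<bullet> x + \<delta> k) powr (- \<gamma> / 2)" for k and x :: "real ^ 'n"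
  define V where "V k x = (2 * (- \<gamma> / 2) * (x \<bullet> x + \<delta> k) powr (- \<gamma> / 2 - 1)) * (x \<bullet> b)" for k and x :: "real ^ 'n"
  have posd: "x \<bullet> x + \<delta> k > 0" for k and x :: "real ^ 'n" using \<delta>[of k] inner_ge_zero[of x] by linarith
  have pos_ne: "x \<bullet> x + \<delta> k \<noteq> 0" for k and x :: "real ^ 'n" using posd[of x k] by simp
  have zero: "(\<integral>x. U k x * \<psi> x + V k x * \<phi> x \<partial>lborel) = 0" for k
  proof -
    let ?F' = "\<lambda>x h. U k x * frechet_derivative \<phi> (at x) h + (2 * (- \<gamma> / 2) * (x \<bullet> x + \<delta> k) powr (- \<gamma> / 2 - 1)) * (x \<bullet> h) * \<phi> x"
    have "(\<integral>x. ?F' x b \<partial>lborel) = 0"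
    proof (rule integral_directional_derivative_eq_0[where F = "\<lambda>x. U k x * \<phi> x" and R = 1])
      show "((\<lambda>x. U k x * \<phi> x) has_derivative ?F' x) (at x)" for x
        unfolding U_def by (rule has_derivative_mult[OF has_derivative_inner_self_powr[OF posd] td(1)])
      show "continuous_on UNIV (\<lambda>x. ?F' x b)"
        unfolding U_def using pos_ne cont\<phi> td(2)[of b]
        by (intro continuous_intros) auto
      show "norm x \<le> 1" if "U k x * \<phi> x \<noteq> 0" for x
        using out(1)[of x] that by (cases "x \<in> ball 0 1") auto
    qed
    then show ?thesis by (simp add: \<psi>_def V_def)
  qed
  \<comment> \<open>The first term controls \<open>U\<close> for \<gamma> >= 0, the second (a
    constant off the origin) for \<gamma> < 0, and the third controls \<open>V\<close>.\<close>
  define B where "B x = M * (indicator (ball 0 1) x * norm x powr (- \<gamma>)) + M * 2 powr \<bar>\<gamma>\<bar> * (indicator (ball 0 1) x * norm x powr (- 0))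
    + M * \<bar>\<gamma>\<bar> * (indicator (ball 0 1) x * norm x powr (- (\<gamma> + 1)))" for x :: "real ^ 'n"
  have Bint: "integrable lborel B"
    unfolding B_def using gamma_plus_1_less n_pos
    by (intro Bochner_Integration.integrable_add integrable_mult_right integrable_power_ball) (auto simp: n_eq)
  have Ubound: "\<bar>U k x\<bar> \<le> norm x powr (- \<gamma>) + 2 powr \<bar>\<gamma>\<bar>" if x: "x \<noteq> 0" "norm x < 1" for k x
  proof (cases "\<gamma> \<ge> 0")
    case True
    have "U k x \<le> (x \<bullet> x) powr (- \<gamma> / 2)"
      unfolding U_def using True x \<delta>[of k] by (intro powr_mono2') auto
    also have "\<dots> = norm x powr (- \<gamma>)" by (simp add: inner_self_powr)
    finally show ?thesis by (simp add: U_def add_increasing2)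
  next
    case False
    have "x \<bullet> x \<le> 1" using x by (simp add: power2_norm_eq_inner[symmetric] power_le_one)
    then have "U k x \<le> 2 powr (- \<gamma> / 2)"
      unfolding U_def using False \<delta>[of k] by (intro powr_mono2) auto
    also have "\<dots> \<le> 2 powr \<bar>\<gamma>\<bar>" using False by (intro powr_mono) auto
    finally show ?thesis by (simp add: U_def add_increasing)
  qed
  have Vbound: "\<bar>V k x\<bar> \<le> \<bar>\<gamma>\<bar> * norm x powr (- (\<gamma> + 1))" if x: "x \<noteq> 0" for k x
  proof -
    \<comment> \<open>The factor is bounded by a power of |x|^2 + \<delta>, so that the powers merge
      before \<delta> is dropped. The merged exponent - (\<gamma> + 1) / 2 is negative, which
      permits dropping it.\<close>
    have "\<bar>x \<bullet> b\<bar> \<le> norm x" using Basis_le_norm[OF b] .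
    also have "norm x = (x \<bullet> x) powr (1 / 2)" by (simp add: inner_self_powr)
    also have "\<dots> \<le> (x \<bullet> x + \<delta> k) powr (1 / 2)" using \<delta>[of k] by (intro powr_mono2) auto
    finally have "\<bar>V k x\<bar> \<le> \<bar>\<gamma>\<bar> * (x \<bullet> x + \<delta> k) powr (- \<gamma> / 2 - 1) * (x \<bullet> x + \<delta> k) powr (1 / 2)"
      unfolding V_def abs_mult by (intro mult_mono) auto
    also have "\<dots> = \<bar>\<gamma>\<bar> * (x \<bullet> x + \<delta> k) powr (- (\<gamma> + 1) / 2)"
    proof -
      have "- \<gamma> / 2 - 1 + 1 / 2 = - (\<gamma> + 1) / 2" by (simp add: field_simps)
      then show ?thesis by (simp only: mult.assoc powr_add[symmetric])
    qed
    also have "\<dots> \<le> \<bar>\<gamma>\<bar> * (x \<bullet> x) powr (- (\<gamma> + 1) / 2)"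
      using gamma_gt x \<delta>[of k] by (intro mult_left_mono powr_mono2') auto
    also have "(x \<bullet> x) powr (- (\<gamma> + 1) / 2) = norm x powr (- (\<gamma> + 1))"
    proof -
      have "2 * (- (\<gamma> + 1) / 2) = - (\<gamma> + 1)" by (simp add: field_simps)
      then show ?thesis by (simp only: inner_self_powr)
    qed
    finally show ?thesis .
  qed
  have "(\<lambda>k. \<integral>x. U k x * \<psi> x + V k x * \<phi> x \<partial>lborel) \<longlonglongrightarrow> (\<integral>x. u x * \<psi> x + (grad x \<bullet> b) * \<phi> x \<partial>lborel)"
  proof (rule integral_dominated_convergence[OF _ _ Bint])
    show "AE x in lborel. (\<lambda>k. U k x * \<psi> x + V k x * \<phi> x) \<longlonglongrightarrow> u x * \<psi> x + (grad x \<bullet> b) * \<phi> x"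
    proof (rule eventually_mono[OF AE_lborel_singleton[of "0 :: real ^ 'n"]])
      fix x :: "real ^ 'n" assume "x \<noteq> 0"
      then have nz: "x \<bullet> x + 0 \<noteq> 0" by simp
      have "(\<lambda>k. x \<bullet> x + \<delta> k) \<longlonglongrightarrow> x \<bullet> x + 0" by (intro tendsto_intros \<delta>_lim)
      from tendsto_powr[OF this tendsto_const nz]
      have *: "(\<lambda>k. (x \<bullet> x + \<delta> k) powr c) \<longlonglongrightarrow> norm x powr (2 * c)" for c by (simp add: inner_self_powr)
      have "(\<lambda>k. U k x) \<longlonglongrightarrow> u x" using *[of "- \<gamma> / 2"] by (simp add: U_def u_eq)
      moreover have "(\<lambda>k. V k x) \<longlonglongrightarrow> (2 * (- \<gamma> / 2) * norm x powr (2 * (- \<gamma> / 2 - 1))) * (x \<bullet> b)"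
        unfolding V_def by (intro tendsto_intros *)
      moreover have "(2 * (- \<gamma> / 2) * norm x powr (2 * (- \<gamma> / 2 - 1))) * (x \<bullet> b) = grad x \<bullet> b"
        by (simp add: grad_def algebra_simps)
      ultimately show "(\<lambda>k. U k x * \<psi> x + V k x * \<phi> x) \<longlonglongrightarrow> u x * \<psi> x + (grad x \<bullet> b) * \<phi> x"
        by (auto intro!: tendsto_add tendsto_mult)
    qed
    show "AE x in lborel. norm (U k x * \<psi> x + V k x * \<phi> x) \<le> B x" for k
    proof (rule eventually_mono[OF AE_lborel_singleton[of "0 :: real ^ 'n"]])
      fix x :: "real ^ 'n" assume x: "x \<noteq> 0"
      show "norm (U k x * \<psi> x + V k x * \<phi> x) \<le> B x"
      proof (cases "norm x < 1")
        case True
        have "\<bar>U k x * \<psi> x\<bar> \<le> (norm x powr (- \<gamma>) + 2 powr \<bar>\<gamma>\<bar>) * M"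
          unfolding abs_mult using Ubound[OF x True] M by (intro mult_mono) auto
        moreover have "\<bar>V k x * \<phi> x\<bar> \<le> (\<bar>\<gamma>\<bar> * norm x powr (- (\<gamma> + 1))) * M"
          unfolding abs_mult using Vbound[OF x] M by (intro mult_mono) auto
        ultimately have "\<bar>U k x * \<psi> x + V k x * \<phi> x\<bar> \<le> (norm x powr (- \<gamma>) + 2 powr \<bar>\<gamma>\<bar>) * M + (\<bar>\<gamma>\<bar> * norm x powr (- (\<gamma> + 1))) * M"
          by linarith
        also have "\<dots> = B x" using True x by (simp add: B_def algebra_simps)
        finally show ?thesis by simp
      next
        case False
        then show ?thesis using out[of x] by (simp add: B_def)
      qed
    qed
  qed (simp_all add: U_def V_def)
  then have sum0: "(\<integral>x. u x * \<psi> x + (grad x \<bullet> b) * \<phi> x \<partial>lborel) = 0"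
    using zero by (simp add: LIMSEQ_const_iff)
  have i1: "integrable lborel (\<lambda>x. u x * \<psi> x)"
  proof (rule Bochner_Integration.integrable_bound[OF Bint])
    show "AE x in lborel. norm (u x * \<psi> x) \<le> norm (B x)"
    proof (rule AE_I2)
      fix x
      show "norm (u x * \<psi> x) \<le> norm (B x)"
      proof (cases "norm x < 1")
        case True
        have "\<bar>u x * \<psi> x\<bar> \<le> norm x powr (- \<gamma>) * M" unfolding abs_mult u_eq using M by (intro mult_mono) auto
        also have "\<dots> \<le> B x" using True M by (simp add: B_def)
        finally show ?thesis by simp
      next
        case False then show ?thesis using out[of x] by simp
      qed
    qed
  qed simp
  have i2: "integrable lborel (\<lambda>x. (grad x \<bullet> b) * \<phi> x)"
  proof (rule Bochner_Integration.integrable_bound[OF Bint])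
    show "AE x in lborel. norm ((grad x \<bullet> b) * \<phi> x) \<le> norm (B x)"
    proof (rule AE_I2)
      fix x
      show "norm ((grad x \<bullet> b) * \<phi> x) \<le> norm (B x)"
      proof (cases "norm x < 1")
        case True
        have "\<bar>(grad x \<bullet> b) * \<phi> x\<bar> \<le> (\<bar>\<gamma>\<bar> * norm x powr (- (\<gamma> + 1))) * M"
          unfolding abs_mult using M abs_grad_inner_le[OF b] by (intro mult_mono) auto
        also have "\<dots> \<le> B x" using True M by (simp add: B_def)
        finally show ?thesis by simp
      next
        case False then show ?thesis using out[of x] by simp
      qed
    qed
  qed simp
  have "(\<integral>x. u x * \<psi> x \<partial>lborel) = - (\<integral>x. (grad x \<bullet> b) * \<phi> x \<partial>lborel)"
    using sum0 i1 i2 by simp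
  moreover have eq: "(\<lambda>x. indicator (ball 0 1) x * (u x * \<psi> x)) = (\<lambda>x. u x * \<psi> x)"
      "(\<lambda>x. indicator (ball 0 1) x * ((grad x \<bullet> b) * \<phi> x)) = (\<lambda>x. (grad x \<bullet> b) * \<phi> x)"
    using out by (force simp: indicator_def)+
  ultimately show "(\<integral>x. u x * frechet_derivative \<phi> (at x) b \<partial>lebesgue_on (ball 0 1)) = - (\<integral>x. (grad x \<bullet> b) * \<phi> x \<partial>lebesgue_on (ball 0 1))"
    using integral_lebesgue_on_eq[of "\<lambda>x. u x * \<psi> x" "ball 0 1"]
      integral_lebesgue_on_eq[of "\<lambda>x. (grad x \<bullet> b) * \<phi> x" "ball 0 1"]
    unfolding \<psi>_def[symmetric] eq by simp
qed

end

section \<open>Bump functions\<close>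

text \<open>The powers of t make the family closed under differentiation up to linear combinations;
  \<open>flat 0\<close> is the usual smooth function that vanishes on the negative axis.\<close>

definition flat :: "nat \<Rightarrow> real \<Rightarrow> real"
  where "flat m t = (if t \<le> 0 then 0 else exp (- (1 / t)) / t ^ m)"

lemma power_le_fact_exp: "x \<ge> 0 \<Longrightarrow> x ^ k \<le> fact k * exp (x :: real)"
proof -
  assume x: "x \<ge> 0"
  have "(\<Sum>i\<in>{k}. x ^ i /\<^sub>R fact i) \<le> (\<Sum>i. x ^ i /\<^sub>R fact i)"
    using x by (intro sum_le_suminf summable_exp_generic) auto
  then have "x ^ k / fact k \<le> exp x" by (simp add: exp_def divide_inverse mult.commute)
  then show ?thesis by (simp add: field_simps)
qed

text \<open>The exponential beats one power of 1 / t more than the definition contains. The spare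
  factor |t| yields the derivative 0 at t = 0.\<close>

lemma flat_le: "0 \<le> flat m t" "flat m t \<le> fact (Suc m) * \<bar>t\<bar>"
proof -
  show "flat m t \<le> fact (Suc m) * \<bar>t\<bar>"
  proof (cases "t \<le> 0")
    case False
    have "(1 / t) ^ Suc m \<le> fact (Suc m) * exp (1 / t)" using False by (intro power_le_fact_exp) auto
    then have "exp (- (1 / t)) * (1 / t) ^ Suc m \<le> exp (- (1 / t)) * (fact (Suc m) * exp (1 / t))"
      by (intro mult_left_mono) auto
    also have "\<dots> = fact (Suc m)" by (simp add: exp_minus)
    finally have "flat m t * (1 / t) \<le> fact (Suc m)" using False by (simp add: flat_def field_simps)
    then show ?thesis using False by (simp add: field_simps)
  next
    case True
    then have "flat m t = 0" by (simp add: flat_def)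
    also have "0 \<le> fact (Suc m) * \<bar>t\<bar>" by (intro mult_nonneg_nonneg) auto
    finally show ?thesis .
  qed
qed (simp add: flat_def)

lemma flat_has_derivative:
  "(flat m has_real_derivative (flat (m + 2) t - real m * flat (m + 1) t)) (at t)"
proof -
  consider "t < 0" | "t = 0" | "t > 0" by linarith
  then show ?thesis
  proof cases
    case 1
    have "((\<lambda>_. 0) has_real_derivative 0) (at t)" by simp
    then have "(flat m has_real_derivative 0) (at t)"
      by (rule has_field_derivative_transform_within_open[where S = "{..<0}"]) (use 1 in \<open>auto simp: flat_def\<close>)
    then show ?thesis using 1 by (simp add: flat_def)
  next
    case 2
    have "(\<lambda>h. flat m h / h) \<midarrow>0\<rightarrow> 0"
    proof (rule Lim_null_comparison[where g = "\<lambda>h. fact (m + 2) * \<bar>h\<bar>"])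
      have "norm (flat m h / h) \<le> fact (m + 2) * \<bar>h\<bar>" for h
      proof (cases "h \<le> 0")
        case False
        then have "flat m h / h = flat (m + 1) h" by (simp add: flat_def)
        then show ?thesis using flat_le[of "m + 1" h] by simp
      next
        case True
        then have "norm (flat m h / h) = 0" by (simp add: flat_def)
        also have "0 \<le> fact (m + 2) * \<bar>h\<bar>" by (intro mult_nonneg_nonneg) auto
        finally show ?thesis .
      qed
      then show "\<forall>\<^sub>F h in at 0. norm (flat m h / h) \<le> fact (m + 2) * \<bar>h\<bar>" by simp
      show "(\<lambda>h. fact (m + 2) * \<bar>h\<bar>) \<midarrow>0\<rightarrow> (0::real)"
        by (rule tendsto_mult_right_zero, rule tendsto_rabs_zero, rule tendsto_ident_at)
    qed
    then show ?thesis using 2 by (simp add: DERIV_def flat_def)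
  next
    case 3
    have "((\<lambda>t. exp (- (1 / t)) * inverse t ^ m) has_real_derivative (flat (m + 2) t - real m * flat (m + 1) t)) (at t)"
      using 3
      by (auto intro!: derivative_eq_intros simp: flat_def power2_eq_square)
         (cases m; simp add: field_simps power2_eq_square)
    then show ?thesis
      by (rule has_field_derivative_transform_within_open[where S = "{0<..}"])
         (use 3 in \<open>auto simp: flat_def power_inverse divide_inverse\<close>)
  qed
qed

text \<open>\<open>Ck\<close> recurses through all directional derivatives, so its induction needs a
  class of functions closed under them. The first rule composes \<open>flat\<close> with quadratic
  polynomials; linear functions and constants enter through the chain rule.\<close>

inductive bump_algebra :: "('a::euclidean_space \<Rightarrow> real) \<Rightarrow> bool" where
  flat: "bump_algebra (\<lambda>x. flat m (R - (c *\<^sub>R x - a) \<bullet> (c *\<^sub>R x - a)))"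
| inner: "bump_algebra (\<lambda>x. x \<bullet> v)"
| const: "bump_algebra (\<lambda>x. k)"
| add: "bump_algebra f \<Longrightarrow> bump_algebra h \<Longrightarrow> bump_algebra (\<lambda>x. f x + h x)"
| mult: "bump_algebra f \<Longrightarrow> bump_algebra h \<Longrightarrow> bump_algebra (\<lambda>x. f x * h x)"

lemma bump_algebra_derivative:
  "bump_algebra f \<Longrightarrow> \<exists>D. (\<forall>x. (f has_derivative (\<lambda>v. D v x)) (at x)) \<and> (\<forall>v. bump_algebra (D v))"
proof (induction rule: bump_algebra.induct)
  case (flat m R c a)
  define r where "r x = R - (c *\<^sub>R x - a) \<bullet> (c *\<^sub>R x - a)" for x
  define D where "D v x = ((c * c * (- 2)) * (x \<bullet> v) + 2 * c * (a \<bullet> v)) * (flat (m + 2) (r x) + (- real m) * flat (m + 1) (r x))" for v x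
  have "((\<lambda>x. flat m (r x)) has_derivative (\<lambda>v. D v x)) (at x)" for x
  proof -
    have 1: "((\<lambda>x. c *\<^sub>R x - a) has_derivative (\<lambda>v. c *\<^sub>R v)) (at x)"
      by (auto intro!: derivative_eq_intros)
    have "(r has_derivative (\<lambda>v. - ((c *\<^sub>R x - a) \<bullet> (c *\<^sub>R v) + (c *\<^sub>R v) \<bullet> (c *\<^sub>R x - a)))) (at x)"
      unfolding r_def[abs_def]
      using has_derivative_diff[OF has_derivative_const[of R] has_derivative_inner[OF 1 1]] by simp
    from DERIV_compose_FDERIV[OF flat_has_derivative this]
    show ?thesis
      by (rule has_derivative_eq_rhs) (simp add: fun_eq_iff D_def inner_diff_left inner_diff_right inner_commute algebra_simps)
  qed
  moreover have "bump_algebra (D v)" for v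
    unfolding D_def[abs_def] r_def by (intro bump_algebra.intros)
  ultimately show ?case unfolding r_def by blast
next
  case (inner v)
  have "((\<lambda>x. x \<bullet> v) has_derivative (\<lambda>w. w \<bullet> v)) (at x)" for x by (auto intro!: derivative_eq_intros)
  moreover have "bump_algebra (\<lambda>_. w \<bullet> v)" for w by (rule bump_algebra.const)
  ultimately show ?case by (intro exI[of _ "\<lambda>w _. w \<bullet> v"]) auto
next
  case (const k)
  show ?case by (intro exI[of _ "\<lambda>_ _. 0"]) (auto intro: bump_algebra.const)
next
  case (add f h)
  then obtain D E where D: "\<And>x. (f has_derivative (\<lambda>v. D v x)) (at x)" "\<And>v. bump_algebra (D v)"
    and E: "\<And>x. (h has_derivative (\<lambda>v. E v x)) (at x)" "\<And>v. bump_algebra (E v)" by blast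
  show ?case
    by (intro exI[of _ "\<lambda>v x. D v x + E v x"] conjI allI has_derivative_add D E bump_algebra.add)
next
  case (mult f h)
  then obtain D E where D: "\<And>x. (f has_derivative (\<lambda>v. D v x)) (at x)" "\<And>v. bump_algebra (D v)"
    and E: "\<And>x. (h has_derivative (\<lambda>v. E v x)) (at x)" "\<And>v. bump_algebra (E v)" by blast
  show ?case
    by (intro exI[of _ "\<lambda>v x. f x * E v x + D v x * h x"] conjI allI has_derivative_mult D E
        bump_algebra.add bump_algebra.mult mult.hyps)
qed

lemma bump_algebra_Ck: "bump_algebra f \<Longrightarrow> Ck k f"
proof (induction k arbitrary: f)
  case 0
  then obtain D where "\<And>x. (f has_derivative (\<lambda>v. D v x)) (at x)"
    using bump_algebra_derivative by blast
  then show ?case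
    by (auto intro!: continuous_at_imp_continuous_on has_derivative_continuous)
next
  case (Suc k)
  then obtain D where D: "\<And>x. (f has_derivative (\<lambda>v. D v x)) (at x)" "\<And>v. bump_algebra (D v)"
    using bump_algebra_derivative by blast
  have "frechet_derivative f (at x) = (\<lambda>v. D v x)" for x
    using frechet_derivative_at[OF D(1)] by simp
  then show ?case using D Suc.IH by (auto simp: differentiable_def)
qed

text \<open>For l > 0 it is positive exactly on the ball of radius l / 4 about the point l a. If |a|
  = 1/2, this ball keeps the distance l / 4 from the origin. Different values of \<open>l\<close>
  are dilates of each other.\<close>

definition bump :: "'a::euclidean_space \<Rightarrow> real \<Rightarrow> 'a \<Rightarrow> real"
  where "bump a l x = flat 0 (1 / 16 - ((1 / l) *\<^sub>R x - a) \<bullet> ((1 / l) *\<^sub>R x - a))"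

lemma bump_range: "0 \<le> bump a l x" "bump a l x \<le> 1"
  by (auto simp: bump_def flat_def)

lemma bump_pos_iff: "bump a l x > 0 \<longleftrightarrow> norm ((1 / l) *\<^sub>R x - a) < 1 / 4"
proof -
  have "norm ((1 / l) *\<^sub>R x - a) < 1 / 4 \<longleftrightarrow> (norm ((1 / l) *\<^sub>R x - a))\<^sup>2 < (1 / 4)\<^sup>2"
    using power2_less_imp_less[of "norm ((1 / l) *\<^sub>R x - a)" "1 / 4"]
      power_strict_mono[of "norm ((1 / l) *\<^sub>R x - a)" "1 / 4" 2] by auto
  then have "norm ((1 / l) *\<^sub>R x - a) < 1 / 4 \<longleftrightarrow> ((1 / l) *\<^sub>R x - a) \<bullet> ((1 / l) *\<^sub>R x - a) < 1 / 16"
    by (simp only: power2_norm_eq_inner) (simp add: power2_eq_square)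
  then show ?thesis by (simp add: bump_def flat_def not_le)
qed

lemma bump_measurable [measurable]: "bump a l \<in> borel_measurable borel"
  unfolding bump_def[abs_def] flat_def by measurable

lemma bump_eq_0:
  assumes "norm a = 1 / 2" "l > 0" "norm x \<ge> 3 / 4 * l"
  shows "bump a l x = 0"
proof (rule ccontr)
  assume "bump a l x \<noteq> 0"
  then have "bump a l x > 0" using bump_range(1)[of a l x] by simp
  then have "norm ((1 / l) *\<^sub>R x - a) < 1 / 4" by (simp add: bump_pos_iff)
  then have "norm ((1 / l) *\<^sub>R x) < 1 / 4 + norm a"
    using norm_triangle_ineq2[of "(1 / l) *\<^sub>R x" a] by linarith
  then have "norm x < 3 / 4 * l" using assms by (simp add: field_simps)
  then show False using assms by simp
qed

lemma bump_test_function: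
  assumes "norm (a :: 'a::euclidean_space) = 1 / 2" "0 < l" "l \<le> 1"
  shows "bump a l \<in> test_functions (ball 0 1)"
proof -
  have "bump_algebra (bump a l)"
    unfolding bump_def[abs_def] by (rule bump_algebra.flat)
  then have "\<forall>k. Ck k (bump a l)" using bump_algebra_Ck by blast
  moreover have "{x. bump a l x \<noteq> 0} \<subseteq> cball 0 (3 / 4)"
  proof
    fix x assume "x \<in> {x. bump a l x \<noteq> 0}"
    then have "\<not> norm x \<ge> 3 / 4 * l" using bump_eq_0[OF assms(1,2), of x] by auto
    then show "x \<in> cball 0 (3 / 4)" using assms by simp
  qed
  then have "closure {x. bump a l x \<noteq> 0} \<subseteq> cball 0 (3 / 4)"
    by (rule closure_minimal) simp
  then have "compactly_contained {x. bump a l x \<noteq> 0} (ball 0 1)"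
    unfolding compactly_contained_def
    by (auto intro!: bounded_closure bounded_subset[OF bounded_cball, of _ 0 "3 / 4"] simp: compact_eq_bounded_closed
        dest: subsetD)
  ultimately show ?thesis by (simp add: test_functions_def)
qed

section \<open>Failure of integrability of the gradient\<close>

lemma lborel_integral_scale:
  fixes f :: "'a::euclidean_space \<Rightarrow> real"
  assumes [measurable]: "f \<in> borel_measurable borel" and c: "c > 0"
  shows "integral\<^sup>L lborel f = c ^ DIM('a) * (\<integral>x. f (c *\<^sub>R x) \<partial>lborel)"
proof -
  have "(lborel :: 'a measure) = density (distr lborel borel (\<lambda>x. 0 + c *\<^sub>R x)) (\<lambda>_. \<bar>c\<bar> ^ DIM('a))"
    using c by (intro lborel_affine) simp
  then have "integral\<^sup>L lborel f = integral\<^sup>L (density (distr lborel borel (\<lambda>x. c *\<^sub>R x)) (\<lambda>_. c ^ DIM('a))) f"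
    using c by simp
  also have "\<dots> = c ^ DIM('a) * (\<integral>x. f (c *\<^sub>R x) \<partial>lborel)"
    using c by (subst integral_density) (auto simp: integral_distr)
  finally show ?thesis .
qed

lemma Lp_subset:
  fixes f :: "'a::euclidean_space \<Rightarrow> real"
  assumes "f \<in> Lp q B" "A \<subseteq> B" "A \<in> sets lebesgue" "B \<in> sets lebesgue"
  shows "f \<in> Lp q A"
proof -
  have "f \<in> borel_measurable (lebesgue_on A)"
    by (rule measurable_restrict_mono[OF _ assms(2)]) (use assms(1) in \<open>simp add: Lp_def\<close>)
  moreover have "integrable (lebesgue_on B) (\<lambda>x. \<bar>f x\<bar> powr q)" using assms by (simp add: Lp_def)
  then have "integrable lebesgue (\<lambda>x. indicator B x *\<^sub>R \<bar>f x\<bar> powr q)"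
    using assms by (subst (asm) integrable_restrict_space) auto
  then have "integrable lebesgue (\<lambda>x. indicator A x *\<^sub>R (indicator B x *\<^sub>R \<bar>f x\<bar> powr q))"
    by (rule integrable_mult_indicator[OF assms(3)])
  moreover have "(\<lambda>x. indicator A x *\<^sub>R (indicator B x *\<^sub>R \<bar>f x\<bar> powr q)) = (\<lambda>x. indicator A x *\<^sub>R \<bar>f x\<bar> powr q)"
    using assms(2) by (force simp: indicator_def)
  ultimately have "integrable (lebesgue_on A) (\<lambda>x. \<bar>f x\<bar> powr q)"
    using assms(3) integrable_restrict_space[of A lebesgue "\<lambda>x. \<bar>f x\<bar> powr q"] by simp
  with \<open>f \<in> borel_measurable (lebesgue_on A)\<close> show ?thesis by (simp add: Lp_def)
qed

text \<open>Young's inequality without its constants: either b <= a^(q - 1), and the first term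
  suffices, or a is at most b^(1 / (q - 1)), and the second does.\<close>

lemma mult_le_powr_conjugate:
  fixes a b q :: real
  assumes "a \<ge> 0" "b \<ge> 0" "q > 1"
  shows "a * b \<le> a powr q + b powr (q / (q - 1))"
proof (cases "a = 0 \<or> b = 0")
  case False
  then have ab: "a > 0" "b > 0" using assms by auto
  show ?thesis
  proof (cases "b \<le> a powr (q - 1)")
    case True
    then have "a * b \<le> a powr 1 * a powr (q - 1)" using ab by simp
    also have "\<dots> = a powr q" unfolding powr_add[symmetric] by simp
    finally show ?thesis by (simp add: add_increasing2)
  next
    case False
    then have "(a powr (q - 1)) powr (1 / (q - 1)) \<le> b powr (1 / (q - 1))"
      using assms by (intro powr_mono2) auto
    then have "a \<le> b powr (1 / (q - 1))" using ab assms by (simp add: powr_powr)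
    then have "a * b \<le> b powr (1 / (q - 1)) * b powr 1" using ab by simp
    also have "\<dots> = b powr (q / (q - 1))"
      unfolding powr_add[symmetric] using assms by (simp add: field_simps)
    finally show ?thesis by (simp add: add_increasing)
  qed
qed auto

lemma powr_le_one_plus_powr:
  fixes t :: real assumes "0 \<le> t" "0 \<le> a" "a \<le> b" shows "t powr a \<le> 1 + t powr b"
proof (cases "t \<le> 1")
  case True
  then have "t powr a \<le> 1" using assms by (simp add: powr_le1)
  then show ?thesis by (simp add: add_increasing2)
next
  case False
  then have "t powr a \<le> t powr b" using assms by (intro powr_mono) auto
  then show ?thesis by simp
qed

context power_solution
begin

lemma grad_scale: "l > 0 \<Longrightarrow> grad (l *\<^sub>R x) = l powr (- (\<gamma> + 1)) *\<^sub>R grad x"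
proof -
  assume l: "l > 0"
  have "- \<gamma> - 2 + 1 = - (\<gamma> + 1)" by simp
  then have "l powr (- \<gamma> - 2) * l = l powr (- (\<gamma> + 1))"
    using l powr_add[of l "- \<gamma> - 2" 1] by (simp only: powr_one)
  then show ?thesis using l by (simp add: grad_def powr_mult mult_ac)
qed

text \<open>On the ball where the bump is positive, x \<bullet> b > 1/2 - 1/4 > 0. Hence the
  integrand - \<gamma> P has constant sign and is nonzero on a whole ball.\<close>

lemma integral_grad_bump_neq_0:
  assumes "\<gamma> \<noteq> 0" "b \<in> Basis"
  shows "(\<integral>x. (grad x \<bullet> b) * bump ((1 / 2) *\<^sub>R b) 1 x \<partial>lborel) \<noteq> 0"
proof
  define a where "a = (1 / 2) *\<^sub>R b"
  define P where "P x = norm x powr (- \<gamma> - 2) * (x \<bullet> b) * bump a 1 x" for x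
  have a: "norm a = 1 / 2" "a \<bullet> b = 1 / 2" using assms by (simp_all add: a_def inner_Basis)
  have pos: "x \<bullet> b > 0" if "bump a 1 x > 0" for x
  proof -
    have "norm (x - a) < 1 / 4" using that by (simp add: bump_pos_iff)
    moreover have "\<bar>(x - a) \<bullet> b\<bar> \<le> norm (x - a)" using assms by (intro Basis_le_norm)
    ultimately show ?thesis using a by (simp add: inner_diff_left)
  qed
  have P0: "P x \<ge> 0" for x
  proof (cases "bump a 1 x > 0")
    case True
    then show ?thesis using pos[OF True] by (simp add: P_def)
  next
    case False
    then have "bump a 1 x = 0" using bump_range(1)[of a 1 x] by simp
    then show ?thesis by (simp add: P_def)
  qed
  have Ppos: "P x > 0" if "x \<in> ball a (1 / 4)" for x
  proof -
    have "bump a 1 x > 0" using that by (simp add: bump_pos_iff dist_norm norm_minus_commute)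
    moreover from pos[OF this] have "x \<noteq> 0" by auto
    ultimately show ?thesis using pos[of x] by (simp add: P_def)
  qed
  have eq: "(grad x \<bullet> b) * bump a 1 x = - \<gamma> * P x" for x
    by (simp add: grad_def P_def)
  have i: "integrable lborel P"
  proof (rule Bochner_Integration.integrable_bound)
    show "integrable lborel (\<lambda>x. indicator (ball (0 :: real ^ 'n) 1) x * norm x powr (- (\<gamma> + 1)))"
      using gamma_plus_1_less by (intro integrable_power_ball) (simp add: n_eq)
    show "P \<in> borel_measurable lborel" unfolding P_def[abs_def] by measurable
    show "AE x in lborel. norm (P x) \<le> norm (indicator (ball (0 :: real ^ 'n) 1) x * norm x powr (- (\<gamma> + 1)))"
    proof (rule AE_I2)
      fix x :: "real ^ 'n"
      show "norm (P x) \<le> norm (indicator (ball (0 :: real ^ 'n) 1) x * norm x powr (- (\<gamma> + 1)))"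
      proof (cases "norm x < 1 \<and> x \<noteq> 0")
        case True
        have "- \<gamma> - 2 + 1 = - (\<gamma> + 1)" by simp
        then have 1: "norm x powr (- \<gamma> - 2) * norm x = norm x powr (- (\<gamma> + 1))"
          using True powr_add[of "norm x" "- \<gamma> - 2" 1] by (simp only: powr_one norm_ge_zero)
        have "\<bar>P x\<bar> \<le> norm x powr (- \<gamma> - 2) * norm x * 1"
          unfolding P_def abs_mult using bump_range[of a 1 x] Basis_le_norm[OF assms(2), of x]
          by (intro mult_mono) auto
        then show ?thesis using True 1 by simp
      next
        case False
        then have "P x = 0" using bump_eq_0[OF a(1), of 1 x] by (auto simp: P_def)
        then show ?thesis by simp
      qed
    qed
  qed
  assume "(\<integral>x. (grad x \<bullet> b) * bump ((1 / 2) *\<^sub>R b) 1 x \<partial>lborel) = 0"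
  then have "(\<integral>x. - \<gamma> * P x \<partial>lborel) = 0" unfolding a_def[symmetric] eq .
  then have "integral\<^sup>L lborel P = 0" using assms(1) by simp
  then have "AE x in lborel. P x = 0" using integral_nonneg_eq_0_iff_AE[OF i] P0 by simp
  then have "AE x in lborel. x \<notin> ball a (1 / 4)"
    by (rule eventually_mono) (use Ppos in force)
  then have "ball a (1 / 4) \<in> null_sets lborel" by (subst (asm) AE_iff_null_sets[symmetric]) auto
  then have "emeasure lborel (ball a (1 / 4)) = 0" by auto
  then show False
    using content_ball_pos[of "1 / 4" a] by (simp add: measure_def)
qed

text \<open>Test with \<open>bump a l\<close> as \<open>l \<rightarrow> 0\<close>: by homogeneity the integral against \<open>grad\<close> is a nonzero multiple
  of \<open>l powr (n - (\<gamma> + 1))\<close>, while a weak gradient in \<open>L\<^sup>q\<close> would make it of smaller order.\<close>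

lemma weak_gradient_not_Lp:
  assumes \<gamma>0: "\<gamma> \<noteq> 0" and H: "is_weak_gradient (ball 0 1) u H" and q: "n / (\<gamma> + 1) \<le> q"
  shows "(\<lambda>x. norm (H x)) \<notin> Lp q (ball 0 (1 / 2))"
proof
  assume HL: "(\<lambda>x. norm (H x)) \<in> Lp q (ball 0 (1 / 2))"
  obtain b :: "real ^ 'n" where b: "b \<in> Basis" using nonempty_Basis by blast
  define a where "a = (1 / 2) *\<^sub>R b"
  have a: "norm a = 1 / 2" using b by (simp add: a_def)
  \<comment> \<open>The critical exponent; \<open>q1\<close> below is its conjugate. With
    \<open>c\<close> = n - (\<gamma> + 1), the power of \<open>l\<close> gained by scaling, the
    relation c q1 = n makes Young's inequality scale invariant.\<close>
  define q0 where "q0 = n / (\<gamma> + 1)"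
  have q0: "q0 > 1" using gamma_plus_1_less gamma_gt by (simp add: q0_def field_simps)
  define q1 where "q1 = q0 / (q0 - 1)"
  have q1: "q1 > 0" using q0 by (simp add: q1_def)
  define c where "c = n - (\<gamma> + 1)"
  have c_q1: "c * q1 = n"
  proof -
    have "q0 - 1 = c / (\<gamma> + 1)" using gamma_gt by (simp add: q0_def c_def field_simps)
    moreover have "c > 0" using gamma_plus_1_less by (simp add: c_def)
    ultimately show ?thesis using gamma_gt by (simp add: q1_def q0_def)
  qed
  define I where "I = (\<integral>x. (grad x \<bullet> b) * bump a 1 x \<partial>lborel)"
  define m where "m = measure lebesgue (ball (0 :: real ^ 'n) 1)"
  have m0: "m \<ge> 0" by (simp add: m_def)
  define h where "h x = indicator (ball 0 (1 / 2)) x * norm (H x) powr q0" for x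
  have h: "integrable lebesgue h"
  proof -
    have meas: "(\<lambda>x. norm (H x)) \<in> borel_measurable (lebesgue_on (ball 0 (1 / 2)))"
      and int: "integrable (lebesgue_on (ball 0 (1 / 2))) (\<lambda>x. \<bar>norm (H x)\<bar> powr q)"
      using HL by (auto simp: Lp_def)
    have "finite_measure (lebesgue_on (ball (0 :: real ^ 'n) (1 / 2)))"
      by (intro finite_measure_lebesgue_on) (simp add: lmeasurable_ball)
    \<comment> \<open>The half ball has finite measure, so integrability with exponent
      \<open>q\<close> descends to \<open>q0\<close> <= \<open>q\<close>.\<close>
    then have "integrable (lebesgue_on (ball 0 (1 / 2))) (\<lambda>x. 1 + \<bar>norm (H x)\<bar> powr q)"
      using int by (intro Bochner_Integration.integrable_add finite_measure.integrable_const)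
    then have "integrable (lebesgue_on (ball 0 (1 / 2))) (\<lambda>x. norm (H x) powr q0)"
    proof (rule Bochner_Integration.integrable_bound)
      show "(\<lambda>x. norm (H x) powr q0) \<in> borel_measurable (lebesgue_on (ball 0 (1 / 2)))"
        using meas by measurable
      show "AE x in lebesgue_on (ball 0 (1 / 2)). norm (norm (H x) powr q0) \<le> norm (1 + \<bar>norm (H x)\<bar> powr q)"
        using powr_le_one_plus_powr[of _ q0 q] q q0 by (intro AE_I2) (simp add: q0_def)
    qed
    then show ?thesis
      using integrable_restrict_space[of "ball (0 :: real ^ 'n) (1 / 2)" lebesgue "\<lambda>x. norm (H x) powr q0"]
      by (simp add: h_def[abs_def])
  qed
  define T where "T l = (\<integral>x. indicator (ball 0 l) x * h x \<partial>lebesgue)" for l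
  \<comment> \<open>Two weak gradients have equal integrals against every test function, so
    \<open>H\<close> may be replaced by \<open>grad\<close>, whose integral scales exactly to l^c I.
    Young's inequality with the free parameter \<delta> bounds the integral of \<open>H\<close>; the
    common factor l^c cancels.\<close>
  have main: "\<bar>I\<bar> \<le> \<delta> powr (- q0) * T l + \<delta> powr q1 * m" if l: "0 < l" "l \<le> 1 / 2" and \<delta>: "\<delta> > 0" for l \<delta>
  proof -
    have tf: "bump a l \<in> test_functions (ball 0 1)" using l a by (intro bump_test_function) auto
    have out: "bump a l x = 0" if "x \<notin> ball 0 l" for x
      using that l a by (intro bump_eq_0) auto
    have "(\<integral>x. (H x \<bullet> b) * bump a l x \<partial>lebesgue_on (ball 0 1)) = (\<integral>x. (grad x \<bullet> b) * bump a l x \<partial>lebesgue_on (ball 0 1))"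
      using H is_weak_gradient_grad tf b unfolding is_weak_gradient_def by fastforce
    also have "\<dots> = (\<integral>x. indicator (ball 0 1) x * ((grad x \<bullet> b) * bump a l x) \<partial>lborel)"
      by (rule integral_lebesgue_on_eq) auto
    also have "\<dots> = (\<integral>x. (grad x \<bullet> b) * bump a l x \<partial>lborel)"
      using out l by (intro Bochner_Integration.integral_cong) (auto simp: indicator_def)
    also have "\<dots> = l ^ CARD('n) * (\<integral>x. (grad (l *\<^sub>R x) \<bullet> b) * bump a l (l *\<^sub>R x) \<partial>lborel)"
      using lborel_integral_scale[of "\<lambda>x. (grad x \<bullet> b) * bump a l x" l] l by simp
    also have "\<dots> = l ^ CARD('n) * (\<integral>x. l powr (- (\<gamma> + 1)) * ((grad x \<bullet> b) * bump a 1 x) \<partial>lborel)"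
      using l by (simp add: grad_scale bump_def mult.assoc)
    also have "\<dots> = (l powr n * l powr (- (\<gamma> + 1))) * I"
      using l by (simp add: I_def n_eq powr_realpow)
    also have "l powr n * l powr (- (\<gamma> + 1)) = l powr c"
      unfolding powr_add[symmetric] c_def by (rule arg_cong) simp
    finally have 1: "(\<integral>x. (H x \<bullet> b) * bump a l x \<partial>lebesgue_on (ball 0 1)) = l powr c * I" .
    define W where "W x = l powr c * (\<delta> powr (- q0) * (indicator (ball 0 l) x * h x) + \<delta> powr q1 * l powr (- n) * indicator (ball 0 l) x)" for x
    have i1: "integrable lebesgue (\<lambda>x. indicator (ball 0 l) x * h x)"
      using integrable_mult_indicator[OF _ h, of "ball 0 l"] by simp
    have i2: "integrable lebesgue (\<lambda>x :: real ^ 'n. indicator (ball 0 l) x :: real)"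
      by (intro integrable_real_indicator) (auto simp: emeasure_lborel_ball_finite[unfolded infinity_ennreal_def])
    have W: "integrable lebesgue W" unfolding W_def using i1 i2 by auto
    have Wint: "integral\<^sup>L lebesgue W = l powr c * (\<delta> powr (- q0) * T l + \<delta> powr q1 * m)"
    proof -
      have "integral\<^sup>L lebesgue W = l powr c * (\<delta> powr (- q0) * T l + \<delta> powr q1 * l powr (- n) * measure lebesgue (ball (0 :: real ^ 'n) l))"
        unfolding W_def T_def using i1 i2 by simp
      also have "measure lebesgue (ball (0 :: real ^ 'n) l) = l powr n * m"
        using content_ball_conv_unit_ball[of l "0 :: real ^ 'n"] l by (simp add: m_def n_eq powr_realpow)
      also have "\<delta> powr q1 * l powr (- n) * (l powr n * m) = \<delta> powr q1 * m"
        using l by (simp add: powr_minus)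
      finally show ?thesis .
    qed
    have bound: "\<bar>indicator (ball 0 1) x * ((H x \<bullet> b) * bump a l x)\<bar> \<le> W x" for x
    proof (cases "x \<in> ball 0 l")
      case True
      have "\<bar>H x \<bullet> b\<bar> \<le> norm (H x)" using Basis_le_norm[OF b] .
      then have "\<bar>indicator (ball 0 1) x * ((H x \<bullet> b) * bump a l x)\<bar> \<le> norm (H x) * bump a l x"
        using bump_range[of a l x] by (auto simp: abs_mult indicator_def intro!: mult_right_mono)
      also have "\<dots> = l powr c * ((norm (H x) / \<delta>) * (\<delta> * l powr (- c) * bump a l x))"
      proof -
        have "l powr c * l powr (- c) = 1" using l by (simp add: powr_add[symmetric])
        moreover have "l powr c * ((norm (H x) / \<delta>) * (\<delta> * l powr (- c) * bump a l x))
            = (l powr c * l powr (- c)) * (norm (H x) / \<delta> * \<delta>) * bump a l x" by (simp only: mult_ac)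
        ultimately show ?thesis using \<delta> by simp
      qed
      also have "\<dots> \<le> l powr c * ((norm (H x) / \<delta>) powr q0 + (\<delta> * l powr (- c) * bump a l x) powr q1)"
        unfolding q1_def using q0 \<delta> bump_range[of a l x] by (intro mult_left_mono mult_le_powr_conjugate) auto
      also have "(norm (H x) / \<delta>) powr q0 = \<delta> powr (- q0) * (indicator (ball 0 l) x * h x)"
      proof -
        have "indicator (ball 0 l) x * h x = norm (H x) powr q0" using True l by (simp add: h_def)
        then show ?thesis using \<delta> by (simp add: powr_divide powr_minus_divide)
      qed
      also have "(\<delta> * l powr (- c) * bump a l x) powr q1 = \<delta> powr q1 * l powr (- (c * q1)) * bump a l x powr q1"
        using l \<delta> bump_range[of a l x] by (simp add: powr_mult powr_powr)
      finally have "\<bar>indicator (ball 0 1) x * ((H x \<bullet> b) * bump a l x)\<bar>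
        \<le> l powr c * (\<delta> powr (- q0) * (indicator (ball 0 l) x * h x) + \<delta> powr q1 * l powr (- (c * q1)) * bump a l x powr q1)" .
      moreover have "\<delta> powr q1 * l powr (- (c * q1)) * bump a l x powr q1 \<le> \<delta> powr q1 * l powr (- n) * indicator (ball 0 l) x"
        unfolding c_q1 using True bump_range[of a l x] q1 by (intro mult_left_mono) (auto simp: powr_le1)
      then have "l powr c * (\<delta> powr (- q0) * (indicator (ball 0 l) x * h x) + \<delta> powr q1 * l powr (- (c * q1)) * bump a l x powr q1) \<le> W x"
        unfolding W_def by (intro mult_left_mono add_left_mono) auto
      ultimately show ?thesis by (rule order_trans)
    next
      case False
      then show ?thesis using out by (simp add: W_def)
    qed
    have 2: "(\<integral>x. (H x \<bullet> b) * bump a l x \<partial>lebesgue_on (ball 0 1)) = (\<integral>x. indicator (ball 0 1) x * ((H x \<bullet> b) * bump a l x) \<partial>lebesgue)"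
      using integral_restrict_space[of "ball (0 :: real ^ 'n) 1" lebesgue "\<lambda>x. (H x \<bullet> b) * bump a l x"] by simp
    have "l powr c * \<bar>I\<bar> = \<bar>\<integral>x. indicator (ball 0 1) x * ((H x \<bullet> b) * bump a l x) \<partial>lebesgue\<bar>"
    proof -
      have "l powr c * \<bar>I\<bar> = \<bar>l powr c * I\<bar>" by (simp add: abs_mult)
      then show ?thesis using 1 2 by simp
    qed
    also have "\<dots> \<le> (\<integral>x. \<bar>indicator (ball 0 1) x * ((H x \<bullet> b) * bump a l x)\<bar> \<partial>lebesgue)"
      by (rule integral_abs_bound)
    also have "\<dots> \<le> integral\<^sup>L lebesgue W"
      using bound order_trans[OF abs_ge_zero bound] by (intro integral_mono'[OF W]) auto
    finally have "l powr c * \<bar>I\<bar> \<le> l powr c * (\<delta> powr (- q0) * T l + \<delta> powr q1 * m)" unfolding Wint .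
    then show ?thesis using l by simp
  qed
  define l where "l k = inverse (real (Suc k)) / 2" for k
  have l: "0 < l k" "l k \<le> 1 / 2" for k by (auto simp: l_def inverse_le_1_iff)
  have l_lim: "l \<longlonglongrightarrow> 0"
    unfolding l_def using tendsto_divide_zero[OF LIMSEQ_inverse_real_of_nat, of 2] by simp
  have "(\<lambda>k. T (l k)) \<longlonglongrightarrow> (\<integral>x. 0 \<partial>(lebesgue :: (real ^ 'n) measure))"
    unfolding T_def
  proof (rule integral_dominated_convergence[where w = "\<lambda>x. \<bar>h x\<bar>"])
    show "integrable lebesgue (\<lambda>x. \<bar>h x\<bar>)" using h by simp
    show "(\<lambda>x. indicator (ball 0 (l k)) x * h x) \<in> borel_measurable lebesgue" for k
      using borel_measurable_integrable[OF h] by (intro borel_measurable_times borel_measurable_indicator) auto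
    show "AE x in lebesgue. norm (indicator (ball 0 (l k)) x * h x) \<le> \<bar>h x\<bar>" for k
      by (intro AE_I2) (auto simp: indicator_def)
    have "AE x in lebesgue. x \<noteq> (0 :: real ^ 'n)"
      using AE_lborel_singleton[of "0 :: real ^ 'n"] by (rule AE_completion)
    then show "AE x in lebesgue. (\<lambda>k. indicator (ball 0 (l k)) x * h x) \<longlonglongrightarrow> 0"
    proof (rule eventually_mono)
      fix x :: "real ^ 'n" assume "x \<noteq> 0"
      then have "eventually (\<lambda>k. l k < norm x) sequentially"
        using order_tendstoD(2)[OF l_lim, of "norm x"] by simp
      then show "(\<lambda>k. indicator (ball 0 (l k)) x * h x) \<longlonglongrightarrow> 0"
        by (intro tendsto_eventually) (auto elim!: eventually_mono)
    qed
  qed simp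
  then have T_lim: "(\<lambda>k. T (l k)) \<longlonglongrightarrow> 0" by simp
  \<comment> \<open>The order of the limits matters: l -> 0 with \<delta> fixed removes the term
    with \<open>T\<close>, and only then \<delta> is taken small.\<close>
  have I_le: "\<bar>I\<bar> \<le> \<delta> powr q1 * m" if "\<delta> > 0" for \<delta>
  proof (rule LIMSEQ_le_const)
    have "(\<lambda>k. \<delta> powr (- q0) * T (l k) + \<delta> powr q1 * m) \<longlonglongrightarrow> \<delta> powr (- q0) * 0 + \<delta> powr q1 * m"
      by (intro tendsto_intros T_lim)
    then show "(\<lambda>k. \<delta> powr (- q0) * T (l k) + \<delta> powr q1 * m) \<longlonglongrightarrow> \<delta> powr q1 * m" by simp
    show "\<exists>N. \<forall>k\<ge>N. \<bar>I\<bar> \<le> \<delta> powr (- q0) * T (l k) + \<delta> powr q1 * m"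
      using main[OF l that] by blast
  qed
  have I: "\<bar>I\<bar> > 0" using integral_grad_bump_neq_0[OF \<gamma>0 b] by (simp add: I_def a_def)
  \<comment> \<open>The value given to \<delta>^q1, chosen so that t (m + 1) = |I| / 2.\<close>
  define t where "t = \<bar>I\<bar> / (2 * m + 2)"
  have t: "t > 0" using I m0 by (simp add: t_def)
  have "\<bar>I\<bar> \<le> (t powr (1 / q1)) powr q1 * m" using t by (intro I_le) simp
  also have "\<dots> = t * m" using q1 t by (simp add: powr_powr)
  also have "\<dots> \<le> t * (m + 1)" using t by simp
  also have "\<dots> = \<bar>I\<bar> / 2"
  proof -
    have "2 * m + 2 \<noteq> 0" using m0 by linarith
    then show ?thesis by (simp add: t_def field_simps)
  qed
  finally show False using I by simp
qed

end

section \<open>A weak Hardy inequality\<close>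

lemma emeasure_annulus:
  fixes r :: real
  assumes "r \<ge> 0"
  shows "emeasure lborel {y :: 'a::euclidean_space. r < norm y \<and> norm y < 2 * r}
    = ennreal (r ^ DIM('a) * ((2 ^ DIM('a) - 1) * measure lebesgue (ball (0 :: 'a) 1)))"
proof -
  have eq: "{y :: 'a. r < norm y \<and> norm y < 2 * r} = ball 0 (2 * r) - cball 0 r" by auto
  have fin: "emeasure lborel (ball (0 :: 'a) (2 * r)) \<noteq> \<infinity>"
    using emeasure_lborel_ball_finite[of "0 :: 'a" "2 * r"] by simp
  have sub: "measure lborel (ball (0 :: 'a) (2 * r) - cball 0 r)
      = measure lborel (ball (0 :: 'a) (2 * r)) - measure lborel (cball (0 :: 'a) r)"
  proof (cases "r = 0")
    case False
    then show ?thesis using assms by (intro measure_Diff[OF fin]) auto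
  qed simp
  have "emeasure lborel {y :: 'a. r < norm y \<and> norm y < 2 * r} = ennreal (measure lborel (ball (0 :: 'a) (2 * r) - cball 0 r))"
    unfolding eq using fin
  proof (intro emeasure_eq_ennreal_measure)
    have "emeasure lborel (ball (0 :: 'a) (2 * r) - cball 0 r) \<le> emeasure lborel (ball (0 :: 'a) (2 * r))"
      by (intro emeasure_mono) auto
    then show "emeasure lborel (ball (0 :: 'a) (2 * r) - cball 0 r) \<noteq> top"
      using fin by (auto simp: top_unique)
  qed
  also have "measure lborel (ball (0 :: 'a) (2 * r) - cball 0 r) = (2 * r) ^ DIM('a) * measure lebesgue (ball (0 :: 'a) 1) - r ^ DIM('a) * measure lebesgue (ball (0 :: 'a) 1)"
    using sub content_ball_conv_unit_ball[of "2 * r" "0 :: 'a"] content_ball_conv_unit_ball[of r "0 :: 'a"] assms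
    by (simp add: content_cball_conv_ball)
  also have "\<dots> = r ^ DIM('a) * ((2 ^ DIM('a) - 1) * measure lebesgue (ball (0 :: 'a) 1))"
    by (simp add: power_mult_distrib algebra_simps)
  finally show ?thesis .
qed

text \<open>The term with \<open>b\<close> may be subtracted only because \<open>I\<close> is
  finite; this is what the truncation in the Hardy argument provides.\<close>

lemma ennreal_absorb:
  fixes a b :: real and I E :: ennreal
  assumes "0 \<le> b" "b < a" "I < \<infinity>" "E < \<infinity>" "ennreal a * I \<le> E + ennreal b * I"
  shows "I \<le> ennreal (enn2real E / (a - b))"
proof -
  obtain x where x: "x \<ge> 0" "I = ennreal x" using assms(3) by (cases I) auto
  obtain y where y: "y \<ge> 0" "E = ennreal y" using assms(4) by (cases E) auto
  have "ennreal (a * x) \<le> ennreal (y + b * x)"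
    using assms x y by (simp add: ennreal_mult' ennreal_plus)
  then have "a * x \<le> y + b * x" using assms x y by (subst (asm) ennreal_le_iff) auto
  then have "x \<le> y / (a - b)" using assms by (simp add: field_simps)
  then show ?thesis using x y by (simp add: ennreal_leI)
qed

text \<open>The function \<phi> is a Borel representative of a test function; a Lebesgue measurable
  one is reduced to this case by changing it on a null set.\<close>

locale test_pairing = power_solution n s p \<gamma> e for n s p \<gamma> and e :: "real ^ 'n" +
  fixes \<phi> :: "real ^ 'n \<Rightarrow> real"
  assumes phi_measurable [measurable]: "\<phi> \<in> borel_measurable borel"
    and phi_outside: "\<And>x. norm x \<ge> 1 \<Longrightarrow> \<phi> x = 0"
    and phi_Lp: "integrable lborel (\<lambda>x. \<bar>\<phi> x\<bar> powr p)"
    and phi_gagliardo: "integrable lborel (\<lambda>z. \<bar>\<phi> (fst z) - \<phi> (snd z)\<bar> powr p / norm (fst z - snd z) powr (n + s * p))"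
begin

lemma integrable_phi: "integrable lborel \<phi>"
proof -
  have "integrable lborel (\<lambda>x. indicator (ball (0 :: real ^ 'n) 1) x * norm x powr (- 0) + \<bar>\<phi> x\<bar> powr p)"
    using n_pos by (intro Bochner_Integration.integrable_add integrable_power_ball phi_Lp) (simp add: n_eq)
  then show ?thesis
  proof (rule Bochner_Integration.integrable_bound)
    show "AE x in lborel. norm (\<phi> x) \<le> norm (indicator (ball (0 :: real ^ 'n) 1) x * norm x powr (- 0) + \<bar>\<phi> x\<bar> powr p)"
    proof (rule eventually_mono[OF AE_lborel_singleton[of "0 :: real ^ 'n"]])
      fix x :: "real ^ 'n" assume x: "x \<noteq> 0"
      have "\<bar>\<phi> x\<bar> powr 1 \<le> 1 + \<bar>\<phi> x\<bar> powr p" using p_gt by (intro powr_le_one_plus_powr) auto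
      then show "norm (\<phi> x) \<le> norm (indicator (ball (0 :: real ^ 'n) 1) x * norm x powr (- 0) + \<bar>\<phi> x\<bar> powr p)"
        using x phi_outside[of x] by (cases "norm x < 1") auto
    qed
  qed simp
qed

text \<open>Compare \<open>\<phi> x\<close> with the average of \<open>\<phi>\<close> over the annulus \<open>M |x| < |y| < 2 M |x|\<close>. Since
  \<open>\<alpha> < n\<close>, the averages are absorbed when \<open>M\<close> is large; truncating at \<open>|x| > \<delta>\<close> keeps
  the absorbed quantity finite.\<close>

lemma integrable_phi_alpha: "integrable lborel (\<lambda>x. \<phi> x / norm x powr \<alpha>)"
proof -
  \<comment> \<open>With this choice M^(n - \<alpha>) = 2^(\<alpha> + 1) > 2^\<alpha>, so the
    coefficient (2 M)^\<alpha> to be absorbed is smaller than M^n.\<close>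
  define M where "M = 2 powr ((\<alpha> + 1) / (n - \<alpha>))"
  have M1: "M \<ge> 1" using alpha_pos alpha_less by (simp add: M_def ge_one_powr_ge_zero)
  have M0: "M > 0" using M1 by simp
  have M: "(2 * M) powr \<alpha> < M powr n"
  proof -
    have "2 powr \<alpha> < 2 powr (\<alpha> + 1)" by (intro powr_less_mono) auto
    also have "\<dots> = M powr (n - \<alpha>)" using alpha_less by (simp add: M_def powr_powr)
    finally have "2 powr \<alpha> * M powr \<alpha> < M powr (n - \<alpha>) * M powr \<alpha>"
      using M0 by (intro mult_strict_right_mono) auto
    then show ?thesis using M0 by (simp add: powr_mult powr_add[symmetric])
  qed
  define V where "V = (2 ^ DIM(real ^ 'n) - 1) * measure lebesgue (ball (0 :: real ^ 'n) 1)"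
  have V: "V > 0"
  proof -
    have "(1::real) < 2 ^ DIM(real ^ 'n)" by (intro one_less_power) auto
    then show ?thesis unfolding V_def using content_ball_pos[of 1 "0 :: real ^ 'n"] by simp
  qed
  have annulus: "emeasure lborel {y :: real ^ 'n. r < norm y \<and> norm y < 2 * r} = ennreal (r powr n * V)" if "r > 0" for r
    using emeasure_annulus[of r, where 'a = "real ^ 'n"] that by (simp add: V_def n_eq powr_realpow)
  define A where "A x y = (indicator {y. M * norm x < norm y \<and> norm y < 2 * (M * norm x)} y :: real)" for x y :: "real ^ 'n"
  have A_meas [measurable]: "(\<lambda>y. A x y) \<in> borel_measurable borel" "(\<lambda>x. A x y) \<in> borel_measurable borel"
     "(\<lambda>z. A (fst z) (snd z)) \<in> borel_measurable (borel \<Otimes>\<^sub>M borel)" for x y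
    unfolding A_def indicator_def mem_Collect_eq by measurable
  have A01: "0 \<le> A x y" "A x y \<le> 1" for x y by (auto simp: A_def)
  have A_ne: "M * norm x < norm y \<and> norm y < 2 * (M * norm x) \<and> A x y = 1" if "A x y \<noteq> 0" for x y
    using that by (auto simp: A_def indicator_def split: if_splits)
  have A_y: "(\<integral>\<^sup>+y. ennreal (A x y) \<partial>lborel) = ennreal ((M * norm x) powr n * V)" if "x \<noteq> 0" for x
    using annulus[of "M * norm x"] M0 that by (simp add: A_def ennreal_indicator nn_integral_indicator)
  \<comment> \<open>Seen from y the relation is again an annulus: |y| / (2 M) < |x| < |y| /
    M.\<close>
  have A_x: "(\<integral>\<^sup>+x. ennreal (A x y) \<partial>lborel) = ennreal ((norm y / (2 * M)) powr n * V)" if "y \<noteq> 0" for y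
  proof -
    have "A x y = indicator {x. norm y / (2 * M) < norm x \<and> norm x < 2 * (norm y / (2 * M))} x" for x
      using M0 by (auto simp: A_def indicator_def field_simps)
    then show ?thesis
      using annulus[of "norm y / (2 * M)"] M0 that by (simp add: ennreal_indicator nn_integral_indicator)
  qed
  define E where "E = (\<integral>\<^sup>+x. \<integral>\<^sup>+y. ennreal (A x y * (\<bar>\<phi> x - \<phi> y\<bar> * norm x powr (- (\<alpha> + n)))) \<partial>lborel \<partial>lborel)"
  have E: "E < \<infinity>"
  proof -
    define q where "q = p / (p - 1)"
    have q: "q > 0" using p_gt by (simp add: q_def)
    \<comment> \<open>Chosen so that the p-th power of |\<phi> x - \<phi> y| |x - y|^(-b) is the
      Gagliardo quotient \<open>P\<close>. On the annulus |x - y| <= (1 + 2 M) |x|, so the conjugate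
      power of the remaining factor is at most C |x|^(-\<kappa>).\<close>
    define b where "b = (n + s * p) / p"
    have b: "b > 0" using n_pos s_pos p_gt by (simp add: b_def add_pos_pos)
    define \<kappa> where "\<kappa> = (\<alpha> + n - b) * q"
    define C where "C = ((1 + 2 * M) powr b) powr q"
    define P where "P z = \<bar>\<phi> (fst z) - \<phi> (snd z)\<bar> powr p / norm (fst z - snd z) powr (n + s * p)" for z
    define Q where "Q x = indicator (ball (0 :: real ^ 'n) 1) x * (C * norm x powr (- \<kappa>))" for x
    have P_meas [measurable]: "P \<in> borel_measurable borel" unfolding P_def borel_prod[symmetric] by measurable
    have P_meas' [measurable]: "(\<lambda>y. P (x, y)) \<in> borel_measurable borel" for x unfolding P_def by measurable
    have Q_meas [measurable]: "Q \<in> borel_measurable borel" unfolding Q_def by measurable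
    have P0: "P z \<ge> 0" for z by (simp add: P_def)
    have Q0: "Q x \<ge> 0" for x by (simp add: Q_def C_def)
    have bound: "A x y * (\<bar>\<phi> x - \<phi> y\<bar> * norm x powr (- (\<alpha> + n))) \<le> P (x, y) + Q x * A x y" for x y
    proof (cases "A x y = 0 \<or> norm x \<ge> 1")
      \<comment> \<open>If |x| >= 1, then |y| > M |x| >= 1 as well, and \<phi> vanishes at both
        points.\<close>
      case True
      have "A x y * \<bar>\<phi> x - \<phi> y\<bar> = 0"
      proof (cases "A x y = 0")
        case False
        then have x: "norm x \<ge> 1" "M * norm x < norm y" using True A_ne[of x y] by auto
        have "norm x \<le> M * norm x" using M1 mult_right_mono[of 1 M "norm x"] by simp
        then have "norm y \<ge> 1" using x by linarith
        then show ?thesis using x phi_outside by simp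
      qed simp
      then have "A x y * (\<bar>\<phi> x - \<phi> y\<bar> * norm x powr (- (\<alpha> + n))) = 0" by force
      moreover have "0 \<le> P (x, y) + Q x * A x y" using P0 Q0 A01 by (intro add_nonneg_nonneg mult_nonneg_nonneg)
      ultimately show ?thesis by linarith
    next
      case False
      then have x: "norm x < 1" and y: "M * norm x < norm y" "norm y < 2 * (M * norm x)" and A: "A x y = 1"
        using A_ne[of x y] by auto
      have x0: "x \<noteq> 0" using y M0 by auto
      have "norm x \<le> M * norm x" using M1 mult_right_mono[of 1 M "norm x"] by simp
      then have xy: "x \<noteq> y" using y by auto
      let ?d = "norm (x - y)"
      have d: "?d > 0" using xy by simp
      have "\<bar>\<phi> x - \<phi> y\<bar> * norm x powr (- (\<alpha> + n)) = (\<bar>\<phi> x - \<phi> y\<bar> * ?d powr (- b)) * (?d powr b * norm x powr (- (\<alpha> + n)))"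
        using d by (simp add: powr_minus)
      also have "\<dots> \<le> (\<bar>\<phi> x - \<phi> y\<bar> * ?d powr (- b)) powr p + (?d powr b * norm x powr (- (\<alpha> + n))) powr q"
        unfolding q_def using p_gt by (intro mult_le_powr_conjugate) auto
      also have "(\<bar>\<phi> x - \<phi> y\<bar> * ?d powr (- b)) powr p = P (x, y)"
      proof -
        have "- b * p = - (n + s * p)" using p_gt by (simp add: b_def)
        then have "(?d powr (- b)) powr p = ?d powr (- (n + s * p))" by (simp only: powr_powr)
        then have "(\<bar>\<phi> x - \<phi> y\<bar> * ?d powr (- b)) powr p = \<bar>\<phi> x - \<phi> y\<bar> powr p * ?d powr (- (n + s * p))"
          by (simp only: powr_mult)
        then show ?thesis by (simp only: P_def powr_minus_divide fst_conv snd_conv) simp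
      qed
      also have "(?d powr b * norm x powr (- (\<alpha> + n))) powr q \<le> Q x"
      proof -
        have "?d \<le> (1 + 2 * M) * norm x"
          using norm_triangle_ineq4[of x y] y by (simp add: algebra_simps)
        then have "?d powr b \<le> ((1 + 2 * M) * norm x) powr b" using b by (intro powr_mono2) auto
        also have "\<dots> = (1 + 2 * M) powr b * norm x powr b" using M0 by (simp add: powr_mult)
        finally have "?d powr b * norm x powr (- (\<alpha> + n)) \<le> (1 + 2 * M) powr b * norm x powr b * norm x powr (- (\<alpha> + n))"
          by (intro mult_right_mono) auto
        also have "\<dots> = (1 + 2 * M) powr b * norm x powr (- (\<alpha> + n - b))"
          unfolding mult.assoc powr_add[symmetric] by (rule arg_cong) simp
        finally have "(?d powr b * norm x powr (- (\<alpha> + n))) powr q \<le> ((1 + 2 * M) powr b * norm x powr (- (\<alpha> + n - b))) powr q"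
          using q by (intro powr_mono2) auto
        also have "\<dots> = C * norm x powr (- \<kappa>)"
          unfolding C_def \<kappa>_def by (simp only: powr_mult powr_powr minus_mult_left)
        finally show ?thesis using x by (simp add: Q_def)
      qed
      finally show ?thesis using A by simp
    qed
    have PE: "(\<integral>\<^sup>+x. \<integral>\<^sup>+y. ennreal (P (x, y)) \<partial>lborel \<partial>lborel) < \<infinity>"
    proof -
      have "(\<integral>\<^sup>+z. ennreal \<bar>P z\<bar> \<partial>lborel) < \<infinity>"
        using phi_gagliardo integrable_iff_nn_integral_finite[of P lborel] unfolding P_def[abs_def] by simp
      then show ?thesis using nn_integral_lborel_pair[of "\<lambda>z. ennreal (P z)"] P0 by simp
    qed
    have QE: "(\<integral>\<^sup>+x. \<integral>\<^sup>+y. ennreal (Q x * A x y) \<partial>lborel \<partial>lborel) < \<infinity>"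
    proof -
      \<comment> \<open>The annulus has volume proportional to |x|^n, so integration in y lowers
        \<kappa> by n. The remaining condition \<kappa> < 2 n is \<open>alpha_p\<close>.\<close>
      have "\<kappa> - n < DIM(real ^ 'n)"
      proof -
        have "(\<alpha> + n - b) * p < 2 * n * (p - 1)"
        proof -
          have "b * p = n + s * p" using p_gt by (simp add: b_def)
          moreover have "(\<alpha> + n - b) * p = \<alpha> * p + n * p - b * p" by (simp add: algebra_simps)
          ultimately show ?thesis using alpha_p by (simp add: algebra_simps)
        qed
        then have "\<kappa> < 2 * n" using p_gt by (simp add: \<kappa>_def q_def field_simps)
        then show ?thesis by (simp add: n_eq)
      qed
      note fin = nn_integral_power_ball_0[OF _ this, of 1]
      have "(\<integral>\<^sup>+y. ennreal (Q x * A x y) \<partial>lborel) = ennreal (C * M powr n * V) * ennreal (indicator (ball 0 1) x * norm x powr (- (\<kappa> - n)))" for x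
      proof (cases "x = 0")
        case True then show ?thesis by (simp add: Q_def)
      next
        case False
        have "(\<integral>\<^sup>+y. ennreal (Q x * A x y) \<partial>lborel) = ennreal (Q x) * (\<integral>\<^sup>+y. ennreal (A x y) \<partial>lborel)"
          using Q0 by (simp add: ennreal_mult' nn_integral_cmult)
        also have "\<dots> = ennreal (Q x * ((M * norm x) powr n * V))"
          unfolding A_y[OF False] using Q0 by (simp add: ennreal_mult'[symmetric])
        also have "Q x * ((M * norm x) powr n * V) = (C * M powr n * V) * (indicator (ball 0 1) x * (norm x powr (- \<kappa>) * norm x powr n))"
          using M0 by (simp add: Q_def powr_mult)
        also have "norm x powr (- \<kappa>) * norm x powr n = norm x powr (- (\<kappa> - n))"
          unfolding powr_add[symmetric] by (rule arg_cong) simp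
        finally show ?thesis using V by (simp add: ennreal_mult' C_def)
      qed
      then show ?thesis using fin by (simp add: nn_integral_cmult ennreal_mult_less_top)
    qed
    have "E \<le> (\<integral>\<^sup>+x. \<integral>\<^sup>+y. (ennreal (P (x, y)) + ennreal (Q x * A x y)) \<partial>lborel \<partial>lborel)"
      unfolding E_def using bound P0 Q0 A01
      by (intro nn_integral_mono) (simp add: ennreal_plus[symmetric] ennreal_leI del: ennreal_plus)
    also have "\<dots> = (\<integral>\<^sup>+x. (\<integral>\<^sup>+y. ennreal (P (x, y)) \<partial>lborel) + (\<integral>\<^sup>+y. ennreal (Q x * A x y) \<partial>lborel) \<partial>lborel)"
      by (intro nn_integral_cong nn_integral_add) auto
    also have "\<dots> = (\<integral>\<^sup>+x. \<integral>\<^sup>+y. ennreal (P (x, y)) \<partial>lborel \<partial>lborel) + (\<integral>\<^sup>+x. \<integral>\<^sup>+y. ennreal (Q x * A x y) \<partial>lborel \<partial>lborel)"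
    proof (rule nn_integral_add)
      show "(\<lambda>x. \<integral>\<^sup>+y. ennreal (P (x, y)) \<partial>lborel) \<in> borel_measurable lborel"
        using lborel.borel_measurable_nn_integral_fst[of "\<lambda>z. ennreal (P z)" borel] by (simp add: borel_prod)
      have "(\<lambda>z. ennreal (Q (fst z) * A (fst z) (snd z))) \<in> borel_measurable (borel \<Otimes>\<^sub>M lborel)"
        by simp
      then show "(\<lambda>x. \<integral>\<^sup>+y. ennreal (Q x * A x y) \<partial>lborel) \<in> borel_measurable lborel"
        using lborel.borel_measurable_nn_integral_fst[of "\<lambda>z. ennreal (Q (fst z) * A (fst z) (snd z))" borel] by simp
    qed
    also have "\<dots> < \<infinity>" using PE QE by simp
    finally show ?thesis .
  qed
  define I where "I \<delta> = (\<integral>\<^sup>+x. ennreal (indicator (- cball 0 \<delta>) x * (\<bar>\<phi> x\<bar> * norm x powr (- \<alpha>))) \<partial>lborel)" for \<delta>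
  have I_fin: "I \<delta> < \<infinity>" if \<delta>: "\<delta> > 0" for \<delta>
  proof -
    have "I \<delta> \<le> (\<integral>\<^sup>+x. ennreal (\<delta> powr (- \<alpha>)) * ennreal \<bar>\<phi> x\<bar> \<partial>lborel)"
      unfolding I_def
    proof (intro nn_integral_mono)
      fix x :: "real ^ 'n"
      have "indicator (- cball 0 \<delta>) x * (\<bar>\<phi> x\<bar> * norm x powr (- \<alpha>)) \<le> \<delta> powr (- \<alpha>) * \<bar>\<phi> x\<bar>"
      proof (cases "norm x > \<delta>")
        case True
        then have "norm x powr (- \<alpha>) \<le> \<delta> powr (- \<alpha>)" using \<delta> alpha_pos by (intro powr_mono2') auto
        then have "\<bar>\<phi> x\<bar> * norm x powr (- \<alpha>) \<le> \<bar>\<phi> x\<bar> * \<delta> powr (- \<alpha>)" by (intro mult_left_mono) auto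
        then show ?thesis using True by (simp add: mult.commute)
      qed simp
      then show "ennreal (indicator (- cball 0 \<delta>) x * (\<bar>\<phi> x\<bar> * norm x powr (- \<alpha>))) \<le> ennreal (\<delta> powr (- \<alpha>)) * ennreal \<bar>\<phi> x\<bar>"
        by (simp add: ennreal_mult'[symmetric] ennreal_leI)
    qed
    also have "\<dots> = ennreal (\<delta> powr (- \<alpha>)) * (\<integral>\<^sup>+x. ennreal \<bar>\<phi> x\<bar> \<partial>lborel)"
      by (rule nn_integral_cmult) simp
    also have "\<dots> < \<infinity>"
      using integrable_phi by (simp add: integrable_iff_nn_integral_finite ennreal_mult_less_top)
    finally show ?thesis .
  qed
  \<comment> \<open>Integrate |\<phi> x| <= |\<phi> x - \<phi> y| + |\<phi> y| over the annuli with
    weight |x|^(- (\<alpha> + n)), and in the last term over x first. The annuli point outward, so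
    |x| > \<delta> implies |y| > \<delta> and the same truncated integral returns on the
    right.\<close>
  have absorb: "ennreal (M powr n * V) * I \<delta> \<le> E + ennreal ((2 * M) powr \<alpha> * V) * I \<delta>" if \<delta>: "\<delta> > 0" for \<delta>
  proof -
    let ?i = "\<lambda>x. indicator (- cball 0 \<delta>) x :: real"
    have meas2: "(\<lambda>z. ennreal (?i (fst z) * (A (fst z) (snd z) * (\<bar>\<phi> (snd z)\<bar> * norm (fst z) powr (- (\<alpha> + n)))))) \<in> borel_measurable borel"
      unfolding borel_prod[symmetric] by (measurable; simp)
    have "ennreal (M powr n * V) * I \<delta> = (\<integral>\<^sup>+x. ennreal (M powr n * V) * ennreal (?i x * (\<bar>\<phi> x\<bar> * norm x powr (- \<alpha>))) \<partial>lborel)"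
      unfolding I_def by (rule nn_integral_cmult[symmetric]) (measurable; simp)
    also have "\<dots> = (\<integral>\<^sup>+x. \<integral>\<^sup>+y. ennreal (?i x * (A x y * (\<bar>\<phi> x\<bar> * norm x powr (- (\<alpha> + n))))) \<partial>lborel \<partial>lborel)"
    proof (intro nn_integral_cong)
      fix x :: "real ^ 'n"
      show "ennreal (M powr n * V) * ennreal (?i x * (\<bar>\<phi> x\<bar> * norm x powr (- \<alpha>))) = (\<integral>\<^sup>+y. ennreal (?i x * (A x y * (\<bar>\<phi> x\<bar> * norm x powr (- (\<alpha> + n))))) \<partial>lborel)"
      proof (cases "x = 0")
        case True then show ?thesis using \<delta> by simp
      next
        case False
        let ?c = "?i x * (\<bar>\<phi> x\<bar> * norm x powr (- (\<alpha> + n)))"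
        have "(\<integral>\<^sup>+y. ennreal (?i x * (A x y * (\<bar>\<phi> x\<bar> * norm x powr (- (\<alpha> + n))))) \<partial>lborel) = (\<integral>\<^sup>+y. ennreal ?c * ennreal (A x y) \<partial>lborel)"
        proof (intro nn_integral_cong)
          fix y
          have "?c \<ge> 0" by simp
          then have "ennreal ?c * ennreal (A x y) = ennreal (?c * A x y)" by (simp only: ennreal_mult')
          then show "ennreal (?i x * (A x y * (\<bar>\<phi> x\<bar> * norm x powr (- (\<alpha> + n))))) = ennreal ?c * ennreal (A x y)"
            by (simp only: mult_ac)
        qed
        also have "\<dots> = ennreal ?c * (\<integral>\<^sup>+y. ennreal (A x y) \<partial>lborel)" by (rule nn_integral_cmult) simp
        also have "\<dots> = ennreal (?c * ((M * norm x) powr n * V))"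
          unfolding A_y[OF False] by (simp add: ennreal_mult'[symmetric])
        also have "?c * ((M * norm x) powr n * V) = (M powr n * V) * (?i x * (\<bar>\<phi> x\<bar> * (norm x powr (- (\<alpha> + n)) * norm x powr n)))"
          using M0 by (simp add: powr_mult)
        also have "norm x powr (- (\<alpha> + n)) * norm x powr n = norm x powr (- \<alpha>)"
          unfolding powr_add[symmetric] by (rule arg_cong) simp
        finally show ?thesis using V by (simp add: ennreal_mult')
      qed
    qed
    also have "\<dots> \<le> (\<integral>\<^sup>+x. \<integral>\<^sup>+y. ennreal (A x y * (\<bar>\<phi> x - \<phi> y\<bar> * norm x powr (- (\<alpha> + n))))
        + ennreal (?i x * (A x y * (\<bar>\<phi> y\<bar> * norm x powr (- (\<alpha> + n))))) \<partial>lborel \<partial>lborel)"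
    proof (intro nn_integral_mono)
      fix x y :: "real ^ 'n"
      have "?i x * (A x y * norm x powr (- (\<alpha> + n))) * \<bar>\<phi> x\<bar> \<le> ?i x * (A x y * norm x powr (- (\<alpha> + n))) * (\<bar>\<phi> x - \<phi> y\<bar> + \<bar>\<phi> y\<bar>)"
        using A01 by (intro mult_left_mono) auto
      also have "\<dots> = ?i x * (A x y * norm x powr (- (\<alpha> + n)) * \<bar>\<phi> x - \<phi> y\<bar>) + ?i x * (A x y * norm x powr (- (\<alpha> + n))) * \<bar>\<phi> y\<bar>"
        by (simp add: algebra_simps)
      also have "?i x * (A x y * norm x powr (- (\<alpha> + n)) * \<bar>\<phi> x - \<phi> y\<bar>) \<le> 1 * (A x y * norm x powr (- (\<alpha> + n)) * \<bar>\<phi> x - \<phi> y\<bar>)"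
        using A01 by (intro mult_right_mono) auto
      finally have "?i x * (A x y * (\<bar>\<phi> x\<bar> * norm x powr (- (\<alpha> + n)))) \<le> A x y * (\<bar>\<phi> x - \<phi> y\<bar> * norm x powr (- (\<alpha> + n)))
          + ?i x * (A x y * (\<bar>\<phi> y\<bar> * norm x powr (- (\<alpha> + n))))" by (simp add: mult_ac)
      then show "ennreal (?i x * (A x y * (\<bar>\<phi> x\<bar> * norm x powr (- (\<alpha> + n))))) \<le> ennreal (A x y * (\<bar>\<phi> x - \<phi> y\<bar> * norm x powr (- (\<alpha> + n))))
          + ennreal (?i x * (A x y * (\<bar>\<phi> y\<bar> * norm x powr (- (\<alpha> + n)))))"
        using A01 by (simp add: ennreal_plus[symmetric] ennreal_leI del: ennreal_plus)
    qed
    also have "\<dots> = (\<integral>\<^sup>+x. (\<integral>\<^sup>+y. ennreal (A x y * (\<bar>\<phi> x - \<phi> y\<bar> * norm x powr (- (\<alpha> + n)))) \<partial>lborel)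
        + (\<integral>\<^sup>+y. ennreal (?i x * (A x y * (\<bar>\<phi> y\<bar> * norm x powr (- (\<alpha> + n))))) \<partial>lborel) \<partial>lborel)"
      by (intro nn_integral_cong nn_integral_add) auto
    also have "\<dots> = E + (\<integral>\<^sup>+x. \<integral>\<^sup>+y. ennreal (?i x * (A x y * (\<bar>\<phi> y\<bar> * norm x powr (- (\<alpha> + n))))) \<partial>lborel \<partial>lborel)"
      unfolding E_def
    proof (rule nn_integral_add)
      have "(\<lambda>z. ennreal (A (fst z) (snd z) * (\<bar>\<phi> (fst z) - \<phi> (snd z)\<bar> * norm (fst z) powr (- (\<alpha> + n))))) \<in> borel_measurable (borel \<Otimes>\<^sub>M lborel)"
        by simp
      then show "(\<lambda>x. \<integral>\<^sup>+y. ennreal (A x y * (\<bar>\<phi> x - \<phi> y\<bar> * norm x powr (- (\<alpha> + n)))) \<partial>lborel) \<in> borel_measurable lborel"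
        using lborel.borel_measurable_nn_integral_fst[of "\<lambda>z. ennreal (A (fst z) (snd z) * (\<bar>\<phi> (fst z) - \<phi> (snd z)\<bar> * norm (fst z) powr (- (\<alpha> + n))))" borel] by simp
      show "(\<lambda>x. \<integral>\<^sup>+y. ennreal (?i x * (A x y * (\<bar>\<phi> y\<bar> * norm x powr (- (\<alpha> + n))))) \<partial>lborel) \<in> borel_measurable lborel"
        using lborel.borel_measurable_nn_integral_fst[of "\<lambda>z. ennreal (?i (fst z) * (A (fst z) (snd z) * (\<bar>\<phi> (snd z)\<bar> * norm (fst z) powr (- (\<alpha> + n)))))" borel]
          meas2 by (simp add: borel_prod)
    qed
    also have "(\<integral>\<^sup>+x. \<integral>\<^sup>+y. ennreal (?i x * (A x y * (\<bar>\<phi> y\<bar> * norm x powr (- (\<alpha> + n))))) \<partial>lborel \<partial>lborel)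
        = (\<integral>\<^sup>+y. \<integral>\<^sup>+x. ennreal (?i x * (A x y * (\<bar>\<phi> y\<bar> * norm x powr (- (\<alpha> + n))))) \<partial>lborel \<partial>lborel)"
      using nn_integral_lborel_pair[OF meas2] nn_integral_lborel_pair_swap[OF meas2] by simp
    also have "\<dots> \<le> (\<integral>\<^sup>+y. ennreal ((2 * M) powr \<alpha> * V) * ennreal (?i y * (\<bar>\<phi> y\<bar> * norm y powr (- \<alpha>))) \<partial>lborel)"
    proof (intro nn_integral_mono)
      fix y :: "real ^ 'n"
      have pt: "?i x * (A x y * (\<bar>\<phi> y\<bar> * norm x powr (- (\<alpha> + n)))) \<le> (?i y * (\<bar>\<phi> y\<bar> * (norm y / (2 * M)) powr (- (\<alpha> + n)))) * A x y" for x
      proof (cases "norm x > \<delta> \<and> A x y \<noteq> 0")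
        case True
        then have xy: "M * norm x < norm y" "norm y < 2 * (M * norm x)" "A x y = 1" using A_ne[of x y] by auto
        have "norm x \<le> M * norm x" using M1 mult_right_mono[of 1 M "norm x"] by simp
        then have y: "norm y > \<delta>" using True xy by linarith
        have "norm y / (2 * M) \<le> norm x" using xy M0 by (simp add: field_simps)
        then have "norm x powr (- (\<alpha> + n)) \<le> (norm y / (2 * M)) powr (- (\<alpha> + n))"
        proof (intro powr_mono2')
          have "0 < norm y" using y \<delta> by linarith
          then show "0 < norm y / (2 * M)" using M0 by simp
        qed (use alpha_pos n_pos in auto)
        then show ?thesis using True xy y by (simp add: mult_left_mono)
      next
        case False
        then show ?thesis using A01[of x y] by (auto simp: indicator_def)
      qed
      show "(\<integral>\<^sup>+x. ennreal (?i x * (A x y * (\<bar>\<phi> y\<bar> * norm x powr (- (\<alpha> + n))))) \<partial>lborel) \<le> ennreal ((2 * M) powr \<alpha> * V) * ennreal (?i y * (\<bar>\<phi> y\<bar> * norm y powr (- \<alpha>)))"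
      proof (cases "y = 0")
        case True
        have "A x y = 0" for x
        proof -
          have "\<not> M * norm x < 0" using M0 by (simp add: not_less)
          then show ?thesis using True by (simp add: A_def)
        qed
        then show ?thesis using \<open>y = 0\<close> by simp
      next
        case False
        let ?c = "?i y * (\<bar>\<phi> y\<bar> * (norm y / (2 * M)) powr (- (\<alpha> + n)))"
        have "(\<integral>\<^sup>+x. ennreal (?i x * (A x y * (\<bar>\<phi> y\<bar> * norm x powr (- (\<alpha> + n))))) \<partial>lborel) \<le> (\<integral>\<^sup>+x. ennreal ?c * ennreal (A x y) \<partial>lborel)"
          using pt by (intro nn_integral_mono) (subst ennreal_mult'[symmetric], auto intro!: ennreal_leI)
        also have "\<dots> = ennreal ?c * (\<integral>\<^sup>+x. ennreal (A x y) \<partial>lborel)" by (rule nn_integral_cmult) simp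
        also have "\<dots> = ennreal (?c * ((norm y / (2 * M)) powr n * V))"
          unfolding A_x[OF False] by (simp add: ennreal_mult'[symmetric])
        also have "?c * ((norm y / (2 * M)) powr n * V) = ?i y * \<bar>\<phi> y\<bar> * V * ((norm y / (2 * M)) powr (- (\<alpha> + n)) * (norm y / (2 * M)) powr n)"
          by simp
        also have "(norm y / (2 * M)) powr (- (\<alpha> + n)) * (norm y / (2 * M)) powr n = (norm y / (2 * M)) powr (- \<alpha>)"
          unfolding powr_add[symmetric] by (rule arg_cong) simp
        also have "\<dots> = (2 * M) powr \<alpha> * norm y powr (- \<alpha>)"
          using M0 by (simp add: powr_divide powr_minus_divide)
        finally show ?thesis using V by (simp add: ennreal_mult'[symmetric] mult_ac)
      qed
    qed
    also have "\<dots> = ennreal ((2 * M) powr \<alpha> * V) * I \<delta>"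
      unfolding I_def by (rule nn_integral_cmult) (measurable; simp)
    finally show ?thesis by (simp add: add_left_mono)
  qed
  define B where "B = ennreal (enn2real E / (M powr n * V - (2 * M) powr \<alpha> * V))"
  have I_le: "I \<delta> \<le> B" if "\<delta> > 0" for \<delta>
    unfolding B_def using absorb[OF that] I_fin[OF that] E M V
    by (intro ennreal_absorb) (auto intro!: mult_strict_right_mono)
  define \<delta> where "\<delta> k = inverse (real (Suc k))" for k
  have \<delta>: "\<delta> k > 0" for k by (simp add: \<delta>_def)
  have "(\<integral>\<^sup>+x. (SUP k. ennreal (indicator (- cball 0 (\<delta> k)) x * (\<bar>\<phi> x\<bar> * norm x powr (- \<alpha>)))) \<partial>lborel) = (SUP k. I (\<delta> k))"
    unfolding I_def
  proof (rule nn_integral_monotone_convergence_SUP)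
    show "incseq (\<lambda>k x. ennreal (indicator (- cball 0 (\<delta> k)) x * (\<bar>\<phi> x\<bar> * norm x powr (- \<alpha>))))"
    proof (intro incseq_SucI le_funI ennreal_leI mult_right_mono)
      fix k and x :: "real ^ 'n"
      have "\<delta> (Suc k) \<le> \<delta> k" unfolding \<delta>_def by (intro le_imp_inverse_le) auto
      then show "indicator (- cball 0 (\<delta> k)) x \<le> (indicator (- cball 0 (\<delta> (Suc k))) x :: real)"
        by (auto simp: indicator_def)
    qed auto
  qed (measurable; simp)
  moreover have "(SUP k. ennreal (indicator (- cball 0 (\<delta> k)) x * (\<bar>\<phi> x\<bar> * norm x powr (- \<alpha>)))) = ennreal (\<bar>\<phi> x\<bar> * norm x powr (- \<alpha>))" for x
  proof (cases "x = 0")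
    case False
    then obtain k where "\<delta> k < norm x" unfolding \<delta>_def using reals_Archimedean[of "norm x"] by auto
    show ?thesis
    proof (rule antisym)
      show "(SUP k. ennreal (indicator (- cball 0 (\<delta> k)) x * (\<bar>\<phi> x\<bar> * norm x powr (- \<alpha>)))) \<le> ennreal (\<bar>\<phi> x\<bar> * norm x powr (- \<alpha>))"
        by (intro SUP_least ennreal_leI) (simp add: indicator_def)
      have "ennreal (\<bar>\<phi> x\<bar> * norm x powr (- \<alpha>)) = ennreal (indicator (- cball 0 (\<delta> k)) x * (\<bar>\<phi> x\<bar> * norm x powr (- \<alpha>)))"
        using \<open>\<delta> k < norm x\<close> by simp
      also have "\<dots> \<le> (SUP k. ennreal (indicator (- cball 0 (\<delta> k)) x * (\<bar>\<phi> x\<bar> * norm x powr (- \<alpha>))))"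
        by (rule SUP_upper) simp
      finally show "ennreal (\<bar>\<phi> x\<bar> * norm x powr (- \<alpha>)) \<le> (SUP k. ennreal (indicator (- cball 0 (\<delta> k)) x * (\<bar>\<phi> x\<bar> * norm x powr (- \<alpha>))))" .
    qed
  qed simp
  ultimately have "(\<integral>\<^sup>+x. ennreal (\<bar>\<phi> x\<bar> * norm x powr (- \<alpha>)) \<partial>lborel) = (SUP k. I (\<delta> k))" by simp
  also have "\<dots> \<le> B" using I_le \<delta> by (intro SUP_least) auto
  also have "\<dots> < \<infinity>" by (simp add: B_def)
  finally show ?thesis
    by (subst integrable_iff_nn_integral_finite) (auto simp: powr_minus divide_inverse abs_mult)
qed

end

section \<open>The weak formulation\<close>

lemma integrable_product:
  fixes a :: "'a::euclidean_space \<Rightarrow> real" and b :: "'b::euclidean_space \<Rightarrow> real"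
  assumes a: "integrable lborel a" and b: "integrable lborel b"
  shows "integrable lborel (\<lambda>z. a (fst z) * b (snd z))"
proof -
  have [measurable]: "a \<in> borel_measurable borel" "b \<in> borel_measurable borel"
    using assms by (auto dest: borel_measurable_integrable)
  have m: "(\<lambda>z. a (fst z) * b (snd z)) \<in> borel_measurable borel"
    unfolding borel_prod[symmetric] by measurable
  have "(\<integral>\<^sup>+z. ennreal \<bar>a (fst z) * b (snd z)\<bar> \<partial>lborel) = (\<integral>\<^sup>+x. \<integral>\<^sup>+y. ennreal \<bar>a x\<bar> * ennreal \<bar>b y\<bar> \<partial>lborel \<partial>lborel)"
  proof -
    have "(\<lambda>z. ennreal \<bar>a (fst z) * b (snd z)\<bar>) \<in> borel_measurable borel" using m by measurable
    from nn_integral_lborel_pair[OF this] show ?thesis by (simp add: abs_mult ennreal_mult')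
  qed
  also have "\<dots> = (\<integral>\<^sup>+x. ennreal \<bar>a x\<bar> * (\<integral>\<^sup>+y. ennreal \<bar>b y\<bar> \<partial>lborel) \<partial>lborel)"
    by (intro nn_integral_cong nn_integral_cmult) simp
  also have "\<dots> = (\<integral>\<^sup>+x. ennreal \<bar>a x\<bar> \<partial>lborel) * (\<integral>\<^sup>+y. ennreal \<bar>b y\<bar> \<partial>lborel)"
    by (rule nn_integral_multc) simp
  also have "\<dots> < \<infinity>"
    using a b by (simp add: integrable_iff_nn_integral_finite ennreal_mult_less_top)
  finally show ?thesis using m by (simp add: integrable_iff_nn_integral_finite)
qed

lemma add_powr_le:
  fixes a b q :: real
  assumes "a \<ge> 0" "b \<ge> 0" "q \<ge> 0"
  shows "(a + b) powr q \<le> 2 powr q * (a powr q + b powr q)"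
proof -
  have "(a + b) powr q \<le> (2 * max a b) powr q" using assms by (intro powr_mono2) auto
  also have "\<dots> = 2 powr q * (max a b) powr q" using assms by (simp add: powr_mult)
  also have "\<dots> \<le> 2 powr q * (a powr q + b powr q)"
    by (intro mult_left_mono) (auto simp: max_def)
  finally show ?thesis .
qed

context test_pairing
begin

definition pairing where
  "pairing z = Jp p (u (fst z) - u (snd z)) * (\<phi> (fst z) - \<phi> (snd z)) / norm (fst z - snd z) powr (n + s * p)"

lemma pairing_measurable [measurable]: "pairing \<in> borel_measurable borel"
  unfolding pairing_def[abs_def] borel_prod[symmetric] by measurable

lemma pairing_eq: "pairing (x, y) = G (norm x) (norm y) (norm (x - y)) * (\<phi> x - \<phi> y)"
  unfolding u_kernel[symmetric] by (simp add: pairing_def)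

text \<open>Young's inequality: the exponent conjugate to p turns |u x - u y|^(p - 1) into the p-th
  power, leaving the Gagliardo quotients of u and of \<phi>.\<close>

lemma pairing_bound_near:
  "\<bar>pairing z\<bar> \<le> \<bar>u (fst z) - u (snd z)\<bar> powr p / norm (fst z - snd z) powr (n + s * p)
    + \<bar>\<phi> (fst z) - \<phi> (snd z)\<bar> powr p / norm (fst z - snd z) powr (n + s * p)"
proof -
  let ?a = "\<bar>u (fst z) - u (snd z)\<bar>" and ?b = "\<bar>\<phi> (fst z) - \<phi> (snd z)\<bar>"
  have "?b * ?a powr (p - 1) \<le> ?b powr p + (?a powr (p - 1)) powr (p / (p - 1))"
    using p_gt by (intro mult_le_powr_conjugate) auto
  also have "(?a powr (p - 1)) powr (p / (p - 1)) = ?a powr p" using p_gt by (simp add: powr_powr)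
  finally have "?a powr (p - 1) * ?b / norm (fst z - snd z) powr (n + s * p) \<le> (?a powr p + ?b powr p) / norm (fst z - snd z) powr (n + s * p)"
    by (intro divide_right_mono) (auto simp: mult.commute)
  then show ?thesis by (simp add: pairing_def abs_mult abs_Jp add_divide_distrib)
qed

text \<open>A majorant of \<open>pairing\<close> for |x| < 1 and |y| >= 2. It is a sum of two
  products of a function of x and a function of y, so its integrability reduces to integrals in one
  variable. The constant 3 stems from 1 + |y| <= 3 |x - y|, the power of 2 from splitting |u x - u
  y|^(p - 1).\<close>

definition far where
  "far x y = 3 powr (n + s * p) * 2 powr (p - 1) *
     ((\<bar>u x\<bar> powr (p - 1) * \<bar>\<phi> x\<bar>) * (indicator (- ball 0 1) y * norm y powr (- (n + s * p)))
       + \<bar>\<phi> x\<bar> * (\<bar>u y\<bar> powr (p - 1) / (1 + norm y) powr (n + s * p)))"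

lemma far_nonneg: "far x y \<ge> 0"
  by (simp add: far_def)

lemma pairing_bound_far:
  assumes x: "norm x < 1" and y: "norm y \<ge> 2"
  shows "\<bar>pairing (x, y)\<bar> \<le> far x y"
proof -
  have \<beta>: "n + s * p > 0" using n_pos s_pos p_gt by (simp add: add_pos_pos)
  have "norm y - norm x \<le> norm (x - y)" using norm_triangle_ineq3[of x y] by linarith
  then have "1 + norm y \<le> 3 * norm (x - y)" using x y by linarith
  then have d: "(1 + norm y) / 3 \<le> norm (x - y)" by simp
  then have "norm (x - y) powr (- (n + s * p)) \<le> ((1 + norm y) / 3) powr (- (n + s * p))"
    using \<beta> y by (intro powr_mono2') auto
  also have "\<dots> = 3 powr (n + s * p) * (1 + norm y) powr (- (n + s * p))"
  proof -
    define b where "b = n + s * p"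
    have "((1 + norm y) / 3) powr (- b) = 3 powr b * (1 + norm y) powr (- b)"
      using y by (simp add: powr_divide powr_minus_divide)
    then show ?thesis by (simp add: b_def)
  qed
  finally have 1: "norm (x - y) powr (- (n + s * p)) \<le> 3 powr (n + s * p) * (1 + norm y) powr (- (n + s * p))" .
  have "\<bar>u x - u y\<bar> powr (p - 1) \<le> (\<bar>u x\<bar> + \<bar>u y\<bar>) powr (p - 1)"
    using p_gt by (intro powr_mono2) auto
  also have "\<dots> \<le> 2 powr (p - 1) * (\<bar>u x\<bar> powr (p - 1) + \<bar>u y\<bar> powr (p - 1))"
    using p_gt by (intro add_powr_le) auto
  finally have 2: "\<bar>u x - u y\<bar> powr (p - 1) \<le> 2 powr (p - 1) * (\<bar>u x\<bar> powr (p - 1) + \<bar>u y\<bar> powr (p - 1))" .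
  have 3: "(1 + norm y) powr (- (n + s * p)) \<le> norm y powr (- (n + s * p))"
    using \<beta> y by (intro powr_mono2') auto
  have "\<phi> y = 0" using y by (intro phi_outside) auto
  then have "\<bar>pairing (x, y)\<bar> = \<bar>u x - u y\<bar> powr (p - 1) * \<bar>\<phi> x\<bar> * norm (x - y) powr (- (n + s * p))"
    unfolding powr_minus by (simp add: pairing_def abs_mult abs_Jp divide_inverse)
  also have "\<dots> \<le> (2 powr (p - 1) * (\<bar>u x\<bar> powr (p - 1) + \<bar>u y\<bar> powr (p - 1))) * \<bar>\<phi> x\<bar> * (3 powr (n + s * p) * (1 + norm y) powr (- (n + s * p)))"
    using 1 2 by (intro mult_mono) auto
  also have "\<dots> = 3 powr (n + s * p) * 2 powr (p - 1) * ((\<bar>u x\<bar> powr (p - 1) * \<bar>\<phi> x\<bar>) * (1 + norm y) powr (- (n + s * p))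
      + \<bar>\<phi> x\<bar> * (\<bar>u y\<bar> powr (p - 1) * (1 + norm y) powr (- (n + s * p))))"
    by (simp add: algebra_simps)
  also have "\<dots> \<le> 3 powr (n + s * p) * 2 powr (p - 1) * ((\<bar>u x\<bar> powr (p - 1) * \<bar>\<phi> x\<bar>) * norm y powr (- (n + s * p))
      + \<bar>\<phi> x\<bar> * (\<bar>u y\<bar> powr (p - 1) * (1 + norm y) powr (- (n + s * p))))"
    using 3 by (intro mult_left_mono add_right_mono) auto
  also have "\<dots> = far x y" unfolding far_def powr_minus using y by (simp add: divide_inverse)
  finally show ?thesis .
qed

lemma pairing_swap: "pairing (y, x) = pairing (x, y)"
  using G_swap[of "norm x" "norm y" "norm (x - y)"] by (simp add: pairing_eq norm_minus_commute[of y x] algebra_simps)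

lemma integrable_far: "integrable lborel (\<lambda>z. far (fst z) (snd z))"
proof -
  have phi_abs: "integrable lborel (\<lambda>x. \<bar>\<phi> x\<bar>)" using integrable_phi by simp
  have u_phi: "integrable lborel (\<lambda>x. \<bar>u x\<bar> powr (p - 1) * \<bar>\<phi> x\<bar>)"
  proof (rule Bochner_Integration.integrable_bound)
    have "\<gamma> * p < DIM(real ^ 'n)" using gamma_p p_gt by (simp add: n_eq)
    then show "integrable lborel (\<lambda>x. indicator (ball (0 :: real ^ 'n) 1) x * norm x powr (- (\<gamma> * p)) + \<bar>\<phi> x\<bar> powr p)"
      by (intro Bochner_Integration.integrable_add integrable_power_ball phi_Lp)
    show "AE x in lborel. norm (\<bar>u x\<bar> powr (p - 1) * \<bar>\<phi> x\<bar>) \<le> norm (indicator (ball (0 :: real ^ 'n) 1) x * norm x powr (- (\<gamma> * p)) + \<bar>\<phi> x\<bar> powr p)"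
    proof (rule AE_I2)
      fix x
      show "norm (\<bar>u x\<bar> powr (p - 1) * \<bar>\<phi> x\<bar>) \<le> norm (indicator (ball (0 :: real ^ 'n) 1) x * norm x powr (- (\<gamma> * p)) + \<bar>\<phi> x\<bar> powr p)"
      proof (cases "norm x < 1")
        case True
        have "\<bar>\<phi> x\<bar> * \<bar>u x\<bar> powr (p - 1) \<le> \<bar>\<phi> x\<bar> powr p + (\<bar>u x\<bar> powr (p - 1)) powr (p / (p - 1))"
          using p_gt by (intro mult_le_powr_conjugate) auto
        also have "(\<bar>u x\<bar> powr (p - 1)) powr (p / (p - 1)) = norm x powr (- (\<gamma> * p))"
          using p_gt by (simp add: u_eq powr_powr)
        finally show ?thesis using True by (simp add: abs_mult mult.commute add.commute)
      next
        case False then show ?thesis using phi_outside[of x] by simp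
      qed
    qed
  qed simp
  have out: "integrable lborel (\<lambda>y. indicator (- ball (0 :: real ^ 'n) 1) y * norm y powr (- (n + s * p)))"
  proof -
    have "n + s * p > CARD('n)" using s_pos p_gt by (simp add: n_eq)
    from nn_integral_power_outside[OF this] show ?thesis
      by (subst integrable_iff_nn_integral_finite) (auto simp: abs_mult)
  qed
  have tail: "integrable lborel (\<lambda>y. \<bar>u y\<bar> powr (p - 1) / (1 + norm y) powr (n + s * p))"
    using u_tail_space by (simp add: tail_space_def n_eq integrable_completion)
  show ?thesis unfolding far_def
    by (intro integrable_mult_right Bochner_Integration.integrable_add integrable_product phi_abs u_phi out tail)
qed

lemma integrable_swap:
  fixes f :: "'a::euclidean_space \<times> 'a \<Rightarrow> real"
  assumes "integrable lborel f"
  shows "integrable lborel (\<lambda>z. f (snd z, fst z))"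
    and "(\<integral>z. f (snd z, fst z) \<partial>lborel) = integral\<^sup>L lborel f"
proof -
  have f: "integrable (lborel \<Otimes>\<^sub>M lborel) f" using assms by (simp add: lborel_prod)
  then have m: "f \<in> borel_measurable (lborel \<Otimes>\<^sub>M lborel)" by (rule borel_measurable_integrable)
  show "integrable lborel (\<lambda>z. f (snd z, fst z))"
    using lborel_pair.integrable_product_swap[OF f] by (simp add: lborel_prod case_prod_unfold)
  show "(\<integral>z. f (snd z, fst z) \<partial>lborel) = integral\<^sup>L lborel f"
    using lborel_pair.integral_product_swap[OF m] by (simp add: lborel_prod case_prod_unfold)
qed

lemma integrable_pairing: "integrable lborel pairing"
proof (rule Bochner_Integration.integrable_bound)
  let ?g = "\<lambda>z. indicator (ball 0 2 \<times> ball 0 2) z * (\<bar>u (fst z) - u (snd z)\<bar> powr p / norm (fst z - snd z) powr (n + s * p))"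
  let ?h = "\<lambda>z. \<bar>\<phi> (fst z) - \<phi> (snd z)\<bar> powr p / norm (fst z - snd z) powr (n + s * p)"
  have "?g \<in> borel_measurable borel"
  proof (rule borel_measurable_times)
    have "ball (0 :: real ^ 'n) 2 \<times> ball (0 :: real ^ 'n) 2 \<in> sets borel" by (simp add: open_Times)
    then show "indicator (ball (0 :: real ^ 'n) 2 \<times> ball (0 :: real ^ 'n) 2) \<in> borel_measurable borel" by simp
    show "(\<lambda>z. \<bar>u (fst z) - u (snd z)\<bar> powr p / norm (fst z - snd z) powr (n + s * p)) \<in> borel_measurable borel"
      unfolding borel_prod[symmetric] by measurable
  qed
  then have g: "integrable lborel ?g"
    using gagliardo_ball_finite[of 2] by (subst integrable_iff_nn_integral_finite) (auto simp: abs_mult)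
  show "integrable lborel (\<lambda>z. ?g z + ?h z + (far (fst z) (snd z) + far (snd z) (fst z)))"
    using integrable_swap(1)[OF integrable_far]
    by (intro Bochner_Integration.integrable_add g phi_gagliardo integrable_far) simp
  have "\<bar>pairing z\<bar> \<le> ?g z + ?h z + (far (fst z) (snd z) + far (snd z) (fst z))" for z
  proof -
    obtain x y where z: "z = (x, y)" by (cases z)
    have nonneg: "?g z \<ge> 0" "?h z \<ge> 0" "far x y \<ge> 0" "far y x \<ge> 0" by (simp_all add: far_nonneg)
    \<comment> \<open>If both points lie in the ball of radius 2, the local energies suffice. If one
      lies in the unit ball and the other beyond radius 2, \<open>far\<close> applies; outside the
      unit ball in both variables the integrand is 0.\<close>
    consider "norm x < 2" "norm y < 2" | "norm x < 1" "norm y \<ge> 2" | "norm y < 1" "norm x \<ge> 2" | "norm x \<ge> 1" "norm y \<ge> 1"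
      by linarith
    then show ?thesis
    proof cases
      case 1
      have "\<bar>pairing z\<bar> \<le> ?g z + ?h z" using pairing_bound_near[of z] 1 by (simp add: z)
      then show ?thesis using nonneg by (simp add: z)
    next
      case 2
      then have "\<bar>pairing z\<bar> \<le> far x y" using pairing_bound_far by (simp add: z)
      then show ?thesis using nonneg unfolding z fst_conv snd_conv by linarith
    next
      case 3
      then have "\<bar>pairing z\<bar> \<le> far y x" using pairing_bound_far[of y x] pairing_swap[of x y] by (simp add: z)
      then show ?thesis using nonneg unfolding z fst_conv snd_conv by linarith
    next
      case 4
      then have "pairing z = 0" using phi_outside by (simp add: z pairing_def)
      then show ?thesis using nonneg unfolding z fst_conv snd_conv by linarith
    qed
  qed
  then show "AE z in lborel. norm (pairing z) \<le> norm (?g z + ?h z + (far (fst z) (snd z) + far (snd z) (fst z)))"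
    by (intro AE_I2) (auto intro: order_trans[OF _ abs_ge_self])
qed simp

lemma dcut_swap: "dcut \<epsilon> b a c = - dcut \<epsilon> a b c"
  using G_swap[of b a c] by (simp add: dcut_def max.commute)

lemma radial_kernel_dcut:
  shows "radial_kernel (dcut \<epsilon>) (- (\<alpha> + n))" and "radial_kernel (\<lambda>a b c. \<bar>dcut \<epsilon> a b c\<bar>) (- (\<alpha> + n))"
proof -
  have hom: "dcut \<epsilon> (t * a) (t * b) (t * c) = t powr (- (\<alpha> + n)) * dcut \<epsilon> a b c"
    if "t > 0" "a \<ge> 0" "b \<ge> 0" "c \<ge> 0" for t a b c
  proof -
    have "max (t * a) (t * b) = t * max a b" using that by (simp add: max_mult_distrib_left)
    then have "\<epsilon> * max (t * a) (t * b) \<le> t * c \<longleftrightarrow> \<epsilon> * max a b \<le> c"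
      using that by (simp add: mult.left_commute)
    then show ?thesis using G_homogeneous[OF that] by (simp add: dcut_def)
  qed
  show "radial_kernel (dcut \<epsilon>) (- (\<alpha> + n))"
  proof
    show "(\<lambda>(b, c). dcut \<epsilon> a b c) \<in> borel_measurable (borel \<Otimes>\<^sub>M borel)" for a by measurable
  qed (rule hom)
  show "radial_kernel (\<lambda>a b c. \<bar>dcut \<epsilon> a b c\<bar>) (- (\<alpha> + n))"
  proof
    show "(\<lambda>(b, c). \<bar>dcut \<epsilon> a b c\<bar>) \<in> borel_measurable (borel \<Otimes>\<^sub>M borel)" for a by measurable
  qed (simp add: hom abs_mult)
qed

text \<open>Away from the diagonal the kernel is integrable against \<open>\<phi> x\<close> alone, so that antisymmetry
  turns the double integral into \<open>2 \<integral> \<phi> x (\<integral> dcut \<epsilon> dy) dx\<close>.\<close>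

lemma pairing_dcut_integral:
  assumes \<epsilon>: "\<epsilon> > 0"
  shows "(\<integral>z. (if \<epsilon> * max (norm (fst z)) (norm (snd z)) \<le> norm (fst z - snd z) then pairing z else 0) \<partial>lborel)
    = 2 * ((\<integral>y. dcut \<epsilon> 1 (norm y) (norm (e - y)) \<partial>lborel) * (\<integral>x. \<phi> x / norm x powr \<alpha> \<partial>lborel))"
proof -
  interpret k: radial_kernel "dcut \<epsilon>" "- (\<alpha> + n)" by (rule radial_kernel_dcut)
  interpret ka: radial_kernel "\<lambda>a b c. \<bar>dcut \<epsilon> a b c\<bar>" "- (\<alpha> + n)" by (rule radial_kernel_dcut)
  define Q where "Q z = \<phi> (fst z) * dcut \<epsilon> (norm (fst z)) (norm (snd z)) (norm (fst z - snd z))" for z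
  have Qm [measurable]: "Q \<in> borel_measurable borel" unfolding Q_def[abs_def] borel_prod[symmetric] by measurable
  define K where "K = (\<integral>\<^sup>+z. ennreal \<bar>dcut \<epsilon> 1 (norm z) (norm (e - z))\<bar> \<partial>lborel)"
  have K: "K < \<infinity>"
    using dcut_integral(1)[OF \<epsilon>] unfolding K_def by (subst integrable_iff_nn_integral_finite[symmetric]) auto
  have "(\<integral>\<^sup>+z. ennreal \<bar>Q z\<bar> \<partial>lborel) = (\<integral>\<^sup>+x. \<integral>\<^sup>+y. ennreal \<bar>\<phi> x\<bar> * ennreal \<bar>dcut \<epsilon> (norm x) (norm y) (norm (x - y))\<bar> \<partial>lborel \<partial>lborel)"
  proof -
    have "(\<lambda>z. ennreal \<bar>Q z\<bar>) \<in> borel_measurable borel" by measurable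
    from nn_integral_lborel_pair[OF this] show ?thesis by (simp add: Q_def abs_mult ennreal_mult')
  qed
  also have "\<dots> = (\<integral>\<^sup>+x. ennreal \<bar>\<phi> x\<bar> * (\<integral>\<^sup>+y. ennreal \<bar>dcut \<epsilon> (norm x) (norm y) (norm (x - y))\<bar> \<partial>lborel) \<partial>lborel)"
    by (intro nn_integral_cong nn_integral_cmult) simp
  also have "\<dots> = (\<integral>\<^sup>+x. ennreal \<bar>\<phi> x / norm x powr \<alpha>\<bar> * K \<partial>lborel)"
  proof (rule nn_integral_cong_AE, rule eventually_mono[OF AE_lborel_singleton[of "0 :: real ^ 'n"]])
    fix x :: "real ^ 'n" assume x: "x \<noteq> 0"
    have "(\<integral>\<^sup>+y. ennreal \<bar>dcut \<epsilon> (norm x) (norm y) (norm (x - y))\<bar> \<partial>lborel) = ennreal (norm x powr (- \<alpha>)) * K"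
      using ka.nn_integral_radial_kernel[OF norm_e x] by (simp add: K_def n_eq)
    then have "ennreal \<bar>\<phi> x\<bar> * (\<integral>\<^sup>+y. ennreal \<bar>dcut \<epsilon> (norm x) (norm y) (norm (x - y))\<bar> \<partial>lborel) = ennreal (\<bar>\<phi> x\<bar> * norm x powr (- \<alpha>)) * K"
      by (simp add: ennreal_mult' mult.assoc)
    also have "\<bar>\<phi> x\<bar> * norm x powr (- \<alpha>) = \<bar>\<phi> x / norm x powr \<alpha>\<bar>" by (simp add: abs_mult powr_minus divide_inverse)
    finally show "ennreal \<bar>\<phi> x\<bar> * (\<integral>\<^sup>+y. ennreal \<bar>dcut \<epsilon> (norm x) (norm y) (norm (x - y))\<bar> \<partial>lborel) = ennreal \<bar>\<phi> x / norm x powr \<alpha>\<bar> * K" .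
  qed
  also have "\<dots> = (\<integral>\<^sup>+x. ennreal \<bar>\<phi> x / norm x powr \<alpha>\<bar> \<partial>lborel) * K"
    by (rule nn_integral_multc) simp
  also have "\<dots> < \<infinity>"
    using integrable_phi_alpha K
    by (subst (asm) integrable_iff_nn_integral_finite) (auto simp: ennreal_mult_less_top)
  finally have Qi: "integrable lborel Q" by (simp add: integrable_iff_nn_integral_finite)
  have "integral\<^sup>L lborel Q = (\<integral>x. \<integral>y. Q (x, y) \<partial>lborel \<partial>lborel)"
    using lborel_pair.integral_fst'[of Q] Qi by (simp add: lborel_prod)
  also have "\<dots> = (\<integral>x. (\<phi> x / norm x powr \<alpha>) * (\<integral>y. dcut \<epsilon> 1 (norm y) (norm (e - y)) \<partial>lborel) \<partial>lborel)"
  proof (rule integral_cong_AE)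
    show "(\<lambda>x. \<integral>y. Q (x, y) \<partial>lborel) \<in> borel_measurable lborel"
      by (rule lborel.borel_measurable_lebesgue_integral) (simp add: lborel_prod)
    show "AE x in lborel. (\<integral>y. Q (x, y) \<partial>lborel) = (\<phi> x / norm x powr \<alpha>) * (\<integral>y. dcut \<epsilon> 1 (norm y) (norm (e - y)) \<partial>lborel)"
    proof (rule eventually_mono[OF AE_lborel_singleton[of "0 :: real ^ 'n"]])
      fix x :: "real ^ 'n" assume x: "x \<noteq> 0"
      show "(\<integral>y. Q (x, y) \<partial>lborel) = (\<phi> x / norm x powr \<alpha>) * (\<integral>y. dcut \<epsilon> 1 (norm y) (norm (e - y)) \<partial>lborel)"
        using k.integral_radial_kernel[OF norm_e x] by (simp add: Q_def n_eq powr_minus divide_inverse)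
    qed
  qed simp
  also have "\<dots> = (\<integral>x. \<phi> x / norm x powr \<alpha> \<partial>lborel) * (\<integral>y. dcut \<epsilon> 1 (norm y) (norm (e - y)) \<partial>lborel)"
    by (rule integral_mult_left_zero)
  also have "\<dots> = (\<integral>y. dcut \<epsilon> 1 (norm y) (norm (e - y)) \<partial>lborel) * (\<integral>x. \<phi> x / norm x powr \<alpha> \<partial>lborel)"
    by (rule mult.commute)
  finally have Qint: "integral\<^sup>L lborel Q = (\<integral>y. dcut \<epsilon> 1 (norm y) (norm (e - y)) \<partial>lborel) * (\<integral>x. \<phi> x / norm x powr \<alpha> \<partial>lborel)" .
  have "(if \<epsilon> * max (norm (fst z)) (norm (snd z)) \<le> norm (fst z - snd z) then pairing z else 0) = Q z + Q (snd z, fst z)" for z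
  proof -
    obtain x y where z: "z = (x, y)" by (cases z)
    have "Q (y, x) = - (\<phi> y * dcut \<epsilon> (norm x) (norm y) (norm (x - y)))"
      using dcut_swap[of \<epsilon> "norm y" "norm x" "norm (x - y)"] by (simp add: Q_def norm_minus_commute[of y x])
    then have "Q z + Q (snd z, fst z) = dcut \<epsilon> (norm x) (norm y) (norm (x - y)) * (\<phi> x - \<phi> y)"
      by (simp add: z Q_def algebra_simps)
    then show ?thesis by (simp add: z dcut_def pairing_eq)
  qed
  then show ?thesis
    using Qi integrable_swap[OF Qi] Qint by simp
qed

text \<open>As \<epsilon> -> 0, the cut double integrals converge by domination, since
  \<open>pairing\<close> is integrable, while the right-hand side converges by
  \<open>dcut_tendsto\<close>. This is how the weak equation inherits the constant of the pointwise
  one.\<close>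

lemma pairing_integral: "integral\<^sup>L lborel pairing = 2 * (c\<^sub>0 * (\<integral>x. \<phi> x / norm x powr \<alpha> \<partial>lborel))"
proof -
  define \<epsilon> where "\<epsilon> k = inverse (real (Suc k))" for k
  have \<epsilon>: "\<epsilon> k > 0" for k by (simp add: \<epsilon>_def)
  have \<epsilon>_lim: "\<epsilon> \<longlonglongrightarrow> 0" unfolding \<epsilon>_def by (rule LIMSEQ_inverse_real_of_nat)
  let ?P = "\<lambda>k z. if \<epsilon> k * max (norm (fst z)) (norm (snd z)) \<le> norm (fst z - snd z) then pairing z else 0"
  have "(\<lambda>k. \<integral>z. ?P k z \<partial>lborel) \<longlonglongrightarrow> integral\<^sup>L lborel pairing"
  proof (rule integral_dominated_convergence[where w = "\<lambda>z. \<bar>pairing z\<bar>"])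
    show "integrable lborel (\<lambda>z. \<bar>pairing z\<bar>)" using integrable_pairing by simp
    have "(\<lambda>z. ?P k z) \<in> borel_measurable borel" for k
    proof (rule measurable_If[OF pairing_measurable])
      show "{z \<in> space borel. \<epsilon> k * max (norm (fst z)) (norm (snd z)) \<le> norm (fst z - snd z)} \<in> sets (borel :: ((real ^ 'n) \<times> (real ^ 'n)) measure)"
        unfolding borel_prod[symmetric] by measurable
    qed simp
    then show "?P k \<in> borel_measurable lborel" for k by simp
    show "AE z in lborel. norm (?P k z) \<le> \<bar>pairing z\<bar>" for k by (intro AE_I2) auto
    show "AE z in lborel. (\<lambda>k. ?P k z) \<longlonglongrightarrow> pairing z"
    proof (rule AE_I2)
      fix z :: "(real ^ 'n) \<times> (real ^ 'n)"
      show "(\<lambda>k. ?P k z) \<longlonglongrightarrow> pairing z"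
      \<comment> \<open>On the diagonal the cut never needs to release the point, because the
        quotient is 0 there.\<close>
      proof (cases "fst z = snd z")
        case True
        then have "pairing z = 0" by (simp add: pairing_def)
        then show ?thesis by (simp cong: if_cong)
      next
        case False
        have "(\<lambda>k. \<epsilon> k * max (norm (fst z)) (norm (snd z))) \<longlonglongrightarrow> 0 * max (norm (fst z)) (norm (snd z))"
          by (intro tendsto_intros \<epsilon>_lim)
        then have "eventually (\<lambda>k. \<epsilon> k * max (norm (fst z)) (norm (snd z)) < norm (fst z - snd z)) sequentially"
          using False by (intro order_tendstoD(2)) auto
        then show ?thesis by (intro tendsto_eventually) (erule eventually_mono, simp)
      qed
    qed
  qed simp
  moreover have "(\<lambda>k. \<integral>z. ?P k z \<partial>lborel) \<longlonglongrightarrow> 2 * (c\<^sub>0 * (\<integral>x. \<phi> x / norm x powr \<alpha> \<partial>lborel))"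
  proof -
    have "filterlim \<epsilon> (at_right 0) sequentially"
      unfolding filterlim_at using \<epsilon>_lim \<epsilon> less_imp_neq[OF \<epsilon>] by (auto intro!: always_eventually)
    from filterlim_compose[OF dcut_tendsto this]
    have "(\<lambda>k. \<integral>y. dcut (\<epsilon> k) 1 (norm y) (norm (e - y)) \<partial>lborel) \<longlonglongrightarrow> c\<^sub>0" .
    from tendsto_mult_left[OF tendsto_mult_right[OF this]]
    show ?thesis unfolding pairing_dcut_integral[OF \<epsilon>] .
  qed
  ultimately show ?thesis by (rule LIMSEQ_unique)
qed

end

section \<open>Borel representatives of test functions\<close>

lemma AE_lborel_pair:
  assumes "AE x in (lborel :: 'a::euclidean_space measure). P x"
  shows "AE z in (lborel :: ('a \<times> 'a) measure). P (fst z) \<and> P (snd z)"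
proof -
  obtain N :: "'a set" where N: "\<And>x. x \<notin> N \<Longrightarrow> P x" "N \<in> null_sets lborel"
    using AE_E3[OF assms] by auto
  have "N \<times> (UNIV :: 'a set) \<in> null_sets lborel" "(UNIV :: 'a set) \<times> N \<in> null_sets lborel"
    using lborel.times_in_null_sets1[OF N(2), of "UNIV :: 'a set"]
      lborel.times_in_null_sets2[OF _ N(2), of "UNIV :: 'a set" lborel]
    by (simp_all add: lborel_prod)
  then have "AE z in lborel. z \<notin> N \<times> (UNIV :: 'a set)" "AE z in lborel. z \<notin> (UNIV :: 'a set) \<times> N"
    by (auto intro: AE_not_in)
  then show ?thesis
    by eventually_elim (auto intro: N(1) simp: mem_Times_iff)
qed

lemma integrable_lebesgue_cong_AE:
  fixes f f' :: "'a::euclidean_space \<Rightarrow> real"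
  assumes ae: "AE x in lborel. f x = f' x" and f': "f' \<in> borel_measurable borel"
  shows "integrable lebesgue f \<longleftrightarrow> integrable lborel f'"
    and "integral\<^sup>L lebesgue f = integral\<^sup>L lborel f'"
proof -
  have ae': "AE x in lebesgue. f x = f' x" using ae by (rule AE_completion)
  have f'm: "f' \<in> borel_measurable lebesgue" using f' by (intro measurable_completion) simp
  have fm: "f \<in> borel_measurable lebesgue"
    using ae' f'm by (intro borel_measurable_AE[OF f'm]) (auto elim: eventually_mono)
  have "integrable lebesgue f \<longleftrightarrow> integrable lebesgue f'"
    by (rule integrable_cong_AE[OF fm f'm ae'])
  then show "integrable lebesgue f \<longleftrightarrow> integrable lborel f'"
    using f' by (simp add: integrable_completion)
  have "integral\<^sup>L lebesgue f = integral\<^sup>L lebesgue f'"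
    by (rule integral_cong_AE[OF fm f'm ae'])
  then show "integral\<^sup>L lebesgue f = integral\<^sup>L lborel f'"
    using f' by (simp add: integral_completion)
qed

lemma lebesgue_measurable_borel_representative:
  fixes \<phi> :: "'a::euclidean_space \<Rightarrow> real"
  assumes "\<phi> \<in> borel_measurable lebesgue" and out: "\<And>x. x \<notin> A \<Longrightarrow> \<phi> x = 0" and A: "A \<in> sets borel"
  shows "\<exists>\<psi>. \<psi> \<in> borel_measurable borel \<and> (AE x in lborel. \<phi> x = \<psi> x) \<and> (\<forall>x. x \<notin> A \<longrightarrow> \<psi> x = 0)"
proof -
  obtain \<psi> where \<psi>: "\<psi> \<in> borel_measurable lborel" "AE x in lborel. \<phi> x = \<psi> x"
    using completion_ex_borel_measurable_real[OF assms(1)] by blast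
  show ?thesis
  \<comment> \<open>The indicator restores exact vanishing off \<open>A\<close>, which the
    representative satisfies only almost everywhere.\<close>
  proof (intro exI[of _ "\<lambda>x. indicator A x * \<psi> x"] conjI)
    show "(\<lambda>x. indicator A x * \<psi> x) \<in> borel_measurable borel" using \<psi>(1) A by simp
    show "AE x in lborel. \<phi> x = indicator A x * \<psi> x"
      using \<psi>(2) by eventually_elim (auto simp: indicator_def out)
  qed auto
qed

context power_solution
begin

text \<open>Changing \<phi> on a null set N alters the double integrand only where one of the two
  points lies in N, which is a null set of the product. Both sides are thus those of a Borel
  function, to which \<open>test_pairing\<close> applies.\<close>

lemma weak_solution_identity:
  assumes \<phi>: "\<phi> \<in> Wsp s p UNIV" and supp: "compactly_contained {x. \<phi> x \<noteq> 0} (ball (0 :: real ^ 'n) 1)"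
  defines "F \<equiv> (\<lambda>(x, y). Jp p (u x - u y) * (\<phi> x - \<phi> y) / norm (x - y) powr (real DIM(real ^ 'n) + s * p))"
  shows "integrable lebesgue F"
    and "integrable (lebesgue_on (ball 0 1)) (\<lambda>x. c\<^sub>0 / norm x powr \<alpha> * \<phi> x)"
    and "integral\<^sup>L lebesgue F = 2 * integral\<^sup>L (lebesgue_on (ball 0 1)) (\<lambda>x. c\<^sub>0 / norm x powr \<alpha> * \<phi> x)"
proof -
  have out: "\<phi> x = 0" if "x \<notin> ball 0 1" for x
    using supp closure_subset[of "{x. \<phi> x \<noteq> 0}"] that by (auto simp: compactly_contained_def)
  have meas: "\<phi> \<in> borel_measurable lebesgue"
    and int: "integrable lebesgue (\<lambda>x. \<bar>\<phi> x\<bar> powr p)"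
    and gag: "integrable lebesgue (\<lambda>(x, y). \<bar>\<phi> x - \<phi> y\<bar> powr p / norm (x - y) powr (real DIM(real ^ 'n) + s * p))"
    using \<phi> by (auto simp: Wsp_def Lp_def lebesgue_on_UNIV_eq)
  obtain \<psi> where \<psi>: "\<psi> \<in> borel_measurable borel" and ae: "AE x in lborel. \<phi> x = \<psi> x"
    and \<psi>_out: "\<And>x. x \<notin> ball 0 1 \<Longrightarrow> \<psi> x = 0"
    using lebesgue_measurable_borel_representative[OF meas out borel_ball] by blast
  note [measurable] = \<psi>
  have ae2: "AE z in lborel. \<phi> (fst z) = \<psi> (fst z) \<and> \<phi> (snd z) = \<psi> (snd z)"
    by (rule AE_lborel_pair[OF ae])
  interpret t: test_pairing n s p \<gamma> e \<psi>
  proof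
    show "\<psi> x = 0" if "norm x \<ge> 1" for x using that by (intro \<psi>_out) simp
    have "AE x in lborel. \<bar>\<phi> x\<bar> powr p = \<bar>\<psi> x\<bar> powr p" using ae by eventually_elim simp
    from integrable_lebesgue_cong_AE(1)[OF this] int
    show "integrable lborel (\<lambda>x. \<bar>\<psi> x\<bar> powr p)" by simp
    let ?h = "\<lambda>z. \<bar>\<psi> (fst z) - \<psi> (snd z)\<bar> powr p / norm (fst z - snd z) powr (n + s * p)"
    have hm: "?h \<in> borel_measurable borel" unfolding borel_prod[symmetric] by measurable
    have "AE z in lborel. (case z of (x, y) \<Rightarrow> \<bar>\<phi> x - \<phi> y\<bar> powr p / norm (x - y) powr (real DIM(real ^ 'n) + s * p)) = ?h z"
      using ae2 by eventually_elim (simp add: split_beta n_eq)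
    from integrable_lebesgue_cong_AE(1)[OF this hm] gag show "integrable lborel ?h" by (simp only:)
  qed (rule \<psi>)
  have aeF: "AE z in lborel. F z = t.pairing z"
    using ae2 by eventually_elim (simp add: F_def split_beta n_eq[symmetric] t.pairing_def)
  note F = integrable_lebesgue_cong_AE[OF aeF t.pairing_measurable]
  show "integrable lebesgue F" using F(1) t.integrable_pairing by simp
  have aef: "AE x in lborel. indicator (ball 0 1) x *\<^sub>R (c\<^sub>0 / norm x powr \<alpha> * \<phi> x) = c\<^sub>0 * (\<psi> x / norm x powr \<alpha>)"
    using ae
  proof eventually_elim
    case (elim x)
    then show ?case using \<psi>_out[of x] by (cases "x \<in> ball 0 1") simp_all
  qed
  have "(\<lambda>x. c\<^sub>0 * (\<psi> x / norm x powr \<alpha>)) \<in> borel_measurable borel" by measurable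
  note f = integrable_lebesgue_cong_AE[OF aef this]
  have ball: "ball (0 :: real ^ 'n) 1 \<inter> space lebesgue \<in> sets lebesgue" by simp
  show "integrable (lebesgue_on (ball 0 1)) (\<lambda>x. c\<^sub>0 / norm x powr \<alpha> * \<phi> x)"
    unfolding integrable_restrict_space[OF ball] f(1)
    by (rule integrable_mult_right[OF t.integrable_phi_alpha])
  show "integral\<^sup>L lebesgue F = 2 * integral\<^sup>L (lebesgue_on (ball 0 1)) (\<lambda>x. c\<^sub>0 / norm x powr \<alpha> * \<phi> x)"
    unfolding F(2) integral_restrict_space[OF ball] f(2) t.pairing_integral integral_mult_right_zero ..
qed

lemma f_Lp_loc:
  assumes "0 \<le> t" "\<alpha> * t < n"
  shows "(\<lambda>x :: real ^ 'n. c / norm x powr \<alpha>) \<in> Lp_loc t (ball 0 1)"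
  unfolding Lp_loc_def using assms by (auto intro!: f_Lp borel_compact)

lemma Wsp_loc_subset: "v \<in> Wsp_loc s p UNIV \<Longrightarrow> v \<in> Wsp_loc s p A"
  by (auto simp: Wsp_loc_def compactly_contained_def)

theorem u_local_weak_solution: "local_weak_solution s p (ball 0 1) (\<lambda>x. c\<^sub>0 / norm x powr \<alpha>) u"
  unfolding local_weak_solution_def
proof (intro conjI allI impI)
  have sp0: "s * p > 0" using s_pos p_gt by simp
  have d: "n * p - n + s * p > 0"
  proof -
    have "n * 1 < n * p" using n_pos p_gt by (intro mult_strict_left_mono)
    then show ?thesis using sp0 by linarith
  qed
  show "\<exists>t\<ge>real DIM(real ^ 'n) * p / (real DIM(real ^ 'n) * p - real DIM(real ^ 'n) + s * p). (\<lambda>x :: real ^ 'n. c\<^sub>0 / norm x powr \<alpha>) \<in> Lp_loc t (ball 0 1)"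
  \<comment> \<open>The smallest admissible exponent itself works, by
    \<open>alpha_p\<close>.\<close>
  proof (intro exI[of _ "n * p / (n * p - n + s * p)"] conjI)
    show "(\<lambda>x :: real ^ 'n. c\<^sub>0 / norm x powr \<alpha>) \<in> Lp_loc (n * p / (n * p - n + s * p)) (ball 0 1)"
    proof (rule f_Lp_loc)
      show "0 \<le> n * p / (n * p - n + s * p)" using d n_pos p_gt by simp
      have "\<alpha> * p < n * p - n + s * p" using alpha_p by (simp add: algebra_simps)
      then have "n * (\<alpha> * p) < n * (n * p - n + s * p)" using n_pos by (intro mult_strict_left_mono) auto
      then show "\<alpha> * (n * p / (n * p - n + s * p)) < n" using d by (simp add: divide_less_eq mult_ac)
    qed
  qed (simp add: n_eq)
  show "u \<in> Wsp_loc s p (ball 0 1)" by (rule Wsp_loc_subset[OF u_Wsp_loc])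
  show "u \<in> tail_space s p" by (rule u_tail_space)
  fix \<phi> :: "real ^ 'n \<Rightarrow> real"
  assume "\<phi> \<in> Wsp s p UNIV \<and> compactly_contained {x. \<phi> x \<noteq> 0} (ball 0 1)"
  then show "let F = (\<lambda>(x, y). Jp p (u x - u y) * (\<phi> x - \<phi> y) / norm (x - y) powr (real DIM(real ^ 'n) + s * p))
         in integrable lebesgue F \<and> integrable (lebesgue_on (ball 0 1)) (\<lambda>x. c\<^sub>0 / norm x powr \<alpha> * \<phi> x) \<and>
            integral\<^sup>L lebesgue F = 2 * integral\<^sup>L (lebesgue_on (ball 0 1)) (\<lambda>x. c\<^sub>0 / norm x powr \<alpha> * \<phi> x)"
    unfolding Let_def using weak_solution_identity[of \<phi>] by blast
qed auto

end

section \<open>Optimality\<close>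

text \<open>With a = n / r one has \<gamma> (p - 1) = a - s p, and the bounds on \<open>r\<close>
  become bounds on \<open>a\<close>: a < n, a p < (p - 1) n + p (s p - (p - 1)) and s p - (p - 1) <
  a. The last conclusion identifies the exponent \<open>q\<close> of the theorem as n / (\<gamma> +
  1).\<close>

lemma power_solution_exponent:
  fixes s p p' n r \<gamma> :: real and e :: "real ^ 'n"
  assumes n: "n = real CARD('n)"
    and p: "p > 1" and p': "p' = p / (p - 1)"
    and s: "0 < s" "s < 1"
    and sp': "s * p' > 1"
    and r: "max 1 (n * p / ((p - 1) * (n + p * (s * p' - 1)))) < r"
           "r < n / ((p - 1) * (s * p' - 1))"
    and \<gamma>: "\<gamma> = n / (r * (p - 1)) - s * p'"
    and e: "norm e = 1"
  shows "power_solution n s p \<gamma> e" and "power_solution.\<alpha> s p \<gamma> = n / r"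
    and "\<gamma> + 1 = (n - r * (p - 1) * (s * p' - 1)) / (r * (p - 1))"
proof -
  have n0: "n > 0" using n by simp
  have r1: "r > 1" and r2: "n * p / ((p - 1) * (n + p * (s * p' - 1))) < r" using r(1) by auto
  have pp: "(p - 1) * (s * p') = s * p" using p by (simp add: p')
  define a where "a = n / r"
  have a: "a * r = n" using r1 by (simp add: a_def)
  have \<gamma>p: "\<gamma> * (p - 1) = a - s * p"
  proof -
    have "\<gamma> * (p - 1) = n / (r * (p - 1)) * (p - 1) - (p - 1) * (s * p')"
      unfolding \<gamma> by (subst left_diff_distrib) (simp only: mult.commute)
    moreover have "n / (r * (p - 1)) * (p - 1) = a" using p by (simp add: a_def)
    ultimately show ?thesis using pp by simp
  qed
  have sp_gt: "p - 1 < s * p"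
    using mult_strict_left_mono[OF sp', of "p - 1"] p pp by simp
  have D: "(p - 1) * (n + p * (s * p' - 1)) = (p - 1) * n + p * (s * p - (p - 1))"
    using pp by (simp add: algebra_simps)
  have D0: "(p - 1) * n + p * (s * p - (p - 1)) > 0"
    using p n0 sp_gt by (intro add_pos_pos mult_pos_pos) auto
  have E: "(p - 1) * (s * p' - 1) = s * p - (p - 1)"
    using pp by (simp add: algebra_simps)
  have "n * p < r * ((p - 1) * n + p * (s * p - (p - 1)))"
    using r2 D0 unfolding D by (simp add: divide_less_eq)
  then have "(a * p) * r < ((p - 1) * n + p * (s * p - (p - 1))) * r"
  proof -
    have "(a * p) * r = n * p" using a by (simp add: mult.commute mult.left_commute)
    then show ?thesis using \<open>n * p < _\<close> by (simp only: mult.commute)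
  qed
  then have ap: "a * p < (p - 1) * n + p * (s * p - (p - 1))" using r1 by simp
  have "r * (s * p - (p - 1)) < n" using r(2) sp_gt unfolding E by (simp add: less_divide_eq)
  then have "(s * p - (p - 1)) * r < a * r" using a by (simp add: mult.commute)
  then have a1: "s * p - (p - 1) < a" using r1 by simp
  show ps: "power_solution n s p \<gamma> e"
  proof
    have "- 1 * (p - 1) < \<gamma> * (p - 1)" unfolding \<gamma>p using a1 by simp
    then show "- 1 < \<gamma>" using p by (simp only: mult_less_cancel_right_pos diff_gt_0_iff_gt)
    have "\<gamma> * p * (p - 1) = (\<gamma> * (p - 1)) * p" by simp
    also have "\<dots> < (n - p) * (p - 1)" unfolding \<gamma>p using ap by (simp add: algebra_simps)
    finally have "\<gamma> * p < n - p" using p by simp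
    then show "\<gamma> < n / p - 1" using p by (simp add: field_simps)
    have "a < n" using n0 r1 by (simp add: a_def divide_less_eq)
    then show "\<gamma> * (p - 1) < n - s * p" unfolding \<gamma>p by simp
  qed (use n p s sp_gt e in auto)
  show "power_solution.\<alpha> s p \<gamma> = n / r"
    using power_solution.\<alpha>_def[OF ps] \<gamma>p by (simp add: a_def)
  show "\<gamma> + 1 = (n - r * (p - 1) * (s * p' - 1)) / (r * (p - 1))"
    using p r1 by (simp add: \<gamma> field_simps)
qed

text \<open>For \<gamma> = 0 the gradient of u vanishes, so the failure at exponent \<open>q\<close>
  is stated for \<gamma> \<noteq> 0; it is stated for every weak gradient, hence does not depend on
  a representative. The optimality clause covers \<gamma> = 0 too, since its counterexample has
  another exponent.\<close>

theorem mainTheorem3: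
  fixes s p p' n r \<gamma> C q :: real
    and e :: "real ^ 'n"
    and u f :: "real ^ 'n \<Rightarrow> real"
  assumes n: "n = real CARD('n)"
    and p: "p > 1" and p': "p' = p / (p - 1)"
    and s: "0 < s" "s < 1"
    and sp': "s * p' > 1" and sp: "s * p < n"
    and r: "max 1 (n * p / ((p - 1) * (n + p * (s * p' - 1)))) < r"
           "r < n / ((p - 1) * (s * p' - 1))"
    and \<gamma>: "\<gamma> = n / (r * (p - 1)) - s * p'"
    and u: "u = (\<lambda>x. 1 / norm x powr \<gamma>)"
    and e: "norm e = 1"
    and C: "C = pv_integral (\<lambda>y. \<bar>1 - norm y powr (- \<gamma>)\<bar> powr (p - 2) * (1 - norm y powr (- \<gamma>))
                                   / norm (e - y) powr (n + s * p)) e"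
    and f: "f = (\<lambda>x. C / norm x powr (n / r))"
    and q: "q = r * n * (p - 1) / (n - r * (p - 1) * (s * p' - 1))"
  shows "(\<forall>x. x \<noteq> 0 \<longrightarrow> has_frac_p_Laplacian s p u x (f x)) \<and>
    u \<in> Wsp_loc s p UNIV \<and> u \<in> tail_space s p \<and>
    local_weak_solution s p (ball 0 1) f u \<and>
    (\<forall>r'. 0 < r' \<and> r' < r \<longrightarrow> f \<in> Lp r' (ball 0 1)) \<and>
    (\<exists>G. (\<forall>x. x \<noteq> 0 \<longrightarrow> GDERIV u x :> G x) \<and> is_weak_gradient (ball 0 1) u G \<and>
       (\<forall>q'. 0 < q' \<and> q' < q \<longrightarrow> (\<lambda>x. norm (G x)) \<in> Lp q' (ball 0 1))) \<and>
    (\<gamma> \<noteq> 0 \<longrightarrow>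
       (\<forall>G. is_weak_gradient (ball 0 1) u G \<longrightarrow> (\<lambda>x. norm (G x)) \<notin> Lp q (ball 0 1))) \<and>
    (\<forall>r'. 0 < r' \<and> r' < r \<longrightarrow>
       \<not> (\<forall>(g :: real ^ 'n \<Rightarrow> real) v.
            g \<in> Lp_loc r' (ball 0 1) \<and> local_weak_solution s p (ball 0 1) g v \<longrightarrow>
            (\<exists>G. is_weak_gradient (ball 0 1) v G \<and> (\<lambda>x. norm (G x)) \<in> Lp_loc q (ball 0 1))))"
proof -
  note exponent = power_solution_exponent[OF n p p' s sp' _ _ refl e]
  interpret S: power_solution n s p \<gamma> e
    unfolding \<gamma> by (rule exponent(1)[OF r])
  have \<alpha>: "S.\<alpha> = n / r" unfolding \<gamma> by (rule exponent(2)[OF r])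
  have u_S: "u = S.u" by (simp add: fun_eq_iff u S.u_def)
  have C_S: "C = S.c\<^sub>0" unfolding C by (rule S.c\<^sub>0_eq_pv[symmetric])
  have f_S: "f = (\<lambda>x. S.c\<^sub>0 / norm x powr S.\<alpha>)" by (simp add: f C_S \<alpha>)
  have r0: "r > 1" using r(1) by simp
  have \<gamma>1: "\<gamma> + 1 > 0" using S.gamma_gt by simp
  have q_eq: "q = n / (\<gamma> + 1)"
    using exponent(3)[OF r] \<gamma>1 p r0 unfolding \<gamma>[symmetric] q by (simp add: mult_ac)
  have half: "ball (0 :: real ^ 'n) (1 / 2) \<subseteq> ball 0 1" "cball (0 :: real ^ 'n) (1 / 2) \<subseteq> ball 0 1"
    by auto
  have "f \<in> Lp r' (ball 0 1)" if "0 < r'" "r' < r" for r'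
  proof -
    have "S.\<alpha> * r' < n" unfolding \<alpha> using that S.n_pos r0 by (simp add: divide_less_eq)
    then show ?thesis unfolding f_S using that by (intro S.f_Lp) auto
  qed
  moreover have "(\<lambda>x. norm (S.grad x)) \<in> Lp q' (ball 0 1)" if "0 < q'" "q' < q" for q'
    using that \<gamma>1 by (intro S.grad_Lp) (auto simp: q_eq field_simps)
  moreover have "(\<lambda>x. norm (G x)) \<notin> Lp q (ball 0 1)" if "\<gamma> \<noteq> 0" "is_weak_gradient (ball 0 1) u G" for G
    using S.weak_gradient_not_Lp[OF that(1) that(2)[unfolded u_S], of q] Lp_subset[OF _ half(1), of _ q] by (auto simp: q_eq)
  moreover have "\<not> (\<forall>(g :: real ^ 'n \<Rightarrow> real) v.
            g \<in> Lp_loc r' (ball 0 1) \<and> local_weak_solution s p (ball 0 1) g v \<longrightarrow>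
            (\<exists>G. is_weak_gradient (ball 0 1) v G \<and> (\<lambda>x. norm (G x)) \<in> Lp_loc q (ball 0 1)))"
    if r': "0 < r'" "r' < r" for r'
  proof
    assume all: "\<forall>(g :: real ^ 'n \<Rightarrow> real) v.
            g \<in> Lp_loc r' (ball 0 1) \<and> local_weak_solution s p (ball 0 1) g v \<longrightarrow>
            (\<exists>G. is_weak_gradient (ball 0 1) v G \<and> (\<lambda>x. norm (G x)) \<in> Lp_loc q (ball 0 1))"
    \<comment> \<open>Every t strictly between \<open>m\<close> and \<open>r\<close> satisfies the
      hypotheses on \<open>r\<close> and exceeds \<open>r'\<close>.\<close>
    define m where "m = max r' (max 1 (n * p / ((p - 1) * (n + p * (s * p' - 1)))))"
    have m: "m < r" using r' r(1) by (simp add: m_def)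
    define \<Gamma> where "\<Gamma> t = n / (t * (p - 1)) - s * p'" for t
    have mono: "\<Gamma> t' < \<Gamma> t" if "0 < t" "t < t'" for t t'
      unfolding \<Gamma>_def using that p S.n_pos by (intro diff_strict_right_mono divide_strict_left_mono mult_strict_right_mono) auto
    have m0: "m > 0" using r'(1) by (simp add: m_def)
    \<comment> \<open>\<Gamma> is strictly decreasing, so of two candidates at most one gives the
      exponent 0, that is the constant solution.\<close>
    obtain t where t: "m < t" "t < r" "\<Gamma> t \<noteq> 0"
    proof -
      obtain t where t: "m < t" "t < r" using m dense by blast
      obtain t' where t': "t < t'" "t' < r" using t dense by blast
      show thesis
      proof (cases "\<Gamma> t = 0")
        case True
        then have "\<Gamma> t' \<noteq> 0" using mono[of t t'] t t' m0 by simp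
        then show thesis using t t' by (intro that[of t']) auto
      next
        case False
        then show thesis using t by (intro that[of t]) auto
      qed
    qed
    have rt: "max 1 (n * p / ((p - 1) * (n + p * (s * p' - 1)))) < t" "t < n / ((p - 1) * (s * p' - 1))"
      using t r(2) by (auto simp: m_def)
    interpret T: power_solution n s p "\<Gamma> t" e
      unfolding \<Gamma>_def by (rule exponent(1)[OF rt])
    have \<alpha>t: "T.\<alpha> = n / t" unfolding \<Gamma>_def by (rule exponent(2)[OF rt])
    have "T.\<alpha> * r' < n"
    proof -
      have "r' < t" using t by (simp add: m_def)
      then show ?thesis unfolding \<alpha>t using r' S.n_pos by (simp add: divide_less_eq)
    qed
    then have "(\<lambda>x :: real ^ 'n. T.c\<^sub>0 / norm x powr T.\<alpha>) \<in> Lp_loc r' (ball 0 1)"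
      using r' by (intro T.f_Lp_loc) auto
    with all T.u_local_weak_solution obtain G where G: "is_weak_gradient (ball 0 1) T.u G"
        "(\<lambda>x. norm (G x)) \<in> Lp_loc q (ball 0 1)"
      by blast
    \<comment> \<open>\<open>Lp_loc\<close> speaks of compact sets only; the closed half ball
      already contains the singularity at the origin.\<close>
    have "(\<lambda>x. norm (G x)) \<in> Lp q (cball 0 (1 / 2))"
      using G(2) half(2) by (auto simp: Lp_loc_def)
    then have "(\<lambda>x. norm (G x)) \<in> Lp q (ball 0 (1 / 2))"
      by (rule Lp_subset) auto
    \<comment> \<open>Because t < r, the new solution is more singular than u, so \<open>q\<close>
      is not below its critical exponent.\<close>
    moreover have "n / (\<Gamma> t + 1) \<le> q"
    proof -
      have "\<gamma> < \<Gamma> t" using mono[of t r] t m0 by (simp add: \<Gamma>_def \<gamma>)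
      then show ?thesis unfolding q_eq using \<gamma>1 S.n_pos by (intro divide_left_mono) auto
    qed
    ultimately show False using T.weak_gradient_not_Lp[OF t(3) G(1)] by blast
  qed
  ultimately show ?thesis
    using S.has_frac_p_Laplacian_u S.u_Wsp_loc S.u_tail_space S.u_local_weak_solution S.GDERIV_u S.is_weak_gradient_grad
    unfolding u_S f_S by blast
qed

end
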